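(* For every $0<t\leq 1$ there is an irreducible continuous representation $\varrho\colon\mathrm{Is}(\mathbf{H}_{\mathbf{C}}^\infty)\to\mathrm{Is}(\mathbf{H}_{\mathbf{C}}^\infty)$ together with a $\varrho$-equivariant map $f\colon\mathbf{H}_{\mathbf{C}}^\infty\to\mathbf{H}_{\mathbf{C}}^\infty$ satisfying $$\cosh d\big(f(x),f(y)\big)=\big(\cosh d(x,y)\big)^t\quad\text{and}\quad\mathrm{Cart}\big(f(x),f(y),f(z)\big)=t\,\mathrm{Cart}(x,y,z)$$ for all $x,y,z\in\mathbf{H}_{\mathbf{C}}^\infty$.
   Context: Sesquilinear forms are linear in the second variable. For a complex Hilbert space $H$ of Hilbertian dimension $\kappa$, let $B(z\oplus u,w\oplus v)=\overline{z}w-\langle u,v\rangle$ on $\mathbf{C}\oplus H$. The complex hyperbolic space $\mathbf{H}_{\mathbf{C}}^\kappa$ is the projectivisation of the set of $B$-positive vectors, with distance $\cosh d(x,y)=|B(X,Y)|/(B(X,X)B(Y,Y))^{1/2}$ for any representatives $X,Y$ of $x,y$; $\mathbf{H}_{\mathbf{C}}^\infty$ is the case $\kappa=\aleph_0$. $\mathrm{Is}(\mathbf{H}_{\mathbf{C}}^\kappa)$ is the full isometry group (holomorphic isometries, i.e. $\mathbf{PU}(B)$, together with anti-holomorphic ones), with the topology of pointwise convergence. The Cartan argument $\mathrm{Cart}(x,y,z)\in(-\tfrac\pi2,\tfrac\pi2)$ of three points represented by positive vectors $X,Y,Z$ is the argument of $B(X,Y)B(Y,Z)B(Z,X)$ (which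 has positive real part). An isometric action on $\mathbf{H}_{\mathbf{C}}^\kappa$ ($\kappa\geq 2$) is irreducible if the associated projective action on $\mathbf{C}\oplus H$ has no closed invariant complex subspace other than $0$ and the whole space. Equivalently, it is non-elementary (it preserves no non-empty finite subset of $\mathbf{H}_{\mathbf{C}}^\kappa\cup\partial\mathbf{H}_{\mathbf{C}}^\kappa$) and minimal (no orbit is contained in a proper complex hyperbolic subspace). Here $\partial\mathbf{H}_{\mathbf{C}}^\kappa$ is the space of $B$-isotropic lines. The map $f$ is $\varrho$-equivariant if $f(gx)=\varrho(g)f(x)$ for all $g,x$. *)

theory Defs
  imports "HOL-Analysis.Analysis" "HOL-Algebra.Group"
begin

section \<open>The Hilbert space of square-summable complex sequences\<close>

text \<open>Up to isomorphism this is the unique complex Hilbert space of Hilbertian dimension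
  \<open>\<aleph>\<^sub>0\<close>.\<close>

typedef ell2 = "{u :: nat \<Rightarrow> complex. summable (\<lambda>n. (cmod (u n))\<^sup>2)}"
  morphisms coord Abs_ell2
  by (rule exI[of _ "\<lambda>_. 0"]) simp

setup_lifting type_definition_ell2

lemma summable_coord: "summable (\<lambda>n. (cmod (coord u n))\<^sup>2)"
  using coord[of u] by simp

lemma cmod_add_square_le: "(cmod (a + b))\<^sup>2 \<le> 2 * (cmod a)\<^sup>2 + 2 * (cmod b)\<^sup>2"
proof -
  have "(cmod (a + b))\<^sup>2 \<le> (cmod a + cmod b)\<^sup>2"
    by (intro power_mono norm_triangle_ineq) auto
  also have "\<dots> \<le> 2 * (cmod a)\<^sup>2 + 2 * (cmod b)\<^sup>2"
    using sum_squares_bound[of "cmod a" "cmod b"] by (simp add: power2_sum)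
  finally show ?thesis .
qed

lemma summable_square_add:
  assumes "summable (\<lambda>n. (cmod (u n))\<^sup>2)" "summable (\<lambda>n. (cmod (v n))\<^sup>2)"
  shows "summable (\<lambda>n. (cmod (u n + v n))\<^sup>2)"
proof (rule summable_comparison_test')
  show "summable (\<lambda>n. 2 * (cmod (u n))\<^sup>2 + 2 * (cmod (v n))\<^sup>2)"
    by (intro summable_add summable_mult assms)
qed (simp add: cmod_add_square_le)

lemma summable_square_scale:
  assumes "summable (\<lambda>n. (cmod (u n))\<^sup>2)"
  shows "summable (\<lambda>n. (cmod (c * u n))\<^sup>2)"
  using summable_mult[OF assms, of "(cmod c)\<^sup>2"] by (simp add: norm_mult power_mult_distrib)

lift_definition scaleC :: "complex \<Rightarrow> ell2 \<Rightarrow> ell2" is "\<lambda>c u n. c * u n"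
  by (rule summable_square_scale)

definition cinner :: "ell2 \<Rightarrow> ell2 \<Rightarrow> complex" where
  "cinner u v = (\<Sum>n. cnj (coord u n) * coord v n)"

lemma summable_cinner: "summable (\<lambda>n. cnj (coord u n) * coord v n)"
proof (rule summable_comparison_test')
  show "summable (\<lambda>n. (cmod (coord u n))\<^sup>2 + (cmod (coord v n))\<^sup>2)"
    by (intro summable_add summable_coord)
next
  fix n
  have "2 * (cmod (coord u n) * cmod (coord v n)) \<le> (cmod (coord u n))\<^sup>2 + (cmod (coord v n))\<^sup>2"
    using sum_squares_bound[of "cmod (coord u n)" "cmod (coord v n)"] by (simp add: mult.assoc)
  moreover have "0 \<le> cmod (coord u n) * cmod (coord v n)" by simp
  ultimately show "norm (cnj (coord u n) * coord v n) \<le> (cmod (coord u n))\<^sup>2 + (cmod (coord v n))\<^sup>2"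
    unfolding norm_mult complex_mod_cnj by linarith
qed

instantiation ell2 :: real_vector
begin

lift_definition zero_ell2 :: ell2 is "\<lambda>_. 0" by simp
lift_definition plus_ell2 :: "ell2 \<Rightarrow> ell2 \<Rightarrow> ell2" is "\<lambda>u v n. u n + v n"
  by (rule summable_square_add)
lift_definition uminus_ell2 :: "ell2 \<Rightarrow> ell2" is "\<lambda>u n. - u n" by simp
lift_definition minus_ell2 :: "ell2 \<Rightarrow> ell2 \<Rightarrow> ell2" is "\<lambda>u v n. u n - v n"
  subgoal for u v using summable_square_add[of u "\<lambda>n. - v n"] by simp
  done
definition scaleR_ell2 :: "real \<Rightarrow> ell2 \<Rightarrow> ell2" where
  "scaleR_ell2 r = scaleC (of_real r)"

instance
proof
  fix u v w :: ell2 and a b :: real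
  show "u + v + w = u + (v + w)" by transfer (simp add: add.assoc)
  show "u + v = v + u" by transfer (simp add: add.commute)
  show "0 + u = u" by transfer simp
  show "- u + u = 0" by transfer simp
  show "u - v = u + - v" by transfer simp
  show "a *\<^sub>R (u + v) = a *\<^sub>R u + a *\<^sub>R v"
    unfolding scaleR_ell2_def by transfer (simp add: algebra_simps)
  show "(a + b) *\<^sub>R u = a *\<^sub>R u + b *\<^sub>R u"
    unfolding scaleR_ell2_def by transfer (simp add: algebra_simps)
  show "a *\<^sub>R b *\<^sub>R u = (a * b) *\<^sub>R u"
    unfolding scaleR_ell2_def by transfer (simp add: algebra_simps)
  show "1 *\<^sub>R u = u"
    unfolding scaleR_ell2_def by transfer simp
qed

end

instantiation ell2 :: real_inner
begin

definition inner_ell2 :: "ell2 \<Rightarrow> ell2 \<Rightarrow> real" where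
  "inner_ell2 u v = Re (cinner u v)"
definition norm_ell2 :: "ell2 \<Rightarrow> real" where
  "norm_ell2 u = sqrt (inner u u)"
definition sgn_ell2 :: "ell2 \<Rightarrow> ell2" where
  "sgn_ell2 u = u /\<^sub>R norm u"
definition dist_ell2 :: "ell2 \<Rightarrow> ell2 \<Rightarrow> real" where
  "dist_ell2 u v = norm (u - v)"
definition uniformity_ell2 :: "(ell2 \<times> ell2) filter" where
  "uniformity_ell2 = (INF e\<in>{0<..}. principal {(u, v). dist u v < e})"
definition open_ell2 :: "ell2 set \<Rightarrow> bool" where
  "open_ell2 U \<longleftrightarrow> (\<forall>u\<in>U. \<forall>\<^sub>F (u', v) in uniformity. u' = u \<longrightarrow> v \<in> U)"

lemma inner_ell2_alt: "inner u v = (\<Sum>n. Re (cnj (coord u n) * coord v n))" for u v :: ell2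
  unfolding inner_ell2_def cinner_def by (rule Re_suminf[OF summable_cinner])

instance
proof
  fix u v w :: ell2 and r :: real and U :: "ell2 set"
  show "sgn u = u /\<^sub>R norm u" by (rule sgn_ell2_def)
  show "dist u v = norm (u - v)" by (rule dist_ell2_def)
  show "uniformity = (INF e\<in>{0<..}. principal {(u, v :: ell2). dist u v < e})"
    by (rule uniformity_ell2_def)
  show "open U \<longleftrightarrow> (\<forall>u\<in>U. \<forall>\<^sub>F (u', v) in uniformity. u' = u \<longrightarrow> v \<in> U)"
    by (rule open_ell2_def)
  show "inner u v = inner v u"
    unfolding inner_ell2_alt by (simp add: mult.commute)
  have sm: "summable (\<lambda>n. Re (cnj (coord x n) * coord y n))" for x y
    by (rule summable_Re[OF summable_cinner])
  show "inner (u + v) w = inner u w + inner v w"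
    unfolding inner_ell2_alt suminf_add[OF sm sm]
    by (simp add: plus_ell2.rep_eq algebra_simps)
  show "inner (r *\<^sub>R u) v = r * inner u v"
    unfolding inner_ell2_alt suminf_mult[OF sm, symmetric]
    by (simp add: scaleR_ell2_def scaleC.rep_eq algebra_simps)
  have sq: "inner u u = (\<Sum>n. (cmod (coord u n))\<^sup>2)"
    unfolding inner_ell2_alt cmod_power2 by (simp add: power2_eq_square)
  show "0 \<le> inner u u"
    unfolding sq by (intro suminf_nonneg summable_coord) simp
  show "inner u u = 0 \<longleftrightarrow> u = 0"
    unfolding sq suminf_eq_zero_iff[OF summable_coord zero_le_power2]
    by (auto simp: coord_inject[symmetric] zero_ell2.rep_eq fun_eq_iff)
  show "norm u = sqrt (inner u u)" by (rule norm_ell2_def)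
qed

end

lemma cinner_add_left: "cinner (u + v) w = cinner u w + cinner v w"
  unfolding cinner_def suminf_add[OF summable_cinner summable_cinner]
  by (simp add: plus_ell2.rep_eq algebra_simps)

lemma cinner_add_right: "cinner w (u + v) = cinner w u + cinner w v"
  unfolding cinner_def suminf_add[OF summable_cinner summable_cinner]
  by (simp add: plus_ell2.rep_eq algebra_simps)

lemma cinner_scaleC_right: "cinner u (scaleC c v) = c * cinner u v"
  unfolding cinner_def suminf_mult[OF summable_cinner, symmetric]
  by (simp add: scaleC.rep_eq algebra_simps)

lemma cinner_commute: "cinner v u = cnj (cinner u v)"
proof -
  have "(\<lambda>n. cnj (cnj (coord u n) * coord v n)) sums cnj (cinner u v)"
    unfolding cinner_def sums_cnj by (rule summable_sums[OF summable_cinner])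
  then show ?thesis
    by (simp add: cinner_def sums_iff mult.commute)
qed

lemma cinner_scaleC_left: "cinner (scaleC c u) v = cnj c * cinner u v"
  by (metis cinner_commute cinner_scaleC_right complex_cnj_mult)

lemma cinner_self: "cinner u u = of_real ((norm u)\<^sup>2)"
proof (rule complex_eqI)
  show "Re (cinner u u) = Re (of_real ((norm u)\<^sup>2))"
    by (simp add: power2_norm_eq_inner inner_ell2_def)
  show "Im (cinner u u) = Im (of_real ((norm u)\<^sup>2))"
    using arg_cong[OF cinner_commute[of u u], of Im] by simp
qed

lemma norm_scaleC: "norm (scaleC c u) = cmod c * norm u"
proof -
  have "complex_of_real ((norm (scaleC c u))\<^sup>2) = of_real ((cmod c * norm u)\<^sup>2)"
    unfolding cinner_self[symmetric] power_mult_distrib of_real_mult complex_norm_square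
    by (simp add: cinner_scaleC_left cinner_scaleC_right)
  then have "(norm (scaleC c u))\<^sup>2 = (cmod c * norm u)\<^sup>2"
    using of_real_eq_iff by blast
  then show ?thesis
    by (simp add: power2_eq_iff_nonneg)
qed

lemma cmod_cinner_le: "cmod (cinner u v) \<le> norm u * norm v"
proof (cases "cinner u v = 0")
  case False
  define c where "c = cnj (cinner u v) / cmod (cinner u v)"
  have "c * cinner u v = of_real (cmod (cinner u v))"
    using False unfolding c_def
    by (simp add: complex_norm_square[symmetric] mult.commute power2_eq_square)
  then have "cmod (cinner u v) = inner u (scaleC c v)"
    by (simp add: inner_ell2_def cinner_scaleC_right)
  also have "\<dots> \<le> norm u * norm (scaleC c v)" by (rule norm_cauchy_schwarz)
  also have "\<dots> = norm u * norm v"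
    using False by (simp add: norm_scaleC c_def norm_divide)
  finally show ?thesis .
qed simp


section \<open>The form \<open>B\<close> on \<open>\<complex> \<oplus> H\<close>\<close>

type_synonym cvec = "complex \<times> ell2"

fun cscale :: "complex \<Rightarrow> cvec \<Rightarrow> cvec" where
  "cscale c (z, u) = (c * z, scaleC c u)"

fun B :: "cvec \<Rightarrow> cvec \<Rightarrow> complex" where
  "B (z, u) (w, v) = cnj z * w - cinner u v"

interpretation cvec: vector_space cscale
proof
  fix a b :: complex and x y :: cvec
  have *: "scaleC a (u + v) = scaleC a u + scaleC a v"
    "scaleC (a + b) u = scaleC a u + scaleC b u"
    "scaleC a (scaleC b u) = scaleC (a * b) u" "scaleC 1 u = u" for u v
    by (transfer; simp add: algebra_simps)+
  show "cscale a (x + y) = cscale a x + cscale a y"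
    "cscale (a + b) x = cscale a x + cscale b x"
    "cscale a (cscale b x) = cscale (a * b) x" "cscale 1 x = x"
    by (cases x; cases y; simp add: * algebra_simps)+
qed

lemma B_add_left: "B (X + Y) Z = B X Z + B Y Z"
  by (cases X; cases Y; cases Z) (simp add: cinner_add_left algebra_simps)

lemma B_add_right: "B Z (X + Y) = B Z X + B Z Y"
  by (cases X; cases Y; cases Z) (simp add: cinner_add_right algebra_simps)

lemma B_scale_left: "B (cscale c X) Y = cnj c * B X Y"
  by (cases X; cases Y) (simp add: cinner_scaleC_left algebra_simps)

lemma B_scale_right: "B X (cscale c Y) = c * B X Y"
  by (cases X; cases Y) (simp add: cinner_scaleC_right algebra_simps)

lemma B_commute: "B Y X = cnj (B X Y)"
  by (cases X; cases Y) (simp add: cinner_commute[of "snd X" "snd Y"] mult.commute, metis cinner_commute)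

lemma B_self_real: "B X X = of_real (Re (B X X))"
  by (cases X) (simp add: cinner_self complex_norm_square[symmetric] mult.commute[of "cnj _"])

lemma Re_B_self: "Re (B (z, u) (z, u)) = (cmod z)\<^sup>2 - (norm u)\<^sup>2"
proof -
  have "(cmod z)\<^sup>2 = Re z * Re z + Im z * Im z"
    using cmod_power2[of z] by (simp only: power2_eq_square)
  then show ?thesis by (simp add: cinner_self)
qed

declare cscale.simps [simp del]

text \<open>\<open>B X X\<close> is real by \<open>B_self_real\<close>.\<close>
definition B_positive :: "cvec \<Rightarrow> bool" where
  "B_positive X \<longleftrightarrow> 0 < Re (B X X)"

lemma B_positive_orth:
  assumes "B_positive Y" "B Y W = 0" "W \<noteq> 0"
  shows "Re (B W W) < 0"
proof -
  obtain z u w v where Y: "Y = (z, u)" and W: "W = (w, v)" by (cases Y; cases W)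
  have "(norm u)\<^sup>2 < (cmod z)\<^sup>2"
    using assms(1) unfolding Y B_positive_def Re_B_self by simp
  then have less: "norm u < cmod z"
    by (rule power_less_imp_less_base) simp
  then have z: "z \<noteq> 0" using norm_ge_zero[of u] by auto
  have eq: "cnj z * w = cinner u v" using assms(2) unfolding Y W by simp
  have v: "v \<noteq> 0"
  proof
    assume "v = 0"
    then have "cmod (cinner u v) \<le> 0" using cmod_cinner_le[of u v] by simp
    then have "w = 0" using eq z by simp
    with \<open>v = 0\<close> show False using assms(3) W by (simp add: zero_prod_def)
  qed
  have "cmod z * cmod w = cmod (cinner u v)"
    using arg_cong[OF eq, of cmod] by (simp add: norm_mult)
  also have "\<dots> \<le> norm u * norm v" by (rule cmod_cinner_le)
  also have "\<dots> < cmod z * norm v" using less v by simp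
  finally have "cmod w < norm v" using z by simp
  then have "(cmod w)\<^sup>2 < (norm v)\<^sup>2" by (intro power_strict_mono) auto
  then show ?thesis unfolding W Re_B_self by simp
qed

lemma B_diff_left: "B (X - Y) Z = B X Z - B Y Z"
  using B_add_left[of "X - Y" Y Z] by simp

lemma B_diff_right: "B Z (X - Y) = B Z X - B Z Y"
  using B_add_right[of Z "X - Y" Y] by simp

lemma B_zero [simp]: "B 0 X = 0" "B X 0 = 0"
  using B_add_left[of 0 0 X] B_add_right[of X 0 0] by simp_all

lemma B_mult_commute: "B X Y * B Y X = of_real ((cmod (B X Y))\<^sup>2)"
  unfolding B_commute[of Y X] by (simp only: complex_norm_square)

lemma B_cauchy_schwarz_orth:
  assumes Y: "B_positive Y" and V: "B Y V = 0" and W: "B Y W = 0"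
  shows "(cmod (B V W))\<^sup>2 \<le> Re (B V V) * Re (B W W)"
proof (cases "V = 0")
  case False
  define k where "k = Re (B V V)"
  have k: "k < 0" unfolding k_def by (rule B_positive_orth[OF Y V False])
  have VV: "B V V = of_real k" unfolding k_def by (rule B_self_real)
  define W' where "W' = W - cscale (B V W / of_real k) V"
  have VW': "B V W' = 0" unfolding W'_def B_diff_right B_scale_right VV using k by simp
  have "B W' W' = B W W' - cnj (B V W / of_real k) * B V W'"
    unfolding W'_def by (simp only: B_diff_left B_scale_left)
  also have "\<dots> = B W W - B V W / of_real k * B W V"
    unfolding VW' unfolding W'_def by (simp only: B_diff_right B_scale_right) simp
  also have "\<dots> = B W W - of_real ((cmod (B V W))\<^sup>2 / k)"
    using B_mult_commute[of V W] by simp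
  finally have "Re (B W' W') = Re (B W W) - (cmod (B V W))\<^sup>2 / k" by simp
  moreover have "B Y W' = 0" unfolding W'_def B_diff_right B_scale_right V W by simp
  then have "Re (B W' W') \<le> 0"
    using B_positive_orth[OF Y, of W'] by (cases "W' = 0") auto
  ultimately have "Re (B W W) \<le> (cmod (B V W))\<^sup>2 / k" by simp
  then show ?thesis using k unfolding k_def[symmetric] by (simp add: field_simps)
qed simp

text \<open>The hyperbolic cosine of the distance between the points represented by \<open>X\<close> and \<open>Y\<close>.\<close>
definition cosh_ratio :: "cvec \<Rightarrow> cvec \<Rightarrow> real" where
  "cosh_ratio X Y = cmod (B X Y) / sqrt (Re (B X X) * Re (B Y Y))"

lemma B_reverse_cauchy_schwarz:
  assumes "B_positive X" "B_positive Y"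
  shows "Re (B X X) * Re (B Y Y) \<le> (cmod (B X Y))\<^sup>2"
    and "Re (B X X) * Re (B Y Y) = (cmod (B X Y))\<^sup>2 \<Longrightarrow> Y = cscale (B X Y / B X X) X"
proof -
  define k where "k = Re (B X X)"
  have k: "k > 0" using assms unfolding k_def B_positive_def by simp
  have XX: "B X X = of_real k" unfolding k_def by (rule B_self_real)
  define W where "W = Y - cscale (B X Y / of_real k) X"
  have XW: "B X W = 0" unfolding W_def B_diff_right B_scale_right XX using k by simp
  have "B W W = B Y W - cnj (B X Y / of_real k) * B X W"
    unfolding W_def by (simp only: B_diff_left B_scale_left)
  also have "\<dots> = B Y Y - B X Y / of_real k * B Y X"
    unfolding XW unfolding W_def by (simp only: B_diff_right B_scale_right) simp
  also have "\<dots> = B Y Y - of_real ((cmod (B X Y))\<^sup>2 / k)"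
    using B_mult_commute[of X Y] by simp
  finally have WW: "Re (B W W) = Re (B Y Y) - (cmod (B X Y))\<^sup>2 / k" by simp
  have neg: "W \<noteq> 0 \<Longrightarrow> Re (B W W) < 0" using B_positive_orth[OF assms(1) XW] by simp
  then have "Re (B W W) \<le> 0" by (cases "W = 0") auto
  then show "Re (B X X) * Re (B Y Y) \<le> (cmod (B X Y))\<^sup>2"
    unfolding WW k_def[symmetric] using k by (simp add: field_simps)
  assume "Re (B X X) * Re (B Y Y) = (cmod (B X Y))\<^sup>2"
  then have "Re (B W W) = 0" unfolding WW k_def[symmetric] using k by (simp add: field_simps)
  then have "W = 0" using neg by fastforce
  then show "Y = cscale (B X Y / B X X) X" unfolding W_def XX by simp
qed

lemma cosh_ratio_ge_1:
  assumes "B_positive X" "B_positive Y"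
  shows "1 \<le> cosh_ratio X Y"
proof -
  have "0 < Re (B X X) * Re (B Y Y)" using assms unfolding B_positive_def by simp
  moreover have "sqrt (Re (B X X) * Re (B Y Y)) \<le> cmod (B X Y)"
    by (rule real_le_lsqrt) (use B_reverse_cauchy_schwarz(1)[OF assms] in auto)
  ultimately show ?thesis unfolding cosh_ratio_def by (simp add: le_divide_eq)
qed

lemma cosh_ratio_commute: "cosh_ratio Y X = cosh_ratio X Y"
  unfolding cosh_ratio_def B_commute[of Y X] by (simp add: mult.commute)

lemma Re_B_scale: "Re (B (cscale c X) (cscale c X)) = (cmod c)\<^sup>2 * Re (B X X)"
  by (cases X) (simp add: cscale.simps Re_B_self norm_mult norm_scaleC power_mult_distrib algebra_simps
    del: B.simps)

lemma cosh_ratio_scale_left: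
  assumes "c \<noteq> 0"
  shows "cosh_ratio (cscale c X) Y = cosh_ratio X Y"
  unfolding cosh_ratio_def Re_B_scale unfolding B_scale_left
  using assms by (simp add: norm_mult real_sqrt_mult)

lemma cosh_ratio_scale_right:
  assumes "c \<noteq> 0"
  shows "cosh_ratio X (cscale c Y) = cosh_ratio X Y"
  using cosh_ratio_scale_left[OF assms, of Y X] by (simp add: cosh_ratio_commute)

lemma cosh_ratio_triangle:
  assumes X: "B_positive X" and Y: "B_positive Y" and Z: "B_positive Z"
  defines "a \<equiv> cosh_ratio X Y" and "b \<equiv> cosh_ratio Y Z"
  shows "cosh_ratio X Z \<le> a * b + sqrt (a\<^sup>2 - 1) * sqrt (b\<^sup>2 - 1)"
proof -
  define k l m where "k = Re (B X X)" and "l = Re (B Y Y)" and "m = Re (B Z Z)"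
  have klm: "k > 0" "l > 0" "m > 0"
    using X Y Z unfolding k_def l_def m_def B_positive_def by simp_all
  have YY: "B Y Y = of_real l" unfolding l_def by (rule B_self_real)
  define P where "P U = U - cscale (B Y U / of_real l) Y" for U
  have YP: "B Y (P U) = 0" for U
    unfolding P_def B_diff_right B_scale_right YY using klm by simp
  have PP: "B (P U) (P V) = B U V - B U Y * B Y V / of_real l" for U V
  proof -
    have "B (P U) (P V) = B U (P V) - cnj (B Y U / of_real l) * B Y (P V)"
      by (subst P_def) (simp only: B_diff_left B_scale_left)
    also have "\<dots> = B U V - B U Y * B Y V / of_real l"
      unfolding YP unfolding P_def by (simp only: B_diff_right B_scale_right) simp
    finally show ?thesis .
  qed
  have RePP: "Re (B (P U) (P U)) = Re (B U U) - (cmod (B Y U))\<^sup>2 / l" for U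
    unfolding PP B_mult_commute[of U Y] of_real_divide[symmetric]
    by (simp add: B_commute[of U Y])
  have a2: "a\<^sup>2 = (cmod (B Y X))\<^sup>2 / (k * l)"
    unfolding a_def cosh_ratio_def k_def[symmetric] l_def[symmetric] power_divide
    using klm by (simp add: B_commute[of X Y])
  have b2: "b\<^sup>2 = (cmod (B Y Z))\<^sup>2 / (l * m)"
    unfolding b_def cosh_ratio_def m_def[symmetric] l_def[symmetric] power_divide
    using klm by simp
  have pX: "- Re (B (P X) (P X)) = k * (a\<^sup>2 - 1)"
    unfolding RePP a2 k_def[symmetric] using klm by (simp add: field_simps)
  have pZ: "- Re (B (P Z) (P Z)) = m * (b\<^sup>2 - 1)"
    unfolding RePP b2 m_def[symmetric] using klm by (simp add: field_simps)
  have "(cmod (B (P X) (P Z)))\<^sup>2 \<le> (- Re (B (P X) (P X))) * (- Re (B (P Z) (P Z)))"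
    using B_cauchy_schwarz_orth[OF Y YP YP] by simp
  then have cs: "cmod (B (P X) (P Z)) \<le> sqrt (k * (a\<^sup>2 - 1) * (m * (b\<^sup>2 - 1)))"
    unfolding pX pZ by (rule real_le_rsqrt)
  have "B X Z = B (P X) (P Z) + B X Y * B Y Z / of_real l" unfolding PP by simp
  then have "cmod (B X Z) \<le> cmod (B (P X) (P Z)) + cmod (B X Y) * cmod (B Y Z) / l"
    using norm_triangle_ineq[of "B (P X) (P Z)" "B X Y * B Y Z / of_real l"] klm
    by (simp add: norm_mult norm_divide)
  also have "\<dots> \<le> sqrt k * sqrt m * (sqrt (a\<^sup>2 - 1) * sqrt (b\<^sup>2 - 1)) + sqrt k * sqrt m * (a * b)"
  proof (rule add_mono)
    show "cmod (B (P X) (P Z)) \<le> sqrt k * sqrt m * (sqrt (a\<^sup>2 - 1) * sqrt (b\<^sup>2 - 1))"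
      using cs by (simp add: real_sqrt_mult ac_simps)
    have "cmod (B X Y) * cmod (B Y Z) / l = sqrt k * sqrt m * (a * b)"
      unfolding a_def b_def cosh_ratio_def k_def[symmetric] l_def[symmetric] m_def[symmetric]
      using klm by (simp add: real_sqrt_mult field_simps)
    then show "cmod (B X Y) * cmod (B Y Z) / l \<le> sqrt k * sqrt m * (a * b)" by simp
  qed
  finally show ?thesis
    unfolding cosh_ratio_def k_def[symmetric] m_def[symmetric]
    using klm by (simp add: real_sqrt_mult field_simps)
qed


section \<open>Complex hyperbolic space of dimension \<open>\<aleph>\<^sub>0\<close>\<close>

definition same_line :: "cvec \<Rightarrow> cvec \<Rightarrow> bool" where
  "same_line X Y \<longleftrightarrow> B_positive X \<and> B_positive Y \<and> (\<exists>c. c \<noteq> 0 \<and> Y = cscale c X)"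

lemma B_positive_scale: "c \<noteq> 0 \<Longrightarrow> B_positive (cscale c X) \<longleftrightarrow> B_positive X"
  unfolding B_positive_def Re_B_scale by (simp add: zero_less_mult_iff)

text \<open>The abstraction \<open>point X\<close> is the complex line through \<open>X\<close>; it is meaningful only
  for \<open>B\<close>-positive \<open>X\<close>.\<close>

quotient_type chyp = cvec / partial: same_line
  morphisms rep_chyp point
proof (rule part_equivpI)
  have "same_line (1, 0) (1, 0)"
    unfolding same_line_def B_positive_def Re_B_self
    by (auto intro: exI[of _ 1] simp del: B.simps)
  then show "\<exists>X. same_line X X" ..
  show "symp same_line"
  proof (rule sympI)
    fix X Y assume "same_line X Y"
    then obtain c where c: "B_positive X" "B_positive Y" "c \<noteq> 0" "Y = cscale c X"
      unfolding same_line_def by blast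
    then have "X = cscale (inverse c) Y" by simp
    then show "same_line Y X" unfolding same_line_def using c by (metis inverse_nonzero_iff_nonzero)
  qed
  show "transp same_line"
  proof (rule transpI)
    fix X Y Z assume "same_line X Y" "same_line Y Z"
    then obtain c d where "B_positive X" "B_positive Z" "c \<noteq> 0" "d \<noteq> 0"
      "Y = cscale c X" "Z = cscale d Y"
      unfolding same_line_def by blast
    then show "same_line X Z" unfolding same_line_def by (auto intro!: exI[of _ "d * c"])
  qed
qed

instantiation chyp :: metric_space
begin

lift_definition dist_chyp :: "chyp \<Rightarrow> chyp \<Rightarrow> real" is "\<lambda>X Y. arcosh (cosh_ratio X Y)"
  by (auto simp: same_line_def cosh_ratio_scale_left cosh_ratio_scale_right)

definition uniformity_chyp :: "(chyp \<times> chyp) filter" where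
  "uniformity_chyp = (INF e\<in>{0<..}. principal {(x, y). dist x y < e})"

definition open_chyp :: "chyp set \<Rightarrow> bool" where
  "open_chyp U \<longleftrightarrow> (\<forall>x\<in>U. \<forall>\<^sub>F (x', y) in uniformity. x' = x \<longrightarrow> y \<in> U)"

instance
proof
  fix x y z :: chyp and U :: "chyp set"
  show "uniformity = (INF e\<in>{0<..}. principal {(x, y :: chyp). dist x y < e})"
    by (rule uniformity_chyp_def)
  show "open U \<longleftrightarrow> (\<forall>x\<in>U. \<forall>\<^sub>F (x', y) in uniformity. x' = x \<longrightarrow> y \<in> U)"
    by (rule open_chyp_def)
  show "dist x y = 0 \<longleftrightarrow> x = y"
  proof transfer
    fix X Y assume "same_line X X" "same_line Y Y"
    then have pos: "B_positive X" "B_positive Y" unfolding same_line_def by auto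
    have D: "0 < Re (B X X) * Re (B Y Y)" using pos unfolding B_positive_def by simp
    have "arcosh (cosh_ratio X Y) = 0 \<longleftrightarrow> cosh_ratio X Y = 1"
      by (rule arcosh_eq_0_iff_real[OF cosh_ratio_ge_1[OF pos]])
    also have "\<dots> \<longleftrightarrow> same_line X Y"
    proof
      assume "cosh_ratio X Y = 1"
      then have eq: "cmod (B X Y) = sqrt (Re (B X X) * Re (B Y Y))"
        using D unfolding cosh_ratio_def by (simp add: divide_eq_1_iff)
      then have "Re (B X X) * Re (B Y Y) = (cmod (B X Y))\<^sup>2" using D by simp
      then have "Y = cscale (B X Y / B X X) X"
        by (rule B_reverse_cauchy_schwarz(2)[OF pos])
      moreover have "B X Y \<noteq> 0" using eq D by auto
      moreover have "B X X \<noteq> 0" using pos unfolding B_positive_def by auto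
      ultimately show "same_line X Y"
        unfolding same_line_def using pos by (metis divide_eq_0_iff)
    next
      assume "same_line X Y"
      then obtain c where c: "c \<noteq> 0" "Y = cscale c X" unfolding same_line_def by blast
      have k: "0 < Re (B X X)" using pos unfolding B_positive_def by simp
      have "cmod (B X X) = Re (B X X)"
        by (subst B_self_real) (use k in simp)
      then show "cosh_ratio X Y = 1"
        unfolding c(2) cosh_ratio_scale_right[OF c(1)] unfolding cosh_ratio_def using k by simp
    qed
    finally show "arcosh (cosh_ratio X Y) = 0 \<longleftrightarrow> same_line X Y" .
  qed
  have comm: "dist x y = dist y x" for x y :: chyp
    by transfer (simp only: cosh_ratio_commute)
  have tri: "dist x z \<le> dist x y + dist y z" for x y z :: chyp
  proof transfer
    fix X Z Y assume "same_line X X" "same_line Z Z" "same_line Y Y"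
    then have pos: "B_positive X" "B_positive Y" "B_positive Z" unfolding same_line_def by auto
    note ge = cosh_ratio_ge_1[OF pos(1,2)] cosh_ratio_ge_1[OF pos(2,3)] cosh_ratio_ge_1[OF pos(1,3)]
    have "cosh (arcosh (cosh_ratio X Z)) \<le>
        cosh (arcosh (cosh_ratio X Y) + arcosh (cosh_ratio Y Z))"
      using cosh_ratio_triangle[OF pos] ge by (simp add: cosh_add sinh_arcosh_real)
    then show "arcosh (cosh_ratio X Z) \<le> arcosh (cosh_ratio X Y) + arcosh (cosh_ratio Y Z)"
      using ge by (subst (asm) cosh_real_nonneg_le_iff) auto
  qed
  show "dist x y \<le> dist x z + dist y z"
    using tri[of x y z] by (simp add: comm[of y z])
qed

end

lemma cosh_dist_point:
  assumes "B_positive X" "B_positive Y"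
  shows "cosh (dist (point X) (point Y)) = cmod (B X Y) / sqrt (Re (B X X) * Re (B Y Y))"
proof -
  have "same_line X X" "same_line Y Y"
    using assms unfolding same_line_def by (auto intro: exI[of _ 1])
  then have "dist (point X) (point Y) = arcosh (cosh_ratio X Y)"
    by (rule dist_chyp.abs_eq)
  then show ?thesis
    using cosh_ratio_ge_1[OF assms] by (simp add: cosh_ratio_def)
qed

lift_definition Cart :: "chyp \<Rightarrow> chyp \<Rightarrow> chyp \<Rightarrow> real"
  is "\<lambda>X Y Z. Arg (B X Y * B Y Z * B Z X)"
proof -
  fix X X' Y Y' Z Z' assume "same_line X X'" "same_line Y Y'" "same_line Z Z'"
  then obtain a b c where abc: "a \<noteq> 0" "b \<noteq> 0" "c \<noteq> 0"
    and eqs: "X' = cscale a X" "Y' = cscale b Y" "Z' = cscale c Z"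
    unfolding same_line_def by blast
  define r where "r = (cmod a * cmod b * cmod c)\<^sup>2"
  have r: "r > 0" unfolding r_def using abc by simp
  have "B X' Y' * B Y' Z' * B Z' X'
      = (a * cnj a) * (b * cnj b) * (c * cnj c) * (B X Y * B Y Z * B Z X)"
    unfolding eqs B_scale_left B_scale_right by (simp add: algebra_simps)
  also have "\<dots> = of_real r * (B X Y * B Y Z * B Z X)"
    unfolding r_def power_mult_distrib of_real_mult complex_norm_square by simp
  finally show "Arg (B X Y * B Y Z * B Z X) = Arg (B X' Y' * B Y' Z' * B Z' X')"
    using r by (simp add: Arg_times_of_real)
qed


section \<open>Isometries and irreducible actions\<close>

definition Is :: "(chyp \<Rightarrow> chyp) monoid" where
  "Is = \<lparr>carrier = {g. bij g \<and> (\<forall>x y. dist (g x) (g y) = dist x y)},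
    monoid.mult = (\<circ>), one = id\<rparr>"

lemma group_Is: "group Is"
proof (rule groupI)
  fix g assume g: "g \<in> carrier Is"
  then have b: "bij g" unfolding Is_def by simp
  have "inv_into UNIV g \<in> carrier Is"
    using g b bij_imp_bij_inv[OF b] unfolding Is_def
    by simp (metis bij_inv_eq_iff)
  moreover have "inv_into UNIV g \<otimes>\<^bsub>Is\<^esub> g = \<one>\<^bsub>Is\<^esub>"
    using b by (simp add: Is_def bij_is_inj)
  ultimately show "\<exists>h\<in>carrier Is. h \<otimes>\<^bsub>Is\<^esub> g = \<one>\<^bsub>Is\<^esub>" by blast
qed (auto simp: Is_def bij_comp)

definition B_unitary :: "(cvec \<Rightarrow> cvec) \<Rightarrow> bool" where
  "B_unitary T \<longleftrightarrow> bij T \<and> (\<forall>X Y. T (X + Y) = T X + T Y) \<and>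
    (\<forall>c X. T (cscale c X) = cscale c (T X)) \<and> (\<forall>X Y. B (T X) (T Y) = B X Y)"

definition B_antiunitary :: "(cvec \<Rightarrow> cvec) \<Rightarrow> bool" where
  "B_antiunitary T \<longleftrightarrow> bij T \<and> (\<forall>X Y. T (X + Y) = T X + T Y) \<and>
    (\<forall>c X. T (cscale c X) = cscale (cnj c) (T X)) \<and> (\<forall>X Y. B (T X) (T Y) = cnj (B X Y))"

text \<open>The projective action associated to an isometry \<open>g\<close> is that of any (anti)linear operator
  inducing \<open>g\<close>. Every isometry has such a lift, unique up to a scalar of modulus one, so that the
  choice of the lift is irrelevant for the invariance of complex subspaces.\<close>

definition lifts :: "(cvec \<Rightarrow> cvec) \<Rightarrow> (chyp \<Rightarrow> chyp) \<Rightarrow> bool" where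
  "lifts T g \<longleftrightarrow> (B_unitary T \<or> B_antiunitary T) \<and>
    (\<forall>X. B_positive X \<longrightarrow> g (point X) = point (T X))"

definition proj_invariant :: "(chyp \<Rightarrow> chyp) \<Rightarrow> cvec set \<Rightarrow> bool" where
  "proj_invariant g S \<longleftrightarrow> (\<forall>T. lifts T g \<longrightarrow> T ` S = S)"

text \<open>Irreducibility of the isometric action of a set \<open>G\<close> of group elements through \<open>\<rho>\<close>. Here
  \<open>closed\<close> refers to the Hilbert space topology of \<open>\<complex> \<oplus> H\<close>.\<close>

definition irreducible_action :: "'g set \<Rightarrow> ('g \<Rightarrow> chyp \<Rightarrow> chyp) \<Rightarrow> bool" where
  "irreducible_action G \<rho> \<longleftrightarrow>
    (\<forall>S. closed S \<and> cvec.subspace S \<and> (\<forall>g\<in>G. proj_invariant (\<rho> g) S) \<longrightarrow> S = {0} \<or> S = UNIV)"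

end

theory Submission
  imports Defs "HOL-Computational_Algebra.Primes" "HOL-Library.Multiset"
begin

text \<open>Represent a point of the hyperbolic space by the vector \<open>(1, u)\<close> with \<open>u\<close> in the unit ball,
  so that \<open>B (1, u) (1, v) = 1 - \<langle>u, v\<rangle>\<close>. For \<open>0 < t < 1\<close> the binomial series of
  \<open>1 - (1 - z)\<^sup>t\<close> has positive coefficients \<open>c\<^sub>n\<close>, hence
  \<open>(1 - \<langle>u, v\<rangle>)\<^sup>t = 1 - \<langle>\<phi> u, \<phi> v\<rangle>\<close> where the coordinates of \<open>\<phi> u\<close> are the monomials in \<open>u\<close>,
  indexed by the nonempty multisets and suitably weighted. This gives \<open>f\<close>.
  An isometry preserves all Cartan arguments or negates all of them (reduce to isometries fixing the
  origin, which act on the ball preserving real parts and moduli of inner products). Hence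
  \<open>f x \<mapsto> f (g x)\<close> preserves or conjugates the \<open>B\<close>-products of suitably scaled representatives. As
  the image of \<open>f\<close> spans a dense subspace, it extends to a unique \<open>B\<close>-(anti)unitary operator; this is
  \<open>\<rho> g\<close>, and uniqueness makes \<open>\<rho>\<close> a homomorphism.
  A closed invariant subspace \<open>S\<close> is invariant under the rotations of the ball, which act by
  \<open>c\<^sup>n\<close> on the coordinates of degree \<open>n\<close>. Averaging over them shows that \<open>S\<close> contains the vector
  \<open>(1, 0)\<close>, hence by transitivity everything, or else is orthogonal to it, hence zero.\<close>

section \<open>Square-summable sequences\<close>

text \<open>\<open>B\<close> is indefinite, so preserving it on a dense span gives no norm bound by
  itself. The extension argument therefore keeps a base vector proportional to
  \<open>(1, 0)\<close>: the Hilbert norm is recovered from \<open>B\<close> and the product with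
  \<open>(1, 0)\<close>. That the image of \<open>f\<close> spans densely is an arithmetic fact. A
  vector orthogonal to all \<open>\<phi> u\<close> is tested on the points \<open>u\<close> whose
  i-th coordinate is the i-th prime to the power \<open>-s\<close>. Each monomial becomes
  \<open>n^(-s)\<close> for an integer \<open>n\<close> that determines it by unique factorisation,
  so orthogonality for all integers \<open>s >= 2\<close> says that a Dirichlet series vanishes,
  hence so do its coefficients. Continuity and uniqueness of \<open>\<rho>\<close> share one
  obstacle: lifts carry an arbitrary phase and may be unitary or antiunitary. A triple with nonzero
  Cartan argument excludes the antiunitary ones near the identity, and the image of one base vector
  fixes the phase. For \<open>t = 1\<close> all binomial coefficients beyond degree one vanish, so
  the monomials are replaced by the identity map. The averages use only roots of unity of order
  \<open>2^m\<close>, so finite sums take the place of an integral over the circle.\<close>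

lemma power2_norm_ell2: "(norm u)\<^sup>2 = (\<Sum>n. (cmod (coord u n))\<^sup>2)"
proof -
  have "(norm u)\<^sup>2 = inner u u" by (rule power2_norm_eq_inner)
  also have "\<dots> = (\<Sum>n. (cmod (coord u n))\<^sup>2)"
    unfolding inner_ell2_alt cmod_power2 by (simp add: power2_eq_square)
  finally show ?thesis .
qed

lemma cmod_coord_le: "cmod (coord u n) \<le> norm u"
proof -
  have "(cmod (coord u n))\<^sup>2 \<le> (norm u)\<^sup>2"
    unfolding power2_norm_ell2 using sum_le_suminf[OF summable_coord, of "{n}" u] by simp
  then show ?thesis by (rule power2_le_imp_le) simp
qed

lemma coord_simps [simp]:
  "coord (u + v) n = coord u n + coord v n" "coord (u - v) n = coord u n - coord v n"
  "coord (- u) n = - coord u n" "coord 0 n = 0" "coord (scaleC c u) n = c * coord u n"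
  by (simp_all add: plus_ell2.rep_eq minus_ell2.rep_eq uminus_ell2.rep_eq zero_ell2.rep_eq
      scaleC.rep_eq)

lemma ell2_eqI: "(\<And>n. coord u n = coord v n) \<Longrightarrow> u = v"
  by (simp add: coord_inject[symmetric] fun_eq_iff)

lemma coord_Abs: "summable (\<lambda>n. (cmod (x n))\<^sup>2) \<Longrightarrow> coord (Abs_ell2 x) = x"
  by (simp add: Abs_ell2_inverse)

text \<open>Completeness serves twice: for orthogonal complements of closed subspaces and for
  extending isometries from a dense span. The limit is built coordinatewise, with estimates on
  finite partial sums that are uniform in their length.\<close>

instance ell2 :: complete_space
proof
  fix X :: "nat \<Rightarrow> ell2" assume X: "Cauchy X"
  have "Cauchy (\<lambda>m. coord (X m) n)" for n
  proof (rule metric_CauchyI)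
    fix e :: real assume "e > 0"
    then obtain M where M: "\<And>i j. i \<ge> M \<Longrightarrow> j \<ge> M \<Longrightarrow> dist (X i) (X j) < e"
      using metric_CauchyD[OF X] by blast
    have "dist (coord (X i) n) (coord (X j) n) < e" if "i \<ge> M" "j \<ge> M" for i j
      using M[OF that] cmod_coord_le[of "X i - X j" n] by (simp add: dist_norm)
    then show "\<exists>M. \<forall>i\<ge>M. \<forall>j\<ge>M. dist (coord (X i) n) (coord (X j) n) < e" by blast
  qed
  then have "\<forall>n. \<exists>l. (\<lambda>m. coord (X m) n) \<longlonglongrightarrow> l"
    by (simp add: Cauchy_convergent_iff convergent_def)
  then obtain x where x: "\<And>n. (\<lambda>m. coord (X m) n) \<longlonglongrightarrow> x n" by metis
  have bound: "(\<Sum>n<K. (cmod (coord (X i) n - x n))\<^sup>2) \<le> e\<^sup>2"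
    if M: "\<And>i j. i \<ge> M \<Longrightarrow> j \<ge> M \<Longrightarrow> dist (X i) (X j) < e" and "i \<ge> M" for i M K and e :: real
  proof (rule LIMSEQ_le_const2)
    show "(\<lambda>j. \<Sum>n<K. (cmod (coord (X i) n - coord (X j) n))\<^sup>2)
        \<longlonglongrightarrow> (\<Sum>n<K. (cmod (coord (X i) n - x n))\<^sup>2)"
      by (intro tendsto_intros x)
    have "(\<Sum>n<K. (cmod (coord (X i) n - coord (X j) n))\<^sup>2) \<le> e\<^sup>2" if "j \<ge> M" for j
    proof -
      have "(\<Sum>n<K. (cmod (coord (X i) n - coord (X j) n))\<^sup>2) \<le> (norm (X i - X j))\<^sup>2"
        unfolding power2_norm_ell2 using sum_le_suminf[OF summable_coord, of "{..<K}" "X i - X j"]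
        by simp
      also have "\<dots> \<le> e\<^sup>2"
        using M[OF \<open>i \<ge> M\<close> that] by (intro power_mono) (auto simp: dist_norm)
      finally show ?thesis .
    qed
    then show "\<exists>N. \<forall>j\<ge>N. (\<Sum>n<K. (cmod (coord (X i) n - coord (X j) n))\<^sup>2) \<le> e\<^sup>2" by blast
  qed
  have summ: "summable (\<lambda>n. (cmod (coord (X i) n - x n))\<^sup>2)"
    and le: "(\<Sum>n. (cmod (coord (X i) n - x n))\<^sup>2) \<le> e\<^sup>2"
    if M: "\<And>i j. i \<ge> M \<Longrightarrow> j \<ge> M \<Longrightarrow> dist (X i) (X j) < e" and i: "i \<ge> M" for i M and e :: real
  proof -
    show "summable (\<lambda>n. (cmod (coord (X i) n - x n))\<^sup>2)"
      by (rule bounded_imp_summable[where B = "e\<^sup>2"])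
        (use bound[OF M i] in \<open>simp_all del: sum.lessThan_Suc flip: lessThan_Suc_atMost\<close>)
    then show "(\<Sum>n. (cmod (coord (X i) n - x n))\<^sup>2) \<le> e\<^sup>2"
      by (rule suminf_le_const) (rule bound[OF M i])
  qed
  obtain M where M: "\<And>i j. i \<ge> M \<Longrightarrow> j \<ge> M \<Longrightarrow> dist (X i) (X j) < 1"
    using metric_CauchyD[OF X, of 1] by auto
  \<comment> \<open>The limit is \<open>X M\<close> minus the square-summable difference
    \<open>X M - x\<close>.\<close>
  have "summable (\<lambda>n. (cmod (coord (X M) n - (coord (X M) n - x n)))\<^sup>2)"
    using summable_square_add[OF summable_coord[of "X M"], of "\<lambda>n. - (coord (X M) n - x n)"]
      summ[OF M order_refl] by (simp add: norm_minus_commute)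
  then have sx: "summable (\<lambda>n. (cmod (x n))\<^sup>2)" by simp
  have "X \<longlonglongrightarrow> Abs_ell2 x"
  proof (rule metric_LIMSEQ_I)
    fix e :: real assume e: "e > 0"
    then obtain M where M: "\<And>i j. i \<ge> M \<Longrightarrow> j \<ge> M \<Longrightarrow> dist (X i) (X j) < e / 2"
      using metric_CauchyD[OF X, of "e / 2"] by auto
    have "dist (X i) (Abs_ell2 x) < e" if "i \<ge> M" for i
    proof -
      have "(norm (X i - Abs_ell2 x))\<^sup>2 \<le> (e / 2)\<^sup>2"
        unfolding power2_norm_ell2 using le[OF M that] by (simp add: coord_Abs[OF sx])
      then have "norm (X i - Abs_ell2 x) \<le> e / 2"
        by (rule power2_le_imp_le) (use e in simp)
      then show ?thesis using e by (simp add: dist_norm)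
    qed
    then show "\<exists>M. \<forall>i\<ge>M. dist (X i) (Abs_ell2 x) < e" by blast
  qed
  then show "convergent X" by (auto simp: convergent_def)
qed

lemma scaleC_of_real: "scaleC (of_real r) u = r *\<^sub>R u"
  by (simp add: scaleR_ell2_def)

lemma bounded_bilinear_cinner: "bounded_bilinear cinner"
proof
  fix r :: real and u u' v v' :: ell2
  show "cinner (u + u') v = cinner u v + cinner u' v" by (rule cinner_add_left)
  show "cinner u (v + v') = cinner u v + cinner u v'" by (rule cinner_add_right)
  show "cinner (r *\<^sub>R u) v = r *\<^sub>R cinner u v"
    by (simp add: scaleC_of_real[symmetric] cinner_scaleC_left scaleR_conv_of_real)
  show "cinner u (r *\<^sub>R v) = r *\<^sub>R cinner u v"
    by (simp add: scaleC_of_real[symmetric] cinner_scaleC_right scaleR_conv_of_real)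
  show "\<exists>K. \<forall>u v. norm (cinner u v) \<le> norm u * norm v * K"
    by (rule exI[of _ 1]) (simp add: cmod_cinner_le)
qed

lemmas tendsto_cinner = bounded_bilinear.tendsto[OF bounded_bilinear_cinner]
lemmas cinner_simps = bounded_bilinear.diff_left[OF bounded_bilinear_cinner]
  bounded_bilinear.diff_right[OF bounded_bilinear_cinner]
  bounded_bilinear.minus_left[OF bounded_bilinear_cinner]
  bounded_bilinear.minus_right[OF bounded_bilinear_cinner]
  bounded_bilinear.zero_left[OF bounded_bilinear_cinner]
  bounded_bilinear.zero_right[OF bounded_bilinear_cinner]
  cinner_add_left cinner_add_right cinner_scaleC_left cinner_scaleC_right

lemma bounded_bilinear_scaleC: "bounded_bilinear scaleC"
proof
  fix r :: real and a a' :: complex and v v' :: ell2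
  show "scaleC (a + a') v = scaleC a v + scaleC a' v" "scaleC a (v + v') = scaleC a v + scaleC a v'"
    "scaleC (r *\<^sub>R a) v = r *\<^sub>R scaleC a v" "scaleC a (r *\<^sub>R v) = r *\<^sub>R scaleC a v"
    by (rule ell2_eqI; simp add: algebra_simps scaleC_of_real[symmetric] scaleR_conv_of_real)+
  show "\<exists>K. \<forall>a v. norm (scaleC a v) \<le> norm a * norm v * K"
    by (rule exI[of _ 1]) (simp add: norm_scaleC)
qed

lemmas tendsto_scaleC = bounded_bilinear.tendsto[OF bounded_bilinear_scaleC]


section \<open>The topology of \<open>\<complex> \<oplus> H\<close>\<close>

lemma B_alt: "B X Y = cnj (fst X) * fst Y - cinner (snd X) (snd Y)"
  by (cases X; cases Y) simp

lemma cscale_alt: "cscale c X = (c * fst X, scaleC c (snd X))"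
  by (cases X) (simp add: cscale.simps)

lemma tendsto_B [tendsto_intros]:
  "(X \<longlongrightarrow> x) F \<Longrightarrow> (Y \<longlongrightarrow> y) F \<Longrightarrow> ((\<lambda>i. B (X i) (Y i)) \<longlongrightarrow> B x y) F"
  unfolding B_alt by (intro tendsto_intros tendsto_cinner)

lemma tendsto_cscale [tendsto_intros]:
  "(c \<longlongrightarrow> a) F \<Longrightarrow> (Y \<longlongrightarrow> y) F \<Longrightarrow> ((\<lambda>i. cscale (c i) (Y i)) \<longlongrightarrow> cscale a y) F"
  unfolding cscale_alt by (intro tendsto_intros tendsto_scaleC)

lemma cscale_of_real: "cscale (of_real r) X = r *\<^sub>R X"
  by (cases X) (simp add: cscale.simps scaleC_of_real scaleR_conv_of_real)

text \<open>\<open>- B\<close> differs from the Hilbert product only in the sign of the first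
  coordinate, and \<open>B (1, 0)\<close> reads that coordinate off. This turns control of
  \<open>B\<close> together with one product into control of the norm.\<close>

lemma power2_norm_cvec: "(norm X)\<^sup>2 = 2 * (cmod (B (1, 0) X))\<^sup>2 - Re (B X X)"
  by (cases X) (simp add: norm_prod_def Re_B_self cinner_simps del: B.simps, simp add: cinner_simps)

section \<open>Closed complex subspaces, orthogonality and density\<close>

lemma closure_cvec_subspace:
  assumes "cvec.subspace S" shows "cvec.subspace (closure S)"
proof (rule cvec.subspaceI)
  show "0 \<in> closure S" using cvec.subspace_0[OF assms] closure_subset by blast
next
  fix X Y assume "X \<in> closure S" "Y \<in> closure S"
  then obtain x y where "\<And>n. x n \<in> S" "x \<longlonglongrightarrow> X" "\<And>n. y n \<in> S" "y \<longlonglongrightarrow> Y"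
    unfolding closure_sequential by blast
  then show "X + Y \<in> closure S"
    unfolding closure_sequential
    by (intro exI[of _ "\<lambda>n. x n + y n"] conjI allI cvec.subspace_add[OF assms] tendsto_add)
next
  fix X c assume "X \<in> closure S"
  then obtain x where "\<And>n. x n \<in> S" "x \<longlonglongrightarrow> X" unfolding closure_sequential by blast
  then show "cscale c X \<in> closure S"
    unfolding closure_sequential
    by (intro exI[of _ "\<lambda>n. cscale c (x n)"] conjI allI cvec.subspace_scale[OF assms]
        tendsto_cscale tendsto_const)
qed

text \<open>Hilbert projection: a sequence in \<open>S\<close> minimising the distance to a point
  outside \<open>S\<close> is Cauchy by the parallelogram law, and the vector from its limit to the
  point is orthogonal to \<open>S\<close>.\<close>

lemma exists_orthogonal:
  fixes S :: "'a :: {real_inner, complete_space} set"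
  assumes "closed S" "subspace S" "S \<noteq> UNIV"
  shows "\<exists>w. w \<noteq> 0 \<and> (\<forall>s\<in>S. inner w s = 0)"
proof -
  obtain a where a: "a \<notin> S" using assms(3) by blast
  have ne: "S \<noteq> {}" using subspace_0[OF assms(2)] by blast
  define d where "d = infdist a S"
  have d0: "d \<ge> 0" unfolding d_def by (rule infdist_nonneg)
  have d: "d \<le> norm (a - s)" if "s \<in> S" for s
    unfolding d_def using infdist_le[OF that, of a] by (simp add: dist_norm)
  have "\<exists>s\<in>S. (norm (a - s))\<^sup>2 < d\<^sup>2 + inverse (real (Suc n))" for n
  proof -
    have "d < sqrt (d\<^sup>2 + inverse (real (Suc n)))"
      by (rule real_less_rsqrt) simp
    then obtain s where "s \<in> S" "dist a s < sqrt (d\<^sup>2 + inverse (real (Suc n)))"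
      unfolding d_def infdist_notempty[OF ne] using cINF_less_iff[OF ne, of "dist a"]
      by (metis bdd_below_image_dist)
    then have "norm (a - s) < sqrt (d\<^sup>2 + inverse (real (Suc n)))" by (simp add: dist_norm)
    then have "(norm (a - s))\<^sup>2 < (sqrt (d\<^sup>2 + inverse (real (Suc n))))\<^sup>2"
      by (intro power_strict_mono) auto
    also have "\<dots> = d\<^sup>2 + inverse (real (Suc n))" by (rule real_sqrt_pow2) simp
    finally show ?thesis using \<open>s \<in> S\<close> by blast
  qed
  then obtain s where s: "\<And>n. s n \<in> S" "\<And>n. (norm (a - s n))\<^sup>2 < d\<^sup>2 + inverse (real (Suc n))"
    by metis
  have par: "(norm (s n - s m))\<^sup>2 \<le> 2 * inverse (real (Suc n)) + 2 * inverse (real (Suc m))" for n m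
  proof -
    have "(1 / 2) *\<^sub>R (s n + s m) \<in> S"
      using s(1) by (intro subspace_scale[OF assms(2)] subspace_add[OF assms(2)])
    from d[OF this] have "d\<^sup>2 \<le> (norm (a - (1 / 2) *\<^sub>R (s n + s m)))\<^sup>2"
      using d0 by (intro power_mono)
    moreover have "(norm (s n - s m))\<^sup>2 + 4 * (norm (a - (1 / 2) *\<^sub>R (s n + s m)))\<^sup>2
        = 2 * (norm (a - s n))\<^sup>2 + 2 * (norm (a - s m))\<^sup>2"
      by (simp add: power2_norm_eq_inner inner_diff_left inner_diff_right inner_add_left
          inner_add_right inner_commute algebra_simps)
    ultimately show ?thesis using s(2)[of n] s(2)[of m] by linarith
  qed
  have "Cauchy s"
  proof (rule metric_CauchyI)
    fix e :: real assume e: "e > 0"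
    obtain N where N: "inverse (real (Suc N)) < e\<^sup>2 / 4"
      using reals_Archimedean[of "e\<^sup>2 / 4"] e by auto
    have "dist (s n) (s m) < e" if "n \<ge> N" "m \<ge> N" for n m
    proof -
      have "inverse (real (Suc n)) \<le> inverse (real (Suc N))" "inverse (real (Suc m)) \<le> inverse (real (Suc N))"
        using that by auto
      then have "(norm (s n - s m))\<^sup>2 < e\<^sup>2" using par[of n m] N by linarith
      then show ?thesis unfolding dist_norm by (rule power_less_imp_less_base) (use e in simp)
    qed
    then show "\<exists>N. \<forall>n\<ge>N. \<forall>m\<ge>N. dist (s n) (s m) < e" by blast
  qed
  then obtain l where l: "s \<longlonglongrightarrow> l" using Cauchy_convergent_iff convergent_def by blast
  have lS: "l \<in> S" using closed_sequentially[OF assms(1)] s(1) l by blast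
  have "(norm (a - l))\<^sup>2 \<le> d\<^sup>2 + 0"
  proof (rule LIMSEQ_le)
    show "(\<lambda>n. (norm (a - s n))\<^sup>2) \<longlonglongrightarrow> (norm (a - l))\<^sup>2" by (intro tendsto_intros l)
    show "(\<lambda>n. d\<^sup>2 + inverse (real (Suc n))) \<longlonglongrightarrow> d\<^sup>2 + 0"
      by (intro tendsto_intros LIMSEQ_inverse_real_of_nat)
    show "\<exists>N. \<forall>n\<ge>N. (norm (a - s n))\<^sup>2 \<le> d\<^sup>2 + inverse (real (Suc n))"
      using s(2) less_imp_le by blast
  qed
  define w where "w = a - l"
  have min: "(norm w)\<^sup>2 \<le> (norm (w - x))\<^sup>2" if "x \<in> S" for x
  proof -
    have "d \<le> norm (a - (l + x))" by (rule d) (rule subspace_add[OF assms(2) lS that])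
    then have "d\<^sup>2 \<le> (norm (w - x))\<^sup>2" unfolding w_def using d0
      by (intro power_mono) (simp_all add: algebra_simps)
    then show ?thesis using \<open>(norm (a - l))\<^sup>2 \<le> d\<^sup>2 + 0\<close> unfolding w_def by linarith
  qed
  have "inner w x = 0" if x: "x \<in> S" for x
  proof (cases "x = 0")
    case False
    \<comment> \<open>The value of \<open>r\<close> that minimises the norm of
      \<open>w - r x\<close>; comparing with \<open>min\<close> leaves no room unless
      \<open>inner w x\<close> vanishes.\<close>
    define r where "r = inner w x / inner x x"
    have "(norm w)\<^sup>2 \<le> (norm (w - r *\<^sub>R x))\<^sup>2"
      by (rule min) (rule subspace_scale[OF assms(2) x])
    then have "r * inner w x * 2 \<le> r * r * inner x x"
      by (simp add: power2_norm_eq_inner inner_diff_left inner_diff_right inner_commute algebra_simps)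
    moreover have "r * r * inner x x = r * inner w x" unfolding r_def using False by simp
    moreover have "r * inner w x = (inner w x)\<^sup>2 / inner x x"
      unfolding r_def by (simp add: power2_eq_square)
    ultimately have "(inner w x)\<^sup>2 / inner x x \<le> 0" by linarith
    moreover have "inner x x > 0" using False by simp
    ultimately have "(inner w x)\<^sup>2 \<le> 0"
      by (metis divide_pos_pos linorder_not_le)
    then show ?thesis by simp
  qed simp
  moreover have "w \<noteq> 0" using a lS unfolding w_def by auto
  ultimately show ?thesis by blast
qed

text \<open>Flipping the sign of the second component converts real Hilbert orthogonality into
  vanishing of \<open>Re (B X Y)\<close>, so density can be tested with \<open>B\<close>
  alone.\<close>

lemma closed_cvec_subspace_eq_UNIV:
  assumes cl: "closed S" and sub: "cvec.subspace S"
    and tot: "\<And>Y. (\<And>X. X \<in> S \<Longrightarrow> B X Y = 0) \<Longrightarrow> Y = 0"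
  shows "S = UNIV"
proof (rule ccontr)
  assume "S \<noteq> UNIV"
  moreover have "subspace S"
    unfolding subspace_def
    using cvec.subspace_0[OF sub] cvec.subspace_add[OF sub] cvec.subspace_scale[OF sub]
    by (metis cscale_of_real)
  ultimately obtain W where W: "W \<noteq> 0" "\<And>X. X \<in> S \<Longrightarrow> inner W X = 0"
    using exists_orthogonal[OF cl] by blast
  define Y where "Y = (fst W, - snd W)"
  have re: "Re (B X Y) = inner W X" for X
    unfolding Y_def B_alt by (cases X; cases W)
      (simp add: cinner_simps inner_complex_def inner_ell2_def[symmetric] inner_commute)
  have "B X Y = 0" if "X \<in> S" for X
  proof (rule complex_eqI)
    show "Re (B X Y) = Re 0" using re W(2)[OF that] by simp
    \<comment> \<open>\<open>S\<close> is complex, so multiplying \<open>X\<close> by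
      \<open>\<i>\<close> recovers the imaginary part from a statement about real parts.\<close>
    have "Re (B (cscale \<i> X) Y) = 0"
      unfolding re by (rule W(2)) (rule cvec.subspace_scale[OF sub that])
    then show "Im (B X Y) = Im 0" by (simp add: B_scale_left)
  qed
  then have "Y = 0" by (rule tot)
  then have "W = 0" unfolding Y_def by (cases W) (simp add: zero_prod_def)
  with W(1) show False by simp
qed

section \<open>Ball coordinates\<close>

lemma same_line_refl: "same_line X X \<longleftrightarrow> B_positive X"
  unfolding same_line_def by (auto intro: exI[of _ 1])

lemma point_rep: "point (rep_chyp x) = x" and B_positive_rep: "B_positive (rep_chyp x)"
  using Quotient3_abs_rep[OF Quotient3_chyp] Quotient3_rep_reflp[OF Quotient3_chyp]
  by (auto simp: same_line_refl)

lemma point_eq_iff: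
  assumes "B_positive X" "B_positive Y"
  shows "point X = point Y \<longleftrightarrow> (\<exists>c. c \<noteq> 0 \<and> Y = cscale c X)"
  using Quotient3_rel[OF Quotient3_chyp, of X Y] assms
  by (auto simp: same_line_refl) (auto simp: same_line_def)

lemma point_cscale: "B_positive X \<Longrightarrow> c \<noteq> 0 \<Longrightarrow> point (cscale c X) = point X"
  by (metis B_positive_scale point_eq_iff)

lemma chyp_cases: obtains X where "B_positive X" "x = point X"
  using point_rep B_positive_rep by metis

lemma B_positive_Pair: "B_positive (z, u) \<longleftrightarrow> norm u < cmod z"
  unfolding B_positive_def Re_B_self
  using power2_less_imp_less[of "norm u" "cmod z"] power_strict_mono[of "norm u" "cmod z" 2] by auto

definition bcoord :: "chyp \<Rightarrow> ell2" where
  "bcoord x = scaleC (inverse (fst (rep_chyp x))) (snd (rep_chyp x))"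

definition hvec :: "chyp \<Rightarrow> cvec" where
  "hvec x = (1, bcoord x)"

definition origin :: chyp where
  "origin = point (1, 0)"

lemma hvec_rep: "\<exists>c. c \<noteq> 0 \<and> hvec x = cscale c (rep_chyp x)"
proof -
  have "norm (snd (rep_chyp x)) < cmod (fst (rep_chyp x))"
    using B_positive_rep[of x] B_positive_Pair by (metis prod.collapse)
  then have "fst (rep_chyp x) \<noteq> 0" using norm_ge_zero[of "snd (rep_chyp x)"] by auto
  then show ?thesis
    unfolding hvec_def bcoord_def cscale_alt
    by (intro exI[of _ "inverse (fst (rep_chyp x))"]) simp
qed

lemma B_positive_hvec [simp]: "B_positive (hvec x)"
  using hvec_rep[of x] B_positive_rep[of x] B_positive_scale by metis

lemma point_hvec [simp]: "point (hvec x) = x"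
  using hvec_rep[of x] B_positive_rep[of x] point_cscale point_rep by metis

lemma norm_bcoord: "norm (bcoord x) < 1"
  using B_positive_hvec[of x] unfolding hvec_def B_positive_Pair by simp

lemma hvec_point: "norm u < 1 \<Longrightarrow> hvec (point (1, u)) = (1, u)"
proof -
  assume u: "norm u < 1"
  then have "B_positive (1, u)" by (simp add: B_positive_Pair)
  then obtain c where "c \<noteq> 0" "hvec (point (1, u)) = cscale c (1, u)"
    using point_eq_iff[of "(1, u)" "hvec (point (1, u))"] by auto
  moreover from this(2) have "c = 1" by (simp add: hvec_def cscale.simps)
  ultimately show ?thesis by simp
qed

lemma bcoord_point: "norm u < 1 \<Longrightarrow> bcoord (point (1, u)) = u"
  using hvec_point by (simp add: hvec_def)

lemma hvec_origin [simp]: "hvec origin = (1, 0)"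
  unfolding origin_def by (rule hvec_point) simp

lemma B_hvec: "B (hvec x) (hvec y) = 1 - cinner (bcoord x) (bcoord y)"
  by (simp add: hvec_def)

lemma Re_B_hvec_pos: "0 < Re (B (hvec x) (hvec y))"
proof -
  have "Re (cinner (bcoord x) (bcoord y)) \<le> norm (bcoord x) * norm (bcoord y)"
    using complex_Re_le_cmod cmod_cinner_le order_trans by blast
  also have "\<dots> < 1 * 1"
    by (intro mult_strict_mono' norm_bcoord norm_ge_zero)
  finally show ?thesis unfolding B_hvec by simp
qed

lemma B_hvec_nonzero [simp]: "B (hvec x) (hvec y) \<noteq> 0"
  using Re_B_hvec_pos[of x y] by auto

lemma B_hvec_origin [simp]: "B (hvec origin) (hvec y) = 1" "B (hvec x) (hvec origin) = 1"
  "B (1, 0) (hvec y) = 1" "B (hvec x) (1, 0) = 1"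
  unfolding hvec_origin by (simp_all add: hvec_def cinner_simps)

definition hnorm2 :: "chyp \<Rightarrow> real" where
  "hnorm2 x = Re (B (hvec x) (hvec x))"

lemma hnorm2_pos: "0 < hnorm2 x" unfolding hnorm2_def by (rule Re_B_hvec_pos)

lemma hnorm2_alt: "hnorm2 x = 1 - (norm (bcoord x))\<^sup>2"
  unfolding hnorm2_def B_hvec by (simp add: cinner_self)

lemma B_hvec_self: "B (hvec x) (hvec x) = of_real (hnorm2 x)"
  unfolding hnorm2_def by (rule B_self_real)

lemma cosh_dist_hvec: "cosh (dist x y) = cmod (B (hvec x) (hvec y)) / sqrt (hnorm2 x * hnorm2 y)"
  using cosh_dist_point[of "hvec x" "hvec y"] by (simp add: hnorm2_def)

lemma cmod_B_hvec: "cmod (B (hvec x) (hvec y)) = cosh (dist x y) * sqrt (hnorm2 x * hnorm2 y)"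
  using hnorm2_pos[of x] hnorm2_pos[of y] by (simp add: cosh_dist_hvec)

lemma Cart_point:
  assumes "B_positive X" "B_positive Y" "B_positive Z"
  shows "Cart (point X) (point Y) (point Z) = Arg (B X Y * B Y Z * B Z X)"
  using assms by (intro Cart.abs_eq) (simp_all add: same_line_refl)

lemma Cart_hvec:
  "Cart x y z = Arg (B (hvec x) (hvec y) * B (hvec y) (hvec z) * B (hvec z) (hvec x))"
  using Cart_point[of "hvec x" "hvec y" "hvec z"] by simp

text \<open>Project \<open>X\<close> and \<open>Z\<close> to the complement of \<open>Y\<close>,
  where \<open>B\<close> is negative definite. This splits \<open>B X Z\<close> into a main term
  \<open>a\<close> through \<open>Y\<close> and an error \<open>e\<close>, and Cauchy-Schwarz on the
  complement gives \<open>cmod e < cmod a\<close>. The triple product is a positive multiple of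
  \<open>a * cnj (e + a)\<close>.\<close>

lemma Re_triple_pos:
  assumes X: "B_positive X" and Y: "B_positive Y" and Z: "B_positive Z"
  shows "0 < Re (B X Y * B Y Z * B Z X)"
proof -
  define k l m where "k = Re (B X X)" and "l = Re (B Y Y)" and "m = Re (B Z Z)"
  have klm: "k > 0" "l > 0" "m > 0"
    using X Y Z unfolding k_def l_def m_def B_positive_def by simp_all
  have YY: "B Y Y = of_real l" unfolding l_def by (rule B_self_real)
  define P where "P U = U - cscale (B Y U / of_real l) Y" for U
  have YP: "B Y (P U) = 0" for U
    unfolding P_def B_diff_right B_scale_right YY using klm by simp
  have PP: "B (P U) (P W) = B U W - B U Y * B Y W / of_real l" for U W
  proof -
    have "B (P U) (P W) = B U (P W) - cnj (B Y U / of_real l) * B Y (P W)"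
      by (subst P_def) (simp only: B_diff_left B_scale_left)
    also have "\<dots> = B U W - B U Y * B Y W / of_real l"
      unfolding YP unfolding P_def by (simp only: B_diff_right B_scale_right) simp
    finally show ?thesis .
  qed
  define p where "p U = (cmod (B Y U))\<^sup>2 / l" for U
  have RePP: "Re (B (P U) (P U)) = Re (B U U) - p U" for U
    unfolding PP B_mult_commute[of U Y] of_real_divide[symmetric] p_def
    by (simp add: B_commute[of U Y])
  have le: "k \<le> p X" "m \<le> p Z"
    using B_reverse_cauchy_schwarz(1)[OF Y X] B_reverse_cauchy_schwarz(1)[OF Y Z] klm
    unfolding k_def[symmetric] l_def[symmetric] m_def[symmetric] p_def
    by (simp_all add: field_simps)
  define a e where "a = B X Y * B Y Z / of_real l" and "e = B (P X) (P Z)"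
  have "(cmod e)\<^sup>2 \<le> (k - p X) * (m - p Z)"
    using B_cauchy_schwarz_orth[OF Y YP YP, of X Z] unfolding e_def RePP k_def m_def .
  also have "\<dots> = (p X - k) * (p Z - m)" by (simp add: algebra_simps)
  also have "\<dots> < p X * p Z" using le klm by (intro mult_strict_mono') auto
  also have "\<dots> = (cmod a)\<^sup>2"
    unfolding p_def a_def B_commute[of X Y]
    by (simp add: norm_mult norm_divide power_mult_distrib power_divide power2_eq_square)
  finally have ea: "cmod e < cmod a" by (rule power_less_imp_less_base) simp
  then have "cmod a > 0" using norm_ge_zero[of e] by linarith
  have "B X Z = e + a" unfolding e_def a_def PP by simp
  then have ZX: "B Z X = cnj (e + a)" using B_commute[of Z X] by simp
  have "B X Y * B Y Z = of_real l * a" unfolding a_def using klm by simp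
  then have "B X Y * B Y Z * B Z X = of_real l * (a * cnj (e + a))"
    unfolding ZX by simp
  also have "Re \<dots> = l * ((cmod a)\<^sup>2 + Re (a * cnj e))"
    unfolding cmod_power2 by (simp add: power2_eq_square algebra_simps)
  also have "\<dots> > 0"
  proof -
    have "- Re (a * cnj e) \<le> cmod a * cmod e"
      using abs_Re_le_cmod[of "a * cnj e"] by (simp add: norm_mult)
    also have "\<dots> < (cmod a)\<^sup>2" using ea \<open>cmod a > 0\<close> by (simp add: power2_eq_square)
    finally show ?thesis using klm by (simp add: zero_less_mult_iff)
  qed
  finally show ?thesis .
qed

section \<open>Convergence in the hyperbolic metric, in ball coordinates and of
  representatives\<close>

lemma tendsto_chyp_iff:
  fixes x :: chyp
  shows "(X \<longlongrightarrow> x) F \<longleftrightarrow> ((\<lambda>i. cosh (dist (X i) x)) \<longlongrightarrow> 1) F"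
proof
  assume "(X \<longlongrightarrow> x) F"
  then have "((\<lambda>i. dist (X i) x) \<longlongrightarrow> 0) F" using tendsto_dist_iff by blast
  then show "((\<lambda>i. cosh (dist (X i) x)) \<longlongrightarrow> 1) F"
    using tendsto_cosh[of "\<lambda>i. dist (X i) x" 0 F] by simp
next
  assume "((\<lambda>i. cosh (dist (X i) x)) \<longlongrightarrow> 1) F"
  then have "((\<lambda>i. arcosh (cosh (dist (X i) x))) \<longlongrightarrow> arcosh 1) F"
    by (intro tendsto_arcosh_strong) (auto simp: cosh_real_ge_1)
  then show "(X \<longlongrightarrow> x) F" by (subst tendsto_dist_iff) (simp add: arcosh_cosh_real)
qed

text \<open>Rests on the identity \<open>|1 - <u,v>|^2 - (1 - |u|^2)(1 - |v|^2) = (1 - |v|^2) |u -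
  v|^2 + |<u - v, v>|^2\<close>, whose left side is \<open>sinh^2\<close> of the distance times
  \<open>hnorm2 x * hnorm2 y\<close>.\<close>

lemma norm_diff_bcoord_le: "norm (bcoord x - bcoord y) \<le> sinh (dist x y)"
proof -
  define u v where "u = bcoord x" and "v = bcoord y"
  define D where "D = (cmod (1 - cinner u v))\<^sup>2 - hnorm2 x * hnorm2 y"
  have nx: "0 < hnorm2 x" "hnorm2 x \<le> 1" and ny: "0 < hnorm2 y"
    using hnorm2_pos[of x] hnorm2_pos[of y] by (simp_all add: hnorm2_alt[of x])
  have vu: "cinner v u = cnj (cinner u v)" by (rule cinner_commute)
  \<comment> \<open>This square is exactly the excess of \<open>D\<close> over
    \<open>hnorm2 y\<close> times the squared norm of \<open>u - v\<close>.\<close>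
  have "0 \<le> (cmod (cinner (u - v) v))\<^sup>2" by simp
  also have "(cmod (cinner (u - v) v))\<^sup>2
      = (cmod (cinner u v))\<^sup>2 - 2 * (norm v)\<^sup>2 * Re (cinner u v) + (norm v)\<^sup>2 * (norm v)\<^sup>2"
    unfolding cinner_simps cinner_self cmod_power2 by (simp add: power2_eq_square algebra_simps)
  finally have 1: "0 \<le> (cmod (cinner u v))\<^sup>2 - 2 * (norm v)\<^sup>2 * Re (cinner u v)
      + (norm v)\<^sup>2 * (norm v)\<^sup>2" .
  have 2: "(norm (u - v))\<^sup>2 = (norm u)\<^sup>2 + (norm v)\<^sup>2 - 2 * Re (cinner u v)"
    by (simp add: power2_norm_eq_inner inner_diff_left inner_diff_right inner_commute
        inner_ell2_def cinner_simps vu)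
  have 3: "(cmod (1 - cinner u v))\<^sup>2 = 1 - 2 * Re (cinner u v) + (cmod (cinner u v))\<^sup>2"
    unfolding cmod_power2 by (simp add: power2_eq_square algebra_simps)
  have "D - (1 - (norm v)\<^sup>2) * (norm (u - v))\<^sup>2 \<ge> 0"
    using 1 unfolding D_def 3 hnorm2_alt u_def[symmetric] v_def[symmetric]
    unfolding 2 by (simp add: algebra_simps)
  then have "hnorm2 y * (norm (u - v))\<^sup>2 \<le> D"
    unfolding hnorm2_alt v_def by simp
  also have "D = ((cosh (dist x y))\<^sup>2 - 1) * (hnorm2 x * hnorm2 y)"
    unfolding D_def u_def v_def B_hvec[symmetric] cmod_B_hvec
    using nx ny by (simp add: power_mult_distrib algebra_simps)
  also have "\<dots> \<le> hnorm2 y * (sinh (dist x y))\<^sup>2"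
    using nx ny by (simp add: cosh_square_eq mult_left_le mult.commute mult_left_le_one_le)
  finally have "(norm (u - v))\<^sup>2 \<le> (sinh (dist x y))\<^sup>2" using ny by simp
  then show ?thesis unfolding u_def v_def by (rule power2_le_imp_le) simp
qed

lemma tendsto_hvec [tendsto_intros]:
  assumes "(X \<longlongrightarrow> x) F" shows "((\<lambda>i. hvec (X i)) \<longlongrightarrow> hvec x) F"
proof -
  have "((\<lambda>i. dist (X i) x) \<longlongrightarrow> 0) F" using assms tendsto_dist_iff by blast
  then have "((\<lambda>i. sinh (dist (X i) x)) \<longlongrightarrow> 0) F"
    using tendsto_sinh[of "\<lambda>i. dist (X i) x" 0 F] by simp
  then have "((\<lambda>i. bcoord (X i) - bcoord x) \<longlongrightarrow> 0) F"
    by (rule tendsto_0_le[where K = 1]) (simp add: norm_diff_bcoord_le)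
  then have "((\<lambda>i. bcoord (X i)) \<longlongrightarrow> bcoord x) F" by (rule LIM_zero_cancel)
  then show ?thesis unfolding hvec_def by (intro tendsto_intros)
qed

lemma tendsto_point:
  assumes X: "(X \<longlongrightarrow> Y) F" and Y: "B_positive Y"
  shows "((\<lambda>i. point (X i)) \<longlongrightarrow> point Y) F"
proof -
  have Y0: "0 < Re (B Y Y)" using Y unfolding B_positive_def .
  have "((\<lambda>i. Re (B (X i) (X i))) \<longlongrightarrow> Re (B Y Y)) F" by (intro tendsto_intros X)
  then have ev: "\<forall>\<^sub>F i in F. 0 < Re (B (X i) (X i))" using Y0 order_tendstoD(1) by blast
  have "((\<lambda>i. cmod (B (X i) Y) / sqrt (Re (B (X i) (X i)) * Re (B Y Y)))
      \<longlongrightarrow> cmod (B Y Y) / sqrt (Re (B Y Y) * Re (B Y Y))) F"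
    using Y0 by (intro tendsto_intros X) auto
  also have "cmod (B Y Y) / sqrt (Re (B Y Y) * Re (B Y Y)) = 1"
    using Y0 by (subst B_self_real) simp
  finally have lim: "((\<lambda>i. cmod (B (X i) Y) / sqrt (Re (B (X i) (X i)) * Re (B Y Y))) \<longlongrightarrow> 1) F" .
  have "((\<lambda>i. cosh (dist (point (X i)) (point Y))) \<longlongrightarrow> 1) F"
  proof (rule Lim_transform_eventually[OF lim], rule eventually_mono[OF ev])
    fix i assume "0 < Re (B (X i) (X i))"
    then show "cmod (B (X i) Y) / sqrt (Re (B (X i) (X i)) * Re (B Y Y))
        = cosh (dist (point (X i)) (point Y))"
      using cosh_dist_point[of "X i" Y] Y unfolding B_positive_def by simp
  qed
  then show ?thesis unfolding tendsto_chyp_iff .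
qed


section \<open>Projective isometries\<close>

definition pmap :: "(cvec \<Rightarrow> cvec) \<Rightarrow> chyp \<Rightarrow> chyp" where
  "pmap T x = point (T (rep_chyp x))"

lemma B_unitaryD:
  assumes "B_unitary T"
  shows "bij T" "T (X + Y) = T X + T Y" "T (cscale c X) = cscale c (T X)" "B (T X) (T Y) = B X Y"
  using assms unfolding B_unitary_def by blast+

lemma B_antiunitaryD:
  assumes "B_antiunitary T"
  shows "bij T" "T (X + Y) = T X + T Y" "T (cscale c X) = cscale (cnj c) (T X)"
    "B (T X) (T Y) = cnj (B X Y)"
  using assms unfolding B_antiunitary_def by blast+

lemma lift_cases [consumes 1, case_names unitary antiunitary]:
  assumes "lifts T r" obtains "B_unitary T" | "B_antiunitary T"
  using assms unfolding lifts_def by blast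

lemma lifts_B:
  assumes "lifts T r"
  shows "cmod (B (T X) (T Y)) = cmod (B X Y)" "Re (B (T X) (T X)) = Re (B X X)"
proof -
  have *: "B (T X) (T Y) = B X Y \<or> B (T X) (T Y) = cnj (B X Y)" for X Y
    using assms B_unitaryD(4) B_antiunitaryD(4) unfolding lifts_def by blast
  show "cmod (B (T X) (T Y)) = cmod (B X Y)" "Re (B (T X) (T X)) = Re (B X X)"
    using *[of X Y] *[of X X] by (auto simp del: B.simps)
qed

lemma lifts_positive: "lifts T r \<Longrightarrow> B_positive (T X) \<longleftrightarrow> B_positive X"
  by (simp add: B_positive_def lifts_B(2))

lemma lifts_point: "lifts T r \<Longrightarrow> B_positive X \<Longrightarrow> r (point X) = point (T X)"
  unfolding lifts_def by blast

lemma lifts_bij: "lifts T r \<Longrightarrow> bij T"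
  unfolding lifts_def B_unitary_def B_antiunitary_def by blast

lemma lifts_pmap:
  assumes "B_unitary T \<or> B_antiunitary T"
  shows "lifts T (pmap T)"
  unfolding lifts_def
proof (intro conjI allI impI assms)
  fix X assume X: "B_positive X"
  obtain c where c: "c \<noteq> 0" "rep_chyp (point X) = cscale c X"
    using point_eq_iff[OF X B_positive_rep] point_rep by metis
  have pos: "B_positive (T X)"
    using assms X B_unitaryD(4)[of T X X] B_antiunitaryD(4)[of T X X] unfolding B_positive_def by auto
  have "T (cscale c X) = cscale c (T X) \<or> T (cscale c X) = cscale (cnj c) (T X)"
    using assms B_unitaryD(3) B_antiunitaryD(3) by blast
  then show "pmap T (point X) = point (T X)"
    unfolding pmap_def c(2) using c(1) point_cscale[OF pos] by auto
qed

lemma lifts_unique: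
  assumes "lifts T r" "lifts T s" shows "r = s"
proof
  fix x obtain X where "B_positive X" "x = point X" by (rule chyp_cases)
  then show "r x = s x" using lifts_point[OF assms(1)] lifts_point[OF assms(2)] by simp
qed

lemma lifts_id: "lifts id id"
  unfolding lifts_def B_unitary_def by (simp only: bij_id id_apply) simp

lemma lifts_comp:
  assumes T: "lifts T r" and S: "lifts S s" shows "lifts (T \<circ> S) (r \<circ> s)"
proof -
  have b: "bij (T \<circ> S)" using lifts_bij[OF T] lifts_bij[OF S] by (simp add: bij_comp)
  have "B_unitary (T \<circ> S) \<or> B_antiunitary (T \<circ> S)"
    using T
  proof (cases rule: lift_cases)
    case unitary
    note T' = B_unitaryD[OF this]
    show ?thesis using S
    proof (cases rule: lift_cases)
      case unitary
      note S' = B_unitaryD[OF this]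
      show ?thesis by (rule disjI1) (use b in \<open>simp only: B_unitary_def comp_apply T' S', simp\<close>)
    next
      case antiunitary
      note S' = B_antiunitaryD[OF this]
      show ?thesis by (rule disjI2) (use b in \<open>simp only: B_antiunitary_def comp_apply T' S', simp\<close>)
    qed
  next
    case antiunitary
    note T' = B_antiunitaryD[OF this]
    show ?thesis using S
    proof (cases rule: lift_cases)
      case unitary
      note S' = B_unitaryD[OF this]
      show ?thesis by (rule disjI2) (use b in \<open>simp only: B_antiunitary_def comp_apply T' S', simp\<close>)
    next
      case antiunitary
      note S' = B_antiunitaryD[OF this]
      show ?thesis
        by (rule disjI1) (use b in \<open>simp only: B_unitary_def comp_apply T' S' complex_cnj_cnj, simp\<close>)
    qed
  qed
  then show ?thesis
    unfolding lifts_def using lifts_point[OF T] lifts_point[OF S] lifts_positive[OF S] by simp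
qed

lemma B_unitary_inv: assumes T: "B_unitary T" shows "B_unitary (inv_into UNIV T)"
proof -
  note b = B_unitaryD(1)[OF T]
  have surj: "T (inv_into UNIV T Y) = Y" and inj: "inv_into UNIV T (T Y) = Y" for Y
    using b by (simp_all add: bij_is_surj surj_f_inv_f bij_is_inj)
  show ?thesis
    unfolding B_unitary_def
  proof (intro conjI allI)
    show "bij (inv_into UNIV T)" using b by (rule bij_imp_bij_inv)
    fix X Y c
    show "inv_into UNIV T (X + Y) = inv_into UNIV T X + inv_into UNIV T Y" by (metis B_unitaryD(2)[OF T] surj inj)
    show "inv_into UNIV T (cscale c X) = cscale c (inv_into UNIV T X)" by (metis B_unitaryD(3)[OF T] surj inj)
    show "B (inv_into UNIV T X) (inv_into UNIV T Y) = B X Y" by (metis B_unitaryD(4)[OF T] surj)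
  qed
qed

lemma B_antiunitary_inv: assumes T: "B_antiunitary T" shows "B_antiunitary (inv_into UNIV T)"
proof -
  note b = B_antiunitaryD(1)[OF T]
  have surj: "T (inv_into UNIV T Y) = Y" and inj: "inv_into UNIV T (T Y) = Y" for Y
    using b by (simp_all add: bij_is_surj surj_f_inv_f bij_is_inj)
  show ?thesis
    unfolding B_antiunitary_def
  proof (intro conjI allI)
    show "bij (inv_into UNIV T)" using b by (rule bij_imp_bij_inv)
    fix X Y c
    show "inv_into UNIV T (X + Y) = inv_into UNIV T X + inv_into UNIV T Y" by (metis B_antiunitaryD(2)[OF T] surj inj)
    have "T (cscale (cnj c) (inv_into UNIV T X)) = cscale c X" by (simp add: B_antiunitaryD[OF T] surj)
    then show "inv_into UNIV T (cscale c X) = cscale (cnj c) (inv_into UNIV T X)" by (metis inj)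
    show "B (inv_into UNIV T X) (inv_into UNIV T Y) = cnj (B X Y)"
      by (metis B_antiunitaryD(4)[OF T] surj complex_cnj_cnj)
  qed
qed

lemma lifts_inv:
  assumes T: "lifts T r" shows "lifts (inv_into UNIV T) (inv_into UNIV r)" "bij r"
proof -
  have u: "B_unitary (inv_into UNIV T) \<or> B_antiunitary (inv_into UNIV T)"
    using T by (cases rule: lift_cases) (auto simp: B_unitary_inv B_antiunitary_inv)
  have S: "lifts (inv_into UNIV T) (pmap (inv_into UNIV T))" using u by (rule lifts_pmap)
  have "T \<circ> inv_into UNIV T = id" "inv_into UNIV T \<circ> T = id"
    using lifts_bij[OF T] by (auto simp: fun_eq_iff bij_is_surj surj_f_inv_f bij_is_inj)
  then have 1: "r \<circ> pmap (inv_into UNIV T) = id" "pmap (inv_into UNIV T) \<circ> r = id"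
    using lifts_comp[OF T S] lifts_comp[OF S T] lifts_unique lifts_id by metis+
  then show "bij r" using o_bij by blast
  have "pmap (inv_into UNIV T) = inv_into UNIV r" using 1 by (metis inv_unique_comp)
  then show "lifts (inv_into UNIV T) (inv_into UNIV r)" using S by simp
qed

lemma lifts_dist:
  assumes T: "lifts T r" shows "dist (r x) (r y) = dist x y"
proof -
  obtain X Y where XY: "B_positive X" "x = point X" "B_positive Y" "y = point Y"
    using chyp_cases by metis
  have "cosh (dist (r x) (r y)) = cosh (dist x y)"
    unfolding XY lifts_point[OF T XY(1)] lifts_point[OF T XY(3)]
    using XY lifts_positive[OF T] by (simp add: cosh_dist_point lifts_B[OF T])
  then show ?thesis using arcosh_cosh_real zero_le_dist by metis
qed

lemma lifts_in_Is: "lifts T r \<Longrightarrow> r \<in> carrier Is"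
  using lifts_inv(2) lifts_dist by (auto simp: Is_def)

section \<open>Cartan arguments under lifts, and transitivity of the unitary group\<close>

lemma Cart_unitary:
  assumes T: "lifts T r" and "B_unitary T" shows "Cart (r x) (r y) (r z) = Cart x y z"
proof -
  obtain X Y Z where XYZ: "B_positive X" "x = point X" "B_positive Y" "y = point Y"
    "B_positive Z" "z = point Z" using chyp_cases by metis
  show ?thesis using XYZ by (simp add: lifts_point[OF T] Cart_point lifts_positive[OF T] B_unitaryD(4)[OF assms(2)])
qed

text \<open>It fails on the negative reals, where \<open>Arg\<close> is \<open>pi\<close> for both
  numbers. Positivity of the real part of the triple product keeps Cartan arguments away from
  there.\<close>

lemma Arg_cnj_Re_pos: "0 < Re z \<Longrightarrow> Arg (cnj z) = - Arg z"
  using Arg_eq_0[of z] unfolding Arg_cnj by auto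

lemma Cart_antiunitary:
  assumes T: "lifts T r" and "B_antiunitary T" shows "Cart (r x) (r y) (r z) = - Cart x y z"
proof -
  obtain X Y Z where XYZ: "B_positive X" "x = point X" "B_positive Y" "y = point Y"
    "B_positive Z" "z = point Z" using chyp_cases by metis
  show ?thesis using XYZ Arg_cnj_Re_pos[OF Re_triple_pos[OF XYZ(1,3,5)]]
    by (simp add: lifts_point[OF T] Cart_point lifts_positive[OF T] B_antiunitaryD(4)[OF assms(2)])
qed

text \<open>The reflection \<open>Y \<mapsto> - Y + 2 B(N, Y) / B(N, N) N\<close> exchanges two unit vectors whose
  product is real when \<open>N\<close> is their sum.\<close>
lemma exists_unitary_origin: "\<exists>T. B_unitary T \<and> pmap T origin = x"
proof -
  define b where "b = 1 / sqrt (hnorm2 x)"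
  have b0: "b > 0" unfolding b_def using hnorm2_pos[of x] by simp
  have "b * b = 1 / (sqrt (hnorm2 x) * sqrt (hnorm2 x))" unfolding b_def by simp
  also have "sqrt (hnorm2 x) * sqrt (hnorm2 x) = hnorm2 x"
    using hnorm2_pos[of x] by (simp only: real_sqrt_mult_self)
  finally have b1: "b * b * hnorm2 x = 1" using hnorm2_pos[of x] by simp
  note b = b0 b1
  \<comment> \<open>The unit representative of \<open>x\<close> whose product with
    \<open>(1, 0)\<close> is the positive real \<open>b\<close>. Then \<open>B N N = 2 + 2 b\<close>
    is nonzero and the reflection along \<open>N\<close> is defined.\<close>
  define X where "X = cscale (of_real b) (hvec x)"
  define N where "N = (1, 0) + X"
  define c where "c = B N N"
  have 0: "B (1, 0) (1, 0) = 1" "B (1, 0) X = of_real b" "B X (1, 0) = of_real b" "B X X = 1"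
    unfolding X_def B_scale_left B_scale_right B_hvec_self B_hvec_origin
  proof -
    show "B (1, 0) (1, 0) = 1" by (simp add: cinner_simps)
    have "complex_of_real (b * b * hnorm2 x) = 1" unfolding b by simp
    then show "of_real b * (cnj (of_real b) * of_real (hnorm2 x)) = (1 :: complex)"
      by (simp add: mult.assoc)
  qed simp_all
  have c: "c = of_real (2 + 2 * b)"
    unfolding c_def N_def B_add_left B_add_right 0 by simp
  have c0: "c \<noteq> 0" using b unfolding c of_real_eq_0_iff by linarith
  have cc: "cnj c = c" unfolding c by (rule complex_cnj_complex_of_real)
  define T where "T Y = cscale (2 * B N Y / c) N - Y" for Y
  have NT: "B N (T Y) = B N Y" for Y
    unfolding T_def B_diff_right B_scale_right c_def[symmetric] using c0 by simp
  have TT: "T (T Y) = Y" for Y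
    by (subst T_def, subst NT) (simp add: T_def)
  have "B_unitary T"
    unfolding B_unitary_def
  proof (intro conjI allI)
    show "bij T" using TT by (intro o_bij[of T]) auto
    show "T (Y + Z) = T Y + T Z" for Y Z
      unfolding T_def B_add_right by (simp add: distrib_left add_divide_distrib cvec.scale_left_distrib)
    show "T (cscale a Y) = cscale a (T Y)" for a Y
      unfolding T_def B_scale_right by (simp add: cvec.scale_right_diff_distrib mult.left_commute)
    show "B (T Y) (T Z) = B Y Z" for Y Z
    proof -
      have "B (T Y) (T Z) = 2 * B Y N / c * B N Z - B Y (T Z)"
        unfolding T_def[of Y] B_diff_left B_scale_left NT
        by (simp add: cc B_commute[of Y N])
      also have "B Y (T Z) = 2 * B N Z / c * B Y N - B Y Z"
        unfolding T_def B_diff_right B_scale_right by simp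
      finally show ?thesis by simp
    qed
  qed
  moreover have "B N (1, 0) = of_real (1 + b)"
    unfolding N_def B_add_left 0 by simp
  then have "2 * B N (1, 0) / c = 1"
    using c0 unfolding c by (simp add: distrib_left)
  then have "T (1, 0) = cscale 1 N - (1, 0)"
    unfolding T_def by simp
  then have "T (1, 0) = X" unfolding N_def by simp
  then have "pmap T origin = point X"
    using lifts_point[OF lifts_pmap, of T "(1, 0)"] \<open>B_unitary T\<close>
    unfolding origin_def by (simp add: B_positive_Pair)
  moreover have "point X = x"
    unfolding X_def using b by (subst point_cscale) auto
  ultimately show ?thesis by auto
qed

section \<open>Isometries are holomorphic or antiholomorphic\<close>

lemma norm_diff_scaleC:
  "(norm (u - scaleC c v))\<^sup>2 = (norm u)\<^sup>2 + (cmod c)\<^sup>2 * (norm v)\<^sup>2 - 2 * Re (c * cinner u v)"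
proof -
  have "(norm (u - scaleC c v))\<^sup>2 = (norm u)\<^sup>2 + (norm (scaleC c v))\<^sup>2 - 2 * inner u (scaleC c v)"
    by (simp add: power2_norm_eq_inner inner_diff_left inner_diff_right inner_commute)
  then show ?thesis
    by (simp add: norm_scaleC power_mult_distrib inner_ell2_def cinner_scaleC_right)
qed

text \<open>Expanding \<open>|1 - s w|^2\<close> at \<open>s = 1\<close> and \<open>s = 1/2\<close>
  gives two independent linear equations for the real part and the squared modulus. For a map of the
  ball, the second equation comes from halving one argument.\<close>

lemma Re_eq_norm_eq_of_cmod_one_minus:
  assumes 1: "cmod (1 - w) = cmod (1 - z)"
    and 2: "cmod (1 - of_real (1/2) * w) = cmod (1 - of_real (1/2) * z)"
  shows "Re w = Re z" "cmod w = cmod z"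
proof -
  have sq: "(cmod (1 - of_real s * w))\<^sup>2 = 1 - 2 * s * Re w + s\<^sup>2 * (cmod w)\<^sup>2" for s w
    unfolding cmod_power2 by (simp add: power2_eq_square algebra_simps)
  have a: "1 - 2 * Re w + (cmod w)\<^sup>2 = 1 - 2 * Re z + (cmod z)\<^sup>2"
    using sq[of 1 w] sq[of 1 z] 1 by simp
  have b: "1 - Re w + (cmod w)\<^sup>2 / 4 = 1 - Re z + (cmod z)\<^sup>2 / 4"
    using sq[of "1/2" w] sq[of "1/2" z] 2 by (simp add: power2_eq_square)
  have c: "(cmod w)\<^sup>2 = (cmod z)\<^sup>2" using a b by linarith
  then show "cmod w = cmod z" by (simp add: power2_eq_iff_nonneg)
  show "Re w = Re z" using a c by linarith
qed

text \<open>A Wigner-type argument. Equality in Cauchy-Schwarz makes \<open>h\<close> commute with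
  halving; the hypothesis at \<open>u\<close> and at \<open>u/2\<close> then fixes real part and
  modulus of each product; equality again forces \<open>h\<close> to send \<open>\<i> u\<close> to
  plus or minus \<open>\<i> h u\<close>. What remains is that the sign does not depend on
  \<open>u\<close>.\<close>

lemma ball_map_cinner:
  fixes h :: "ell2 \<Rightarrow> ell2"
  assumes n: "\<And>u. norm u < 1 \<Longrightarrow> norm (h u) = norm u"
    and d: "\<And>u v. norm u < 1 \<Longrightarrow> norm v < 1 \<Longrightarrow>
      cmod (1 - cinner (h u) (h v)) = cmod (1 - cinner u v)"
  shows "(\<forall>u v. norm u < 1 \<longrightarrow> norm v < 1 \<longrightarrow> cinner (h u) (h v) = cinner u v) \<or>
    (\<forall>u v. norm u < 1 \<longrightarrow> norm v < 1 \<longrightarrow> cinner (h u) (h v) = cnj (cinner u v))"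
proof -
  \<comment> \<open>The hypothesis yields \<open>Re w >= s |u|^2\<close>, and expanding the squared
    norm of \<open>h (s u) - s (h u)\<close> then leaves a quantity that is at most zero.\<close>
  have half: "h (scaleC (of_real (1/2)) u) = scaleC (of_real (1/2)) (h u)" if u: "norm u < 1" for u
  proof -
    define s :: real where "s = 1/2"
    define w where "w = cinner (h (scaleC (of_real s) u)) (h u)"
    have su: "norm (scaleC (of_real s) u) < 1" using u by (simp add: norm_scaleC s_def)
    have "(norm u)\<^sup>2 \<le> 1" using u by (simp add: power_le_one)
    have "cmod (1 - w) = cmod (1 - of_real (s * (norm u)\<^sup>2))"
      unfolding w_def d[OF su u] by (simp add: cinner_scaleC_left cinner_self)
    also have "\<dots> = cmod (of_real (1 - s * (norm u)\<^sup>2))" by simp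
    also have "\<dots> = \<bar>1 - s * (norm u)\<^sup>2\<bar>" by (rule norm_of_real)
    also have "\<dots> = 1 - s * (norm u)\<^sup>2" using \<open>(norm u)\<^sup>2 \<le> 1\<close> unfolding s_def by simp
    finally have "1 - Re w \<le> 1 - s * (norm u)\<^sup>2"
      using complex_Re_le_cmod[of "1 - w"] by simp
    moreover have "(norm (h (scaleC (of_real s) u) - scaleC (of_real s) (h u)))\<^sup>2
        = s\<^sup>2 * (norm u)\<^sup>2 + s\<^sup>2 * (norm u)\<^sup>2 - 2 * (s * Re w)"
      unfolding norm_diff_scaleC n[OF su] n[OF u] w_def
      by (simp add: norm_scaleC power_mult_distrib)
    ultimately have "(norm (h (scaleC (of_real s) u) - scaleC (of_real s) (h u)))\<^sup>2 \<le> 0"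
      by (simp add: s_def power2_eq_square)
    then show ?thesis unfolding s_def by simp
  qed
  have key: "Re (cinner (h u) (h v)) = Re (cinner u v)" "cmod (cinner (h u) (h v)) = cmod (cinner u v)"
    if u: "norm u < 1" and v: "norm v < 1" for u v
  proof -
    have hu: "norm (scaleC (of_real (1/2)) u) < 1" using u by (simp add: norm_scaleC)
    have "cmod (1 - of_real (1/2) * cinner (h u) (h v)) = cmod (1 - of_real (1/2) * cinner u v)"
      using d[OF hu v] unfolding half[OF u] cinner_scaleC_left by simp
    from Re_eq_norm_eq_of_cmod_one_minus[OF d[OF u v] this]
    show "Re (cinner (h u) (h v)) = Re (cinner u v)" "cmod (cinner (h u) (h v)) = cmod (cinner u v)" .
  qed
  \<comment> \<open>The product of \<open>h (\<i> u)\<close> and \<open>h u\<close> is purely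
    imaginary of maximal modulus, so these vectors are proportional; the sign of the imaginary part
    selects \<open>e\<close>.\<close>
  have "\<exists>e::real. (e = 1 \<or> e = -1) \<and> h (scaleC \<i> u) = scaleC (of_real e * \<i>) (h u)"
    if u: "norm u < 1" for u
  proof -
    have iu: "norm (scaleC \<i> u) < 1" using u by (simp add: norm_scaleC)
    define w where "w = cinner (h (scaleC \<i> u)) (h u)"
    have "cinner (scaleC \<i> u) u = - \<i> * of_real ((norm u)\<^sup>2)"
      by (simp add: cinner_scaleC_left cinner_self)
    then have w: "Re w = 0" "cmod w = (norm u)\<^sup>2"
      unfolding w_def key[OF iu u] by (simp_all add: norm_mult norm_power)
    then have "\<bar>Im w\<bar> = (norm u)\<^sup>2" by (simp add: cmod_def)
    then obtain e :: real where e: "e = 1 \<or> e = -1" "Im w = - e * (norm u)\<^sup>2"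
      by (cases "Im w \<ge> 0") (force simp: abs_if split: if_splits)+
    have "(norm (h (scaleC \<i> u) - scaleC (of_real e * \<i>) (h u)))\<^sup>2 = 0"
      unfolding norm_diff_scaleC n[OF iu] n[OF u] w_def[symmetric]
      using e w by (auto simp: norm_scaleC norm_mult)
    then show ?thesis using e(1) by auto
  qed
  then obtain e :: "ell2 \<Rightarrow> real" where e: "\<And>u. norm u < 1 \<Longrightarrow> e u = 1 \<or> e u = -1"
    "\<And>u. norm u < 1 \<Longrightarrow> h (scaleC \<i> u) = scaleC (of_real (e u) * \<i>) (h u)"
    by metis
  have Im: "Im (cinner (h u) (h v)) = e u * Im (cinner u v)" if u: "norm u < 1" and v: "norm v < 1" for u v
  proof -
    have iu: "norm (scaleC \<i> u) < 1" using u by (simp add: norm_scaleC)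
    show ?thesis using key(1)[OF iu v] e(1)[OF u] unfolding e(2)[OF u] cinner_scaleC_left by auto
  qed
  \<comment> \<open>The imaginary part of the product is antisymmetric, so \<open>Im\<close> can be
    applied with the sign of either argument; a nonzero value forces the signs to agree.\<close>
  have eq: "e u = e v" if "norm u < 1" "norm v < 1" "Im (cinner u v) \<noteq> 0" for u v
    using Im[OF that(1,2)] Im[OF that(2,1)] that(3) cinner_commute[of u v] cinner_commute[of "h u" "h v"]
    by simp
  have Im_i: "Im (cinner u (scaleC \<i> z)) = inner u z" for u z
    by (simp add: cinner_scaleC_right inner_ell2_def)
  \<comment> \<open>Two vectors are compared through a third having nonzero imaginary product with
    both: \<open>\<i> (u + v) / 2\<close> when \<open>u\<close> and \<open>v\<close> are orthogonal
    for the real product, \<open>\<i> u\<close> otherwise.\<close>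
  have const: "e u = e v" if u: "norm u < 1" "u \<noteq> 0" and v: "norm v < 1" "v \<noteq> 0" for u v
  proof (cases "inner u v = 0")
    case True
    define w where "w = scaleC \<i> ((1/2) *\<^sub>R (u + v))"
    have "norm w < 1" unfolding w_def using u(1) v(1) norm_triangle_ineq[of u v]
      by (simp add: norm_scaleC)
    moreover have "Im (cinner u w) \<noteq> 0" "Im (cinner v w) \<noteq> 0"
      unfolding w_def Im_i using True u v by (simp_all add: inner_add_right inner_commute)
    ultimately show ?thesis using eq u v by metis
  next
    case False
    have "norm (scaleC \<i> u) < 1" using u by (simp add: norm_scaleC)
    moreover have "Im (cinner u (scaleC \<i> u)) \<noteq> 0" "Im (cinner v (scaleC \<i> u)) \<noteq> 0"
      unfolding Im_i using False u by (simp_all add: inner_commute)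
    ultimately show ?thesis using eq u v by metis
  qed
  obtain e0 where e0: "e0 = 1 \<or> e0 = -1" "\<And>u. norm u < 1 \<Longrightarrow> u \<noteq> 0 \<Longrightarrow> e u = e0"
  proof (cases "\<exists>u::ell2. norm u < 1 \<and> u \<noteq> 0")
    case True
    then show ?thesis using that e(1) const by metis
  qed (use that in auto)
  have "Im (cinner (h u) (h v)) = e0 * Im (cinner u v)" if u: "norm u < 1" and v: "norm v < 1" for u v
  proof (cases "u = 0")
    case True
    then show ?thesis using n[OF u] by (simp add: cinner_simps)
  next
    case False
    then show ?thesis using Im[OF u v] e0(2)[OF u] by simp
  qed
  then show ?thesis
    using e0(1) key(1) by (auto simp: complex_eq_iff)
qed

lemma IsD:
  assumes "g \<in> carrier Is" shows "bij g" "dist (g x) (g y) = dist x y"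
  using assms by (auto simp: Is_def)

lemma Is_comp: "g \<in> carrier Is \<Longrightarrow> h \<in> carrier Is \<Longrightarrow> g \<circ> h \<in> carrier Is"
  by (auto simp: Is_def bij_comp)

theorem Is_Cart:
  assumes g: "g \<in> carrier Is"
  shows "(\<forall>x y z. Cart (g x) (g y) (g z) = Cart x y z) \<or> (\<forall>x y z. Cart (g x) (g y) (g z) = - Cart x y z)"
proof -
  obtain T where T: "B_unitary T" "pmap T origin = g origin" using exists_unitary_origin by blast
  have L: "lifts (inv_into UNIV T) (inv_into UNIV (pmap T))" "bij (pmap T)"
    using lifts_inv[OF lifts_pmap] T(1) by auto
  define k where "k = inv_into UNIV (pmap T) \<circ> g"
  have k: "k \<in> carrier Is" unfolding k_def by (intro Is_comp g lifts_in_Is[OF L(1)])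
  have ko: "k origin = origin"
    unfolding k_def using T(2) L(2) by (metis comp_apply bij_is_inj inv_f_f)
  have Ck: "Cart (k x) (k y) (k z) = Cart (g x) (g y) (g z)" for x y z
    unfolding k_def comp_apply by (rule Cart_unitary[OF L(1) B_unitary_inv[OF T(1)]])
  \<comment> \<open>The distance to the origin depends on \<open>hnorm2\<close> alone, so fixing the
    origin preserves norms in the ball.\<close>
  have nk: "hnorm2 (k x) = hnorm2 x" for x
    using cosh_dist_hvec[of "k x" origin] cosh_dist_hvec[of x origin] IsD(2)[OF k, of x origin]
      hnorm2_pos[of x] hnorm2_pos[of "k x"]
    by (simp add: ko hnorm2_def[of origin] cinner_simps)
  define h where "h u = bcoord (k (point (1, u)))" for u
  have hb: "h (bcoord x) = bcoord (k x)" for x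
    unfolding h_def by (simp flip: hvec_def)
  have "norm (h u) = norm u" if "norm u < 1" for u
    using nk[of "point (1, u)"] unfolding hnorm2_alt h_def bcoord_point[OF that] by simp
  moreover have "cmod (1 - cinner (h u) (h v)) = cmod (1 - cinner u v)"
    if u: "norm u < 1" and v: "norm v < 1" for u v
    using cmod_B_hvec[of "k (point (1, u))" "k (point (1, v))"] cmod_B_hvec[of "point (1, u)" "point (1, v)"]
    unfolding nk IsD(2)[OF k] unfolding B_hvec h_def[symmetric] bcoord_point[OF u] bcoord_point[OF v] by simp
  ultimately consider "\<And>u v. norm u < 1 \<Longrightarrow> norm v < 1 \<Longrightarrow> cinner (h u) (h v) = cinner u v"
    | "\<And>u v. norm u < 1 \<Longrightarrow> norm v < 1 \<Longrightarrow> cinner (h u) (h v) = cnj (cinner u v)"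
    using ball_map_cinner[of h] by blast
  then show ?thesis
  proof cases
    case 1
    have "B (hvec (k x)) (hvec (k y)) = B (hvec x) (hvec y)" for x y
      unfolding B_hvec hb[symmetric] using 1[OF norm_bcoord norm_bcoord] by simp
    then have "Cart (k x) (k y) (k z) = Cart x y z" for x y z unfolding Cart_hvec by simp
    then show ?thesis unfolding Ck by blast
  next
    case 2
    have "B (hvec (k x)) (hvec (k y)) = cnj (B (hvec x) (hvec y))" for x y
      unfolding B_hvec hb[symmetric] using 2[OF norm_bcoord norm_bcoord] by simp
    then have "Cart (k x) (k y) (k z) = - Cart x y z" for x y z unfolding Cart_hvec
      using Arg_cnj_Re_pos[OF Re_triple_pos, of "hvec x" "hvec y" "hvec z"] by simp
    then show ?thesis unfolding Ck by blast
  qed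
qed

section \<open>Extension of partial isometries\<close>

text \<open>Density of the complex span of the representatives, phrased through \<open>B\<close> so
  that (anti)unitary maps transport it at once; \<open>spanning_closure\<close> is the topological
  form.\<close>

definition spanning :: "chyp set \<Rightarrow> bool" where
  "spanning A \<longleftrightarrow> (\<forall>Y. (\<forall>x\<in>A. B (hvec x) Y = 0) \<longrightarrow> Y = 0)"

lemma spanningD: "spanning A \<Longrightarrow> (\<And>x. x \<in> A \<Longrightarrow> B (hvec x) Y = 0) \<Longrightarrow> Y = 0"
  unfolding spanning_def by blast

text \<open>The linear relation generated by the pairs \<open>(P x, Q x)\<close>. A relation is used
  because dependencies among the \<open>P x\<close> are not known in advance to hold among the
  \<open>Q x\<close>; it also makes the roles of \<open>P\<close> and \<open>Q\<close>
  symmetric.\<close>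

inductive_set lin_graph :: "'a set \<Rightarrow> ('a \<Rightarrow> cvec) \<Rightarrow> ('a \<Rightarrow> cvec) \<Rightarrow> (cvec \<times> cvec) set"
  for A P Q where
  zero: "(0, 0) \<in> lin_graph A P Q"
| step: "(Y, Z) \<in> lin_graph A P Q \<Longrightarrow> x \<in> A \<Longrightarrow>
    (Y + cscale c (P x), Z + cscale c (Q x)) \<in> lin_graph A P Q"

lemma lin_graph_swap: "(Y, Z) \<in> lin_graph A P Q \<Longrightarrow> (Z, Y) \<in> lin_graph A Q P"
  by (induction rule: lin_graph.induct) (auto intro: lin_graph.intros)

lemma lin_graph_base: "x \<in> A \<Longrightarrow> (P x, Q x) \<in> lin_graph A P Q"
  using lin_graph.step[OF lin_graph.zero, of x A 1 P Q] by simp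

lemma lin_graph_add:
  assumes "(W, U) \<in> lin_graph A P Q"
  shows "(Y, Z) \<in> lin_graph A P Q \<Longrightarrow> (W + Y, U + Z) \<in> lin_graph A P Q"
proof (induction rule: lin_graph.induct)
  case zero
  then show ?case using assms by simp
next
  case (step Y Z x c)
  then show ?case using lin_graph.step[of "W + Y" "U + Z" A P Q x c] by (simp add: add.assoc)
qed

lemma lin_graph_scale:
  "(Y, Z) \<in> lin_graph A P Q \<Longrightarrow> (cscale a Y, cscale a Z) \<in> lin_graph A P Q"
proof (induction rule: lin_graph.induct)
  case zero
  then show ?case by (simp add: lin_graph.zero)
next
  case (step Y Z x c)
  then show ?case using lin_graph.step[of "cscale a Y" "cscale a Z" A P Q x "a * c"]
    by (simp add: cvec.scale_right_distrib)
qed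

lemma lin_graph_diff:
  assumes "(W, U) \<in> lin_graph A P Q" "(Y, Z) \<in> lin_graph A P Q"
  shows "(W - Y, U - Z) \<in> lin_graph A P Q"
  using lin_graph_add[OF assms(1) lin_graph_scale[OF assms(2), of "-1"]]
  by (simp add: cvec.scale_minus_left)

lemma lin_graph_B:
  assumes iso: "\<And>x y. x \<in> A \<Longrightarrow> y \<in> A \<Longrightarrow> B (Q x) (Q y) = B (P x) (P y)"
    and W: "(W, U) \<in> lin_graph A P Q" and Y: "(Y, Z) \<in> lin_graph A P Q"
  shows "B U Z = B W Y"
proof -
  have 1: "B (Q x) Z = B (P x) Y" if "x \<in> A" for x
    using Y by (induction rule: lin_graph.induct) (simp_all add: that iso B_add_right B_scale_right)
  show ?thesis
    using W by (induction rule: lin_graph.induct) (simp_all add: 1 B_add_left B_scale_left)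
qed

lemma cmod_B_le: "cmod (B X Y) \<le> 2 * (norm X * norm Y)"
proof -
  have "cmod (B X Y) \<le> cmod (cnj (fst X) * fst Y) + cmod (cinner (snd X) (snd Y))"
    unfolding B_alt by (rule norm_triangle_ineq4)
  also have "\<dots> \<le> norm X * norm Y + norm X * norm Y"
    unfolding norm_mult complex_mod_cnj
    using norm_fst_le[of "fst X" "snd X"] norm_fst_le[of "fst Y" "snd Y"]
      norm_snd_le[of "snd X" "fst X"] norm_snd_le[of "snd Y" "fst Y"]
    by (intro add_mono mult_mono order_trans[OF cmod_cinner_le]) auto
  finally show ?thesis by simp
qed

text \<open>Here the indefiniteness of \<open>B\<close> is overcome. Since \<open>Q b\<close> is a
  multiple of \<open>(1, 0)\<close>, the first coordinate of \<open>Z\<close> is read off from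
  \<open>B (P b) Y\<close>, and the rest of the norm is controlled by
  \<open>B Z Z = B Y Y\<close>.\<close>

lemma lin_graph_bounded:
  assumes iso: "\<And>x y. x \<in> A \<Longrightarrow> y \<in> A \<Longrightarrow> B (Q x) (Q y) = B (P x) (P y)"
    and b: "b \<in> A" "Q b = cscale d (1, 0)" "d \<noteq> 0"
  shows "\<exists>K. 0 < K \<and> (\<forall>Y Z. (Y, Z) \<in> lin_graph A P Q \<longrightarrow> norm Z \<le> K * norm Y)"
proof -
  \<comment> \<open>From \<open>power2_norm_cvec\<close>: twice the square of
    \<open>2 (norm (P b) / cmod d)\<close>, plus 2 for the bound on \<open>B Y Y\<close>.\<close>
  define K where "K = sqrt (8 * (norm (P b) / cmod d)\<^sup>2 + 2)"
  have "0 < 8 * (norm (P b) / cmod d)\<^sup>2 + 2" by (rule add_nonneg_pos) simp_all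
  then have K: "K > 0" "K\<^sup>2 = 8 * (norm (P b) / cmod d)\<^sup>2 + 2" unfolding K_def by simp_all
  have "norm Z \<le> K * norm Y" if YZ: "(Y, Z) \<in> lin_graph A P Q" for Y Z
  proof -
    have "cnj d * B (1, 0) Z = B (P b) Y"
      using lin_graph_B[OF iso lin_graph_base[OF b(1)] YZ] unfolding b(2) B_scale_left by simp
    then have "cmod d * cmod (B (1, 0) Z) = cmod (B (P b) Y)"
      by (metis norm_mult complex_mod_cnj)
    also have "\<dots> \<le> 2 * (norm (P b) * norm Y)" by (rule cmod_B_le)
    finally have 1: "cmod (B (1, 0) Z) \<le> 2 * (norm (P b) / cmod d * norm Y)"
      using b(3) by (simp add: field_simps del: B.simps)
    have "(cmod (B (1, 0) Z))\<^sup>2 \<le> (2 * (norm (P b) / cmod d * norm Y))\<^sup>2"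
      by (rule power_mono[OF 1]) simp
    then have "(cmod (B (1, 0) Z))\<^sup>2 \<le> 4 * (norm (P b) / cmod d)\<^sup>2 * (norm Y)\<^sup>2"
      by (simp only: power_mult_distrib) simp
    moreover have "- Re (B Z Z) \<le> 2 * (norm Y)\<^sup>2"
    proof -
      have "- Re (B Z Z) = - Re (B Y Y)" using lin_graph_B[OF iso YZ YZ] by simp
      also have "\<dots> \<le> cmod (B Y Y)" using abs_Re_le_cmod[of "B Y Y"] by linarith
      also have "\<dots> \<le> 2 * (norm Y)\<^sup>2" using cmod_B_le[of Y Y] by (simp add: power2_eq_square)
      finally show ?thesis .
    qed
    ultimately have "(norm Z)\<^sup>2 \<le> 2 * (4 * (norm (P b) / cmod d)\<^sup>2 * (norm Y)\<^sup>2) + 2 * (norm Y)\<^sup>2"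
      unfolding power2_norm_cvec[of Z] by linarith
    also have "\<dots> = (K * norm Y)\<^sup>2"
      unfolding power_mult_distrib[of K] K(2) by (simp only: distrib_right mult.assoc)
    finally show ?thesis by (rule power2_le_imp_le) (use K in simp)
  qed
  then show ?thesis using K(1) by blast
qed

text \<open>The domain of the relation is dense by \<open>tot\<close>, and boundedness makes the
  second components of an approximating sequence Cauchy.\<close>

lemma lin_graph_domain:
  assumes iso: "\<And>x y. x \<in> A \<Longrightarrow> y \<in> A \<Longrightarrow> B (Q x) (Q y) = B (P x) (P y)"
    and b: "b \<in> A" "Q b = cscale d (1, 0)" "d \<noteq> 0"
    and tot: "\<And>Y. (\<And>x. x \<in> A \<Longrightarrow> B (P x) Y = 0) \<Longrightarrow> Y = 0"
  shows "\<exists>y z Z. (\<forall>n. (y n, z n) \<in> lin_graph A P Q) \<and> y \<longlonglongrightarrow> Y \<and> z \<longlonglongrightarrow> Z"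
proof -
  define S where "S = {Y. \<exists>Z. (Y, Z) \<in> lin_graph A P Q}"
  have "cvec.subspace S"
    unfolding S_def by (rule cvec.subspaceI)
      (use lin_graph.zero lin_graph_add lin_graph_scale in blast)+
  then have "closure S = UNIV"
  proof (intro closed_cvec_subspace_eq_UNIV closure_cvec_subspace closed_closure tot)
    fix Y x assume *: "\<And>X. X \<in> closure S \<Longrightarrow> B X Y = 0" and "x \<in> A"
    then have "P x \<in> S" unfolding S_def using lin_graph_base by fast
    then show "B (P x) Y = 0" using * closure_subset by blast
  qed
  then obtain y where y: "\<And>n. y n \<in> S" "y \<longlonglongrightarrow> Y"
    using closure_sequential[of Y S] by auto
  have "\<forall>n. \<exists>z. (y n, z) \<in> lin_graph A P Q" using y(1) unfolding S_def by blast
  from choice[OF this] obtain z where z: "\<And>n. (y n, z n) \<in> lin_graph A P Q" by blast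
  obtain K where K: "K > 0" "\<And>Y Z. (Y, Z) \<in> lin_graph A P Q \<Longrightarrow> norm Z \<le> K * norm Y"
    using lin_graph_bounded[of A Q P b d] iso b by blast
  have "Cauchy z"
  proof (rule metric_CauchyI)
    fix e :: real assume "e > 0"
    then obtain N where N: "\<And>m n. m \<ge> N \<Longrightarrow> n \<ge> N \<Longrightarrow> dist (y m) (y n) < e / K"
      using metric_CauchyD[OF LIMSEQ_imp_Cauchy[OF y(2)], of "e / K"] K(1) by auto
    have "dist (z m) (z n) < e" if "m \<ge> N" "n \<ge> N" for m n
    proof -
      have "dist (z m) (z n) \<le> K * dist (y m) (y n)"
        unfolding dist_norm by (intro K(2) lin_graph_diff z)
      also have "\<dots> < e" using N[OF that] K(1) by (simp add: field_simps)
      finally show ?thesis .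
    qed
    then show "\<exists>M. \<forall>m\<ge>M. \<forall>n\<ge>M. dist (z m) (z n) < e" by blast
  qed
  then obtain Z where "z \<longlonglongrightarrow> Z" using Cauchy_convergent_iff convergent_def by blast
  then show ?thesis using y(2) z by blast
qed

text \<open>The operator is read off from the closure \<open>G\<close> of the graph. One base vector
  on each side is required, because boundedness is used for the relation and for its
  converse.\<close>

lemma exists_unitary_extension:
  assumes iso: "\<And>x y. x \<in> A \<Longrightarrow> y \<in> A \<Longrightarrow> B (Q x) (Q y) = B (P x) (P y)"
    and a: "a \<in> A" "P a = cscale c (1, 0)" "c \<noteq> 0"
    and b: "b \<in> A" "Q b = cscale d (1, 0)" "d \<noteq> 0"
    and totP: "\<And>Y. (\<And>x. x \<in> A \<Longrightarrow> B (P x) Y = 0) \<Longrightarrow> Y = 0"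
    and totQ: "\<And>Y. (\<And>x. x \<in> A \<Longrightarrow> B (Q x) Y = 0) \<Longrightarrow> Y = 0"
  shows "\<exists>T. B_unitary T \<and> (\<forall>x\<in>A. T (P x) = Q x)"
proof -
  define G where "G = {(Y, Z). \<exists>y z. (\<forall>n. (y n, z n) \<in> lin_graph A P Q) \<and> y \<longlonglongrightarrow> Y \<and> z \<longlonglongrightarrow> Z}"
  have GB: "B U Z = B W Y" if WU: "(W, U) \<in> G" and YZ: "(Y, Z) \<in> G" for W U Y Z
  proof -
    obtain w u where wu: "\<And>n. (w n, u n) \<in> lin_graph A P Q" "w \<longlonglongrightarrow> W" "u \<longlonglongrightarrow> U"
      using WU unfolding G_def by blast
    obtain y z where yz: "\<And>n. (y n, z n) \<in> lin_graph A P Q" "y \<longlonglongrightarrow> Y" "z \<longlonglongrightarrow> Z"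
      using YZ unfolding G_def by blast
    have "(\<lambda>n. B (u n) (z n)) \<longlonglongrightarrow> B U Z" by (intro tendsto_B wu yz)
    moreover have "(\<lambda>n. B (u n) (z n)) = (\<lambda>n. B (w n) (y n))"
      using lin_graph_B[of A Q P, OF iso wu(1) yz(1)] by blast
    moreover have "(\<lambda>n. B (w n) (y n)) \<longlonglongrightarrow> B W Y" by (intro tendsto_B wu yz)
    ultimately show ?thesis using LIMSEQ_unique by metis
  qed
  have base: "(P x, Q x) \<in> G" if "x \<in> A" for x
    unfolding G_def using lin_graph_base[OF that, of P Q]
    by (intro CollectI case_prodI exI[of _ "\<lambda>_. P x"] exI[of _ "\<lambda>_. Q x"] conjI allI tendsto_const)
  have "\<exists>Z. (Y, Z) \<in> G" for Y
    using lin_graph_domain[of A Q P b d Y, OF iso b totP] unfolding G_def by blast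
  then obtain T where T: "\<And>Y. (Y, T Y) \<in> G" by metis
  have TP: "B (Q x) (T Y) = B (P x) Y" if "x \<in> A" for x Y
    using GB[OF base[OF that] T[of Y]] .
  \<comment> \<open>By \<open>totQ\<close> a vector is determined by its products with the
    \<open>Q x\<close>. Linearity of \<open>T\<close> and its values on the \<open>P x\<close> all
    come from this characterisation.\<close>
  have uniq: "Z = T Y" if "\<And>x. x \<in> A \<Longrightarrow> B (Q x) Z = B (P x) Y" for Y Z
  proof -
    have "Z - T Y = 0" by (rule totQ) (simp add: B_diff_right that TP)
    then show ?thesis by simp
  qed
  \<comment> \<open>Surjectivity: the domain statement for the converse relation, which uses the
    base vector \<open>P a\<close>.\<close>
  have "\<exists>Y. (Y, Z) \<in> G" for Z
    using lin_graph_domain[of A P Q a c Z, OF iso[symmetric] a totQ] lin_graph_swap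
    unfolding G_def by blast
  then have "surj T" using uniq GB[OF base] by (metis surjI)
  moreover have "inj T"
  proof (rule injI)
    fix Y Z assume "T Y = T Z"
    then have "Y - Z = 0" by (intro totP) (simp add: B_diff_right flip: TP)
    then show "Y = Z" by simp
  qed
  ultimately have "bij T" by (simp add: bij_def)
  moreover have "T (X + Y) = T X + T Y" for X Y
    by (rule uniq[symmetric]) (simp add: B_add_right TP)
  moreover have "T (cscale k X) = cscale k (T X)" for k X
    by (rule uniq[symmetric]) (simp add: B_scale_right TP)
  moreover have "B (T X) (T Y) = B X Y" for X Y by (rule GB[OF T T])
  ultimately have "B_unitary T" unfolding B_unitary_def by blast
  moreover have "T (P x) = Q x" if "x \<in> A" for x
    by (rule uniq[symmetric]) (rule iso[OF _ that])
  ultimately show ?thesis by blast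
qed

lemma hnorm2_origin [simp]: "hnorm2 origin = 1"
  by (simp add: hnorm2_def cinner_simps)

lemma cosh_dist_origin: "cosh (dist origin x) = 1 / sqrt (hnorm2 x)"
  by (simp add: cosh_dist_hvec del: hvec_origin)

text \<open>The Cartan arguments of the triples containing \<open>origin\<close> determine the products of the
  vectors representing the points, once these are normalised by their product with
  \<open>hvec origin\<close>.\<close>
lemma exists_unitary_extending:
  assumes A: "spanning A" "origin \<in> A" and hA: "spanning (h ` A)" "origin \<in> h ` A"
    and d: "\<And>x y. x \<in> A \<Longrightarrow> y \<in> A \<Longrightarrow> dist (h x) (h y) = dist x y"
    and C: "\<And>x y z. x \<in> A \<Longrightarrow> y \<in> A \<Longrightarrow> z \<in> A \<Longrightarrow> Cart (h x) (h y) (h z) = Cart x y z"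
  shows "\<exists>T. B_unitary T \<and> (\<forall>x\<in>A. pmap T x = h x)"
proof -
  define m where "m = hnorm2 (h origin)"
  have m: "m > 0" unfolding m_def by (rule hnorm2_pos)
  define \<beta> where "\<beta> x = B (hvec (h origin)) (hvec (h x))" for x
  have \<beta>0: "\<beta> x \<noteq> 0" for x unfolding \<beta>_def by simp
  \<comment> \<open>Scaled so that \<open>B (Q origin) (Q x) = 1\<close>, matching the product of
    \<open>hvec origin\<close> and \<open>hvec x\<close>.\<close>
  define Q where "Q x = cscale (of_real (sqrt m) / \<beta> x) (hvec (h x))" for x
  have Q0: "of_real (sqrt m) / \<beta> x \<noteq> 0" for x using m \<beta>0 by simp
  have cosh_origin: "cmod (\<beta> x) * sqrt (hnorm2 x) = sqrt m * sqrt (hnorm2 (h x))" if "x \<in> A" for x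
    unfolding \<beta>_def cmod_B_hvec d[OF A(2) that] cosh_dist_origin m_def
    using hnorm2_pos[of x] by (simp add: real_sqrt_mult)
  have "B (Q x) (Q y) = B (hvec x) (hvec y)" if x: "x \<in> A" and y: "y \<in> A" for x y
  proof -
    \<comment> \<open>The positive factor between \<open>B (Q x) (Q y)\<close> and the triple
      product of \<open>h x\<close>, \<open>h y\<close>, \<open>h origin\<close>; being positive, it
      leaves the argument unchanged.\<close>
    define r where "r = m / ((cmod (\<beta> x))\<^sup>2 * (cmod (\<beta> y))\<^sup>2)"
    have r: "r > 0" unfolding r_def using m \<beta>0 by simp
    have sm: "of_real (sqrt m) * of_real (sqrt m) = (of_real m :: complex)"
      using m by (simp flip: of_real_mult)
    have QQ: "B (Q x) (Q y) = of_real m / (cnj (\<beta> x) * \<beta> y) * B (hvec (h x)) (hvec (h y))"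
      unfolding Q_def B_scale_left B_scale_right by (simp add: sm[symmetric] mult_ac)
    have "of_real m / (cnj (\<beta> x) * \<beta> y) = of_real r * (cnj (\<beta> y) * \<beta> x)"
      unfolding r_def of_real_divide of_real_mult complex_norm_square
      using \<beta>0[of x] \<beta>0[of y] by (simp add: field_simps)
    then have "B (Q x) (Q y) = of_real r * (B (hvec (h x)) (hvec (h y)) *
        B (hvec (h y)) (hvec (h origin)) * B (hvec (h origin)) (hvec (h x)))"
      unfolding QQ by (simp add: \<beta>_def B_commute[of "hvec (h y)" "hvec (h origin)"])
    then have "Arg (B (Q x) (Q y)) = Cart (h x) (h y) (h origin)"
      unfolding Cart_hvec using r by (simp add: Arg_times_of_real)
    also have "\<dots> = Cart x y origin" by (rule C[OF x y A(2)])
    also have "\<dots> = Arg (B (hvec x) (hvec y))" unfolding Cart_hvec by (simp del: hvec_origin)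
    finally have Arg: "Arg (B (Q x) (Q y)) = Arg (B (hvec x) (hvec y))" .
    have "cmod (B (Q x) (Q y)) * (cmod (\<beta> x) * cmod (\<beta> y))
        = m * (cosh (dist x y) * (sqrt (hnorm2 (h x)) * sqrt (hnorm2 (h y))))"
      unfolding QQ using \<beta>0 m by (simp add: norm_mult norm_divide cmod_B_hvec d[OF x y] real_sqrt_mult)
    also have "\<dots> = cosh (dist x y) * ((sqrt m * sqrt (hnorm2 (h x))) * (sqrt m * sqrt (hnorm2 (h y))))"
      using m by (simp add: mult_ac)
    also have "\<dots> = cmod (B (hvec x) (hvec y)) * (cmod (\<beta> x) * cmod (\<beta> y))"
      unfolding cosh_origin[OF x, symmetric] cosh_origin[OF y, symmetric] cmod_B_hvec
      by (simp add: real_sqrt_mult mult_ac)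
    finally have "cmod (B (Q x) (Q y)) = cmod (B (hvec x) (hvec y))" using \<beta>0 by simp
    moreover from this have "B (Q x) (Q y) \<noteq> 0" by (metis B_hvec_nonzero norm_eq_zero)
    ultimately show ?thesis using Arg Arg_eq B_hvec_nonzero by metis
  qed
  moreover obtain b where b: "b \<in> A" "h b = origin" using hA(2) by (metis imageE)
  moreover have "Q b = cscale (of_real (sqrt m) / \<beta> b) (1, 0)" unfolding Q_def b(2) by simp
  moreover have "Y = 0" if "\<And>x. x \<in> A \<Longrightarrow> B (Q x) Y = 0" for Y
    by (rule spanningD[OF hA(1)]) (use that Q0 in \<open>auto simp: Q_def B_scale_left\<close>)
  ultimately have "\<exists>T. B_unitary T \<and> (\<forall>x\<in>A. T (hvec x) = Q x)"
    using exists_unitary_extension[of A Q hvec origin 1 b "of_real (sqrt m) / \<beta> b"]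
      spanningD[OF A(1)] A(2) Q0 by auto
  then obtain T where T: "B_unitary T" "\<And>x. x \<in> A \<Longrightarrow> T (hvec x) = Q x" by blast
  have "pmap T x = h x" if "x \<in> A" for x
  proof -
    have "pmap T (point (hvec x)) = point (T (hvec x))"
      by (rule lifts_point[OF lifts_pmap]) (simp_all add: T(1))
    then show ?thesis unfolding T(2)[OF that] Q_def using Q0[of x] by (simp add: point_cscale)
  qed
  then show ?thesis using T(1) by blast
qed


section \<open>Convergence of isometries on a spanning set\<close>

lemma spanning_closure:
  assumes "spanning A" shows "closure (cvec.span (hvec ` A)) = UNIV"
proof (rule closed_cvec_subspace_eq_UNIV)
  show "closed (closure (cvec.span (hvec ` A)))" by simp
  show "cvec.subspace (closure (cvec.span (hvec ` A)))"
    by (rule closure_cvec_subspace) (rule cvec.subspace_span)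
  fix Y assume Y: "\<And>X. X \<in> closure (cvec.span (hvec ` A)) \<Longrightarrow> B X Y = 0"
  show "Y = 0"
  proof (rule spanningD[OF assms])
    fix x assume "x \<in> A"
    then have "hvec x \<in> cvec.span (hvec ` A)" by (simp add: cvec.span_base)
    then show "B (hvec x) Y = 0" using Y closure_subset by blast
  qed
qed

text \<open>Lifts of the \<open>R i\<close> are eventually unitary and, after rescaling, converge to
  the identity on the span of the representatives of \<open>A\<close>. Continuity of
  \<open>\<rho>\<close> and uniqueness of extensions both follow from this.\<close>

lemma tendsto_on_spanning:
  assumes ev: "\<forall>\<^sub>F i in F. \<exists>T. lifts T (R i)"
    and A: "spanning A" "origin \<in> A"
    and xyz: "x \<in> A" "y \<in> A" "z \<in> A" "Cart x y z \<noteq> 0"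
    and lim: "\<And>x. x \<in> A \<Longrightarrow> ((\<lambda>i. R i x) \<longlongrightarrow> x) F"
  shows "((\<lambda>i. R i p) \<longlongrightarrow> p) F"
proof -
  define T where "T i = (SOME T. lifts T (R i))" for i
  have L: "\<forall>\<^sub>F i in F. lifts (T i) (R i)"
    using ev
  proof (rule eventually_mono)
    fix i assume "\<exists>T. lifts T (R i)"
    then show "lifts (T i) (R i)" unfolding T_def by (rule someI_ex)
  qed
  have "((\<lambda>i. Cart (R i x) (R i y) (R i z)) \<longlongrightarrow> Cart x y z) F"
    unfolding Cart_hvec
    by (intro isCont_tendsto_compose[OF continuous_at_Arg] tendsto_intros lim xyz)
      (use Re_triple_pos[of "hvec x" "hvec y" "hvec z"] in \<open>auto simp: complex_nonpos_Reals_iff\<close>)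
  \<comment> \<open>An antiunitary lift would negate the Cartan argument in the limit's place, at
    distance twice its absolute value.\<close>
  then have "\<forall>\<^sub>F i in F. dist (Cart (R i x) (R i y) (R i z)) (Cart x y z) < \<bar>Cart x y z\<bar>"
    by (rule tendstoD) (use xyz in simp)
  with L have U: "\<forall>\<^sub>F i in F. lifts (T i) (R i) \<and> B_unitary (T i)"
  proof eventually_elim
    case (elim i)
    have "\<not> B_antiunitary (T i)"
      using Cart_antiunitary[OF elim(1), of x y z] elim(2) by (auto simp: dist_real_def)
    then show ?case using elim(1) unfolding lifts_def by blast
  qed
  \<comment> \<open>Removes the arbitrary scalar of the lift: \<open>S i (hvec q)\<close> becomes
    \<open>hvec (R i q)\<close> divided by its product with \<open>hvec (R i origin)\<close>, an
    expression in \<open>R i\<close> alone.\<close>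
  define \<gamma> where "\<gamma> i = cnj (fst (T i (1, 0)))" for i
  define S where "S i Y = cscale (\<gamma> i) (T i Y)" for i Y
  have hvec_lim: "((\<lambda>i. S i (hvec q)) \<longlongrightarrow> hvec q) F" if q: "q \<in> A" for q
  proof -
    have "((\<lambda>i. cscale (1 / B (hvec (R i origin)) (hvec (R i q))) (hvec (R i q)))
        \<longlongrightarrow> cscale (1 / B (hvec origin) (hvec q)) (hvec q)) F"
      by (intro tendsto_intros lim A q) (rule B_hvec_nonzero)
    then have "((\<lambda>i. cscale (1 / B (hvec (R i origin)) (hvec (R i q))) (hvec (R i q)))
        \<longlongrightarrow> hvec q) F" by simp
    then show ?thesis
    proof (rule Lim_transform_eventually)
      show "\<forall>\<^sub>F i in F. cscale (1 / B (hvec (R i origin)) (hvec (R i q))) (hvec (R i q))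
          = S i (hvec q)"
        using U
      proof eventually_elim
        case (elim i)
        have ex: "\<exists>a. T i (hvec q) = cscale a (hvec (R i q))" for q
          using lifts_point[of "T i" "R i" "hvec q"] elim
            point_eq_iff[of "hvec (R i q)" "T i (hvec q)"] lifts_positive[of "T i" "R i"]
          by auto
        obtain a where a: "T i (hvec q) = cscale a (hvec (R i q))" using ex by blast
        obtain c where "T i (hvec origin) = cscale c (hvec (R i origin))" using ex by blast
        then have c: "T i (hvec origin) = cscale (cnj (\<gamma> i)) (hvec (R i origin))"
          unfolding \<gamma>_def by (simp add: hvec_def[of "R i origin"] cscale.simps)
        have "B (T i (hvec origin)) (T i (hvec q)) = 1"
          using B_unitaryD(4)[of "T i"] elim by (metis B_hvec_origin(1))
        then have "\<gamma> i * a * B (hvec (R i origin)) (hvec (R i q)) = 1"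
          unfolding a c B_scale_left B_scale_right by (simp add: mult_ac)
        then have "1 / B (hvec (R i origin)) (hvec (R i q)) = \<gamma> i * a"
          by (simp add: field_simps)
        then show ?case unfolding S_def a by simp
      qed
    qed
  qed
  have \<gamma>0: "\<forall>\<^sub>F i in F. \<gamma> i \<noteq> 0"
    using U
  proof eventually_elim
    case (elim i)
    then have "B_positive (T i (1, 0))"
      using lifts_positive[of "T i" "R i" "(1, 0)"] by (simp add: B_positive_Pair)
    then have "norm (snd (T i (1, 0))) < cmod (fst (T i (1, 0)))"
      using B_positive_Pair by (metis prod.collapse)
    then show ?case unfolding \<gamma>_def using norm_ge_zero[of "snd (T i (1, 0))"] by auto
  qed
  have "cvec.subspace {Y. ((\<lambda>i. S i Y) \<longlongrightarrow> Y) F}"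
  proof (rule cvec.subspaceI; simp only: mem_Collect_eq)
    have sc: "\<forall>\<^sub>F i in F. cscale c (S i Y) = S i (cscale c Y)" for c Y
      using U
    proof eventually_elim
      case (elim i)
      then show ?case unfolding S_def by (simp add: B_unitaryD(3)[of "T i"] mult.commute)
    qed
    have "\<forall>\<^sub>F i in F. 0 = S i 0"
      using sc[of 0 0] by eventually_elim simp
    then show "((\<lambda>i. S i 0) \<longlongrightarrow> 0) F" by (rule Lim_transform_eventually[OF tendsto_const])
    fix Y Z c assume Y: "((\<lambda>i. S i Y) \<longlongrightarrow> Y) F"
    show "((\<lambda>i. S i (cscale c Y)) \<longlongrightarrow> cscale c Y) F"
      by (rule Lim_transform_eventually[OF tendsto_cscale[OF tendsto_const Y] sc])
    assume Z: "((\<lambda>i. S i Z) \<longlongrightarrow> Z) F"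
    have "\<forall>\<^sub>F i in F. S i Y + S i Z = S i (Y + Z)"
      using U
    proof eventually_elim
      case (elim i)
      then show ?case unfolding S_def by (simp add: B_unitaryD(2)[of "T i"] cvec.scale_right_distrib)
    qed
    then show "((\<lambda>i. S i (Y + Z)) \<longlongrightarrow> Y + Z) F"
      by (rule Lim_transform_eventually[OF tendsto_add[OF Y Z]])
  qed
  then have "cvec.span (hvec ` A) \<subseteq> {Y. ((\<lambda>i. S i Y) \<longlongrightarrow> Y) F}"
    by (rule cvec.span_minimal[rotated]) (use hvec_lim in blast)
  then have span_lim: "((\<lambda>i. S i Y) \<longlongrightarrow> Y) F" if "Y \<in> cvec.span (hvec ` A)" for Y
    using that by blast
  have point_lim: "((\<lambda>i. R i (point Y)) \<longlongrightarrow> point Y) F"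
    if Y: "Y \<in> cvec.span (hvec ` A)" "B_positive Y" for Y
    using tendsto_point[OF span_lim[OF Y(1)] Y(2)]
  proof (rule Lim_transform_eventually)
    show "\<forall>\<^sub>F i in F. point (S i Y) = R i (point Y)"
      using U \<gamma>0
    proof eventually_elim
      case (elim i)
      then have "B_positive (T i Y)" using lifts_positive Y(2) by blast
      then show ?case
        unfolding S_def using elim lifts_point[of "T i" "R i" Y] Y(2) by (simp add: point_cscale)
    qed
  qed
  obtain Y where Y: "\<And>n. Y n \<in> cvec.span (hvec ` A)" "Y \<longlonglongrightarrow> hvec p"
    using closure_sequential[of "hvec p" "cvec.span (hvec ` A)"]
    unfolding spanning_closure[OF A(1)] by auto
  have pY: "(\<lambda>n. point (Y n)) \<longlonglongrightarrow> p"
    using tendsto_point[OF Y(2)] by simp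
  have "(\<lambda>n. Re (B (Y n) (Y n))) \<longlonglongrightarrow> Re (B (hvec p) (hvec p))" by (intro tendsto_intros Y)
  then have pos: "\<forall>\<^sub>F n in sequentially. B_positive (Y n)"
    unfolding B_positive_def by (rule order_tendstoD) (rule Re_B_hvec_pos)
  \<comment> \<open>Three-epsilon argument in the hyperbolic metric. The \<open>R i\<close> are
    isometries, which replaces a uniform bound on the operators \<open>S i\<close>.\<close>
  show ?thesis
  proof (rule tendstoI)
    fix e :: real assume e: "e > 0"
    have "\<forall>\<^sub>F n in sequentially. B_positive (Y n) \<and> dist (point (Y n)) p < e / 3"
      using pos tendstoD[OF pY, of "e / 3"] e by (simp add: eventually_conj_iff)
    then obtain n where n: "B_positive (Y n)" "dist (point (Y n)) p < e / 3"
      by (auto simp: eventually_sequentially)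
    define q where "q = point (Y n)"
    have "\<forall>\<^sub>F i in F. dist (R i q) q < e / 3"
      using tendstoD[OF point_lim[OF Y(1) n(1)], of "e / 3"] e by (simp add: q_def)
    with L show "\<forall>\<^sub>F i in F. dist (R i p) p < e"
    proof eventually_elim
      case (elim i)
      have "dist (R i p) p \<le> dist (R i p) (R i q) + dist (R i q) q + dist q p"
        using dist_triangle[of "R i p" p "R i q"] dist_triangle[of "R i q" p q] by linarith
      moreover have "dist (R i p) (R i q) = dist q p"
        using lifts_dist[OF elim(1)] by (simp add: dist_commute)
      ultimately show ?case using elim(2) n(2) unfolding q_def by linarith
    qed
  qed
qed

text \<open>The constant-sequence case of \<open>tendsto_on_spanning\<close>, applied to the
  composite of \<open>r\<close> with the inverse of \<open>s\<close>.\<close>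

lemma lifts_eq_on_spanning:
  assumes T: "lifts T r" and S: "lifts S s"
    and A: "spanning A" "origin \<in> A" and xyz: "x \<in> A" "y \<in> A" "z \<in> A" "Cart x y z \<noteq> 0"
    and eq: "\<And>x. x \<in> A \<Longrightarrow> r x = s x"
  shows "r = s"
proof -
  have s: "bij s" by (rule lifts_inv(2)[OF S])
  have L: "lifts (inv_into UNIV S \<circ> T) (inv_into UNIV s \<circ> r)"
    by (rule lifts_comp[OF lifts_inv(1)[OF S] T])
  have "(\<lambda>n::nat. (inv_into UNIV s \<circ> r) p) \<longlonglongrightarrow> p" for p
    using tendsto_on_spanning[of "\<lambda>_. inv_into UNIV s \<circ> r" sequentially A, OF _ A xyz] L eq s
    by (auto simp: bij_is_inj)
  then have "inv_into UNIV s (r p) = p" for p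
    using LIMSEQ_const_iff by fastforce
  then show ?thesis using s by (metis bij_inv_eq_iff ext)
qed

section \<open>Equivariant maps given by powers of the kernel\<close>

text \<open>The three arguments add up to some \<open>S\<close> with \<open>|S| < 3 pi / 2\<close>.
  Positive real part of the product means \<open>cos S > 0\<close>, which leaves only
  \<open>|S| < pi / 2\<close>, so neither \<open>S\<close> nor \<open>t S\<close> wraps
  around.\<close>

lemma Arg_prod3_powr:
  assumes pos: "0 < Re a" "0 < Re b" "0 < Re c" "0 < Re (a * b * c)" and t: "0 < t" "t \<le> 1"
  shows "Arg (a powr of_real t * b powr of_real t * c powr of_real t) = t * Arg (a * b * c)"
proof -
  have nz: "a \<noteq> 0" "b \<noteq> 0" "c \<noteq> 0" using pos by auto
  define S where "S = Arg a + Arg b + Arg c"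
  define r where "r = cmod a * cmod b * cmod c"
  have r: "r > 0" unfolding r_def using nz by simp
  have bd: "\<bar>Arg z\<bar> < pi / 2" if "0 < Re z" for z
  proof -
    have "z \<noteq> 0" using that by auto
    then show ?thesis using Re_Ln_pos_lt_imp[OF that] by (simp add: Arg_eq_Im_Ln)
  qed
  have S: "\<bar>S\<bar> < 3 * pi / 2"
    unfolding S_def using bd[OF pos(1)] bd[OF pos(2)] bd[OF pos(3)] by linarith
  have e: "exp (\<i> * of_real S) = exp (\<i> * of_real (Arg a)) * exp (\<i> * of_real (Arg b)) * exp (\<i> * of_real (Arg c))"
    unfolding S_def by (simp add: distrib_left exp_add)
  have abc: "a * b * c = of_real r * exp (\<i> * of_real S)"
    unfolding e r_def using Arg_eq[OF nz(1)] Arg_eq[OF nz(2)] Arg_eq[OF nz(3)]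
    by (metis (no_types, opaque_lifting) mult.assoc mult.left_commute of_real_mult)
  have "Re (a * b * c) = r * cos S" unfolding abc by (simp add: Re_exp)
  then have cosS: "cos S > 0" using pos(4) r by (simp add: zero_less_mult_iff)
  have "\<bar>S\<bar> < pi / 2"
  proof (rule ccontr)
    assume "\<not> \<bar>S\<bar> < pi / 2"
    then have "0 \<le> sin (\<bar>S\<bar> - pi / 2)" using S by (intro sin_ge_zero) auto
    also have "sin (\<bar>S\<bar> - pi / 2) = - cos \<bar>S\<bar>" by (simp add: sin_diff)
    finally show False using cosS by simp
  qed
  moreover from this have "Arg (a * b * c) = S"
    using r pi_gt_zero by (intro Arg_unique[OF abc[symmetric]]) auto
  moreover have "Arg (a powr of_real t * b powr of_real t * c powr of_real t) = t * S"
  proof (rule Arg_unique)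
    have "z powr of_real t = of_real (cmod z powr t) * exp (\<i> * of_real (t * Arg z))" if "z \<noteq> 0" for z
      using that by (simp add: powr_def Ln_Arg exp_of_real[symmetric] algebra_simps exp_add)
    note * = this[OF nz(1)] this[OF nz(2)] this[OF nz(3)]
    show "of_real (r powr t) * exp (\<i> * of_real (t * S)) = a powr of_real t * b powr of_real t * c powr of_real t"
      unfolding * r_def S_def by (simp add: powr_mult distrib_left exp_add)
    show "0 < r powr t" using r by simp
    have "\<bar>t * S\<bar> < pi"
      using \<open>\<bar>S\<bar> < pi / 2\<close> t mult_left_le_one_le[of "\<bar>S\<bar>" t] pi_gt_zero
      unfolding abs_mult by simp
    then show "- pi < t * S" "t * S \<le> pi" by auto
  qed
  ultimately show ?thesis by simp
qed

text \<open>Supplies the triple that tells unitary from antiunitary lifts. For \<open>u\<close> of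
  norm 1/2, the triple product of the origin, \<open>u\<close> and \<open>\<i> u\<close> is
  \<open>1 - \<i> / 4\<close>.\<close>

lemma exists_Cart_nonzero: "\<exists>x y z. Cart x y z \<noteq> 0"
proof -
  define u where "u = Abs_ell2 (\<lambda>n. if n = 0 then 1 / 2 else 0)"
  have "summable (\<lambda>n. (cmod (if n = 0 then 1 / 2 else 0))\<^sup>2)"
    by (rule summable_finite[of "{0}"]) auto
  then have u: "coord u = (\<lambda>n. if n = 0 then 1 / 2 else 0)"
    unfolding u_def by (rule coord_Abs)
  have "(norm u)\<^sup>2 = (\<Sum>n\<in>{0}. (cmod (coord u n))\<^sup>2)"
    unfolding power2_norm_ell2 by (rule suminf_finite) (auto simp: u)
  then have "(norm u)\<^sup>2 = (1 / 2)\<^sup>2" by (simp add: u)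
  then have n: "norm u = 1 / 2" by (subst (asm) power2_eq_iff_nonneg) auto
  have n': "norm (scaleC \<i> u) = 1 / 2" using n by (simp add: norm_scaleC)
  have *: "cinner u (scaleC \<i> u) = \<i> / 4"
    by (simp add: cinner_scaleC_right cinner_self n power2_eq_square)
  have "Cart origin (point (1, u)) (point (1, scaleC \<i> u)) = Arg (1 - cinner u (scaleC \<i> u))"
    unfolding Cart_hvec by (simp add: hvec_point n n' cinner_simps(5,6))
  also have "\<dots> = Arg (1 - \<i> / 4)" unfolding * ..
  also have "\<dots> \<noteq> 0" by (simp add: Arg_eq_0 complex_is_Real_iff)
  finally show ?thesis by blast
qed

lift_definition conj_ell2 :: "ell2 \<Rightarrow> ell2" is "\<lambda>u n. cnj (u n)" by simp

definition conj_cvec :: "cvec \<Rightarrow> cvec" where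
  "conj_cvec X = (cnj (fst X), conj_ell2 (snd X))"

lemma B_antiunitary_conj: "B_antiunitary conj_cvec"
proof -
  have c: "coord (conj_ell2 u) n = cnj (coord u n)" for u n by (simp add: conj_ell2.rep_eq)
  have "cinner (conj_ell2 u) (conj_ell2 v) = cnj (cinner u v)" for u v
  proof -
    have "(\<lambda>n. cnj (cnj (coord u n) * coord v n)) sums cnj (cinner u v)"
      unfolding cinner_def sums_cnj by (rule summable_sums[OF summable_cinner])
    then show ?thesis by (simp add: cinner_def c sums_iff)
  qed
  moreover have "conj_ell2 (u + v) = conj_ell2 u + conj_ell2 v"
    "conj_ell2 (scaleC k u) = scaleC (cnj k) (conj_ell2 u)" "conj_ell2 (conj_ell2 u) = u" for u v k
    by (rule ell2_eqI; simp add: c)+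
  ultimately show ?thesis
    unfolding B_antiunitary_def conj_cvec_def cscale_alt B_alt
    by (intro conjI allI o_bij[of conj_cvec]) (auto simp: conj_cvec_def)
qed

lemma lifts_zero:
  assumes "lifts T r" shows "T 0 = 0"
proof -
  have "T (0 + 0) = T 0 + T 0"
    using assms B_unitaryD(2) B_antiunitaryD(2) unfolding lifts_def by blast
  then show ?thesis by simp
qed

lemma spanning_image:
  assumes T: "lifts T r" and A: "spanning A" shows "spanning (r ` A)"
  unfolding spanning_def
proof (intro allI impI)
  fix Y assume Y: "\<forall>x\<in>r ` A. B (hvec x) Y = 0"
  obtain Z where Z: "Y = T Z" using lifts_bij[OF T] by (metis bij_pointE)
  have "B (hvec x) Z = 0" if "x \<in> A" for x
  proof -
    have "r x = point (T (hvec x))" using lifts_point[OF T, of "hvec x"] by simp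
    then obtain c where "c \<noteq> 0" "hvec (r x) = cscale c (T (hvec x))"
      using point_eq_iff[of "T (hvec x)" "hvec (r x)"] lifts_positive[OF T] by auto
    then have "B (T (hvec x)) (T Z) = 0"
      using Y that unfolding Z by (metis B_scale_left complex_cnj_zero_iff image_eqI mult_eq_0_iff)
    then have "cmod (B (hvec x) Z) = 0" using lifts_B(1)[OF T] by (metis norm_zero)
    then show ?thesis by simp
  qed
  then have "Z = 0" by (rule spanningD[OF A])
  then show "Y = 0" using Z lifts_zero[OF T] by simp
qed

text \<open>The interface between the analysis of the kernel and the geometry. Homogeneity makes
  rotations of the ball act diagonally, and positivity of the degrees ensures that averaging over
  them leaves only the first component.\<close>

locale kernel_power =
  fixes t :: real and \<phi> :: "ell2 \<Rightarrow> ell2" and deg :: "nat \<Rightarrow> nat"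
  assumes t: "0 < t" "t \<le> 1"
    and kernel: "norm u < 1 \<Longrightarrow> norm v < 1 \<Longrightarrow>
      1 - cinner (\<phi> u) (\<phi> v) = (1 - cinner u v) powr of_real t"
    and homogeneous: "norm u < 1 \<Longrightarrow> cmod c = 1 \<Longrightarrow>
      coord (\<phi> (scaleC c u)) k = c ^ deg k * coord (\<phi> u) k"
    and deg_pos: "0 < deg k"
    and total: "(\<And>u. norm u < 1 \<Longrightarrow> B (1, \<phi> u) Y = 0) \<Longrightarrow> Y = 0"
begin

section \<open>The equivariant map and its metric properties\<close>

definition f :: "chyp \<Rightarrow> chyp" where
  "f x = point (1, \<phi> (bcoord x))"

lemma norm_\<phi>: assumes "norm u < 1" shows "norm (\<phi> u) < 1"
proof -
  have u2: "0 < 1 - (norm u)\<^sup>2" using assms by (simp add: power_less_one_iff)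
  have "complex_of_real (1 - (norm (\<phi> u))\<^sup>2) = of_real (1 - (norm u)\<^sup>2) powr of_real t"
    using kernel[OF assms assms] by (simp add: cinner_self)
  also have "\<dots> = of_real ((1 - (norm u)\<^sup>2) powr t)" using u2 by (intro powr_of_real) auto
  finally have "1 - (norm (\<phi> u))\<^sup>2 = (1 - (norm u)\<^sup>2) powr t" by (simp only: of_real_eq_iff)
  also have "\<dots> > 0" using u2 by simp
  finally show ?thesis by (simp add: power_less_one_iff abs_square_less_1)
qed

lemma hvec_f: "hvec (f x) = (1, \<phi> (bcoord x))"
  unfolding f_def by (intro hvec_point norm_\<phi> norm_bcoord)

lemma B_hvec_f: "B (hvec (f x)) (hvec (f y)) = B (hvec x) (hvec y) powr of_real t"
  using kernel[OF norm_bcoord[of x] norm_bcoord[of y]] by (simp add: hvec_f B_hvec)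

lemma hnorm2_f: "hnorm2 (f x) = hnorm2 x powr t"
proof -
  have "complex_of_real (hnorm2 (f x)) = of_real (hnorm2 x) powr of_real t"
    using B_hvec_f[of x x] by (simp only: B_hvec_self)
  also have "\<dots> = of_real (hnorm2 x powr t)"
    using hnorm2_pos[of x] by (intro powr_of_real) auto
  finally show ?thesis by (simp only: of_real_eq_iff)
qed

lemma cosh_dist_f: "cosh (dist (f x) (f y)) = cosh (dist x y) powr t"
proof -
  have "cmod (B (hvec (f x)) (hvec (f y))) = cmod (B (hvec x) (hvec y)) powr t"
    unfolding B_hvec_f by (simp add: norm_powr_real_powr')
  then show ?thesis
    unfolding cosh_dist_hvec hnorm2_f using hnorm2_pos[of x] hnorm2_pos[of y]
    by (simp add: powr_divide powr_mult real_sqrt_mult powr_half_sqrt[symmetric] powr_powr mult.commute)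
qed

lemma Cart_f: "Cart (f x) (f y) (f z) = t * Cart x y z"
  unfolding Cart_hvec B_hvec_f
  by (intro Arg_prod3_powr Re_B_hvec_pos Re_triple_pos B_positive_hvec t)

lemma dist_f_eq: "dist x y = dist u v \<Longrightarrow> dist (f x) (f y) = dist (f u) (f v)"
  using arcosh_cosh_real[OF zero_le_dist, of "f x" "f y"]
    arcosh_cosh_real[OF zero_le_dist, of "f u" "f v"] by (simp add: cosh_dist_f)

lemma inj_f: "inj f"
proof (rule injI)
  fix x y assume "f x = f y"
  then have "cosh (dist x y) powr t = 1" using cosh_dist_f[of x y] by simp
  then have "cosh (dist x y) = 1"
    using t(1) powr_eq_one_iff_gen[OF cosh_real_pos[of "dist x y"], of t] by blast
  then show "x = y" by simp
qed

lemma f_origin: "f origin = origin"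
proof -
  have 0: "bcoord origin = 0" using hvec_origin unfolding hvec_def by simp
  have "hnorm2 (f origin) = 1" unfolding hnorm2_f by simp
  then have "\<phi> 0 = 0"
    unfolding hnorm2_alt using hvec_f[of origin] by (simp add: 0 hvec_def)
  then have "f origin = point (1, 0)" unfolding f_def 0 by simp
  then show ?thesis by (simp add: origin_def)
qed

lemma tendsto_f: assumes "(X \<longlongrightarrow> x) F" shows "((\<lambda>i. f (X i)) \<longlongrightarrow> f x) F"
proof -
  have "((\<lambda>i. cosh (dist (X i) x) powr t) \<longlongrightarrow> 1 powr t) F"
    by (intro tendsto_powr tendsto_const assms[unfolded tendsto_chyp_iff]) simp
  then show ?thesis unfolding tendsto_chyp_iff cosh_dist_f by simp
qed

lemma spanning_f: "spanning (range f)"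
  unfolding spanning_def
proof (intro allI impI)
  fix Y assume Y: "\<forall>x\<in>range f. B (hvec x) Y = 0"
  show "Y = 0"
  proof (rule total)
    fix u :: ell2 assume "norm u < 1"
    then show "B (1, \<phi> u) Y = 0"
      using bspec[OF Y rangeI, of "point (1, u)"] by (simp add: hvec_f bcoord_point del: B.simps)
  qed
qed

text \<open>On the image of \<open>f\<close> the map \<open>h\<close> preserves distances, and
  preserves or negates Cartan arguments as \<open>g\<close> does. In the second case complex
  conjugation \<open>j\<close> is composed on the left to reach the unitary case, and undone at the
  end.\<close>

lemma exists_extension:
  assumes g: "g \<in> carrier Is" shows "\<exists>T r. lifts T r \<and> (\<forall>x. r (f x) = f (g x))"
proof -
  define h where "h p = f (g (inv_into UNIV f p))" for p
  have hf: "h (f x) = f (g x)" for x unfolding h_def by (simp add: inj_f)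
  have "h ` range f = f ` range g" unfolding image_image hf ..
  then have hA: "h ` range f = range f" using bij_is_surj[OF IsD(1)[OF g]] by simp
  have hd: "dist (h p) (h q) = dist p q" if "p \<in> range f" "q \<in> range f" for p q
    using that dist_f_eq[OF IsD(2)[OF g]] by (auto simp: hf)
  have o: "origin \<in> range f" using f_origin by (metis rangeI)
  from Is_Cart[OF g] show ?thesis
  proof
    assume C: "\<forall>x y z. Cart (g x) (g y) (g z) = Cart x y z"
    have "\<exists>T. B_unitary T \<and> (\<forall>p\<in>range f. pmap T p = h p)"
      using o hd by (intro exists_unitary_extending) (auto simp: spanning_f hA hf Cart_f C)
    then show ?thesis using lifts_pmap hf by (metis rangeI)
  next
    assume C: "\<forall>x y z. Cart (g x) (g y) (g z) = - Cart x y z"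
    define j where "j = pmap conj_cvec"
    have j: "lifts conj_cvec j" unfolding j_def by (intro lifts_pmap disjI2 B_antiunitary_conj)
    have "conj_ell2 0 = 0" by (rule ell2_eqI) (simp add: conj_ell2.rep_eq)
    then have jo: "j origin = origin"
      using lifts_point[OF j, of "(1, 0)"] by (simp add: origin_def B_positive_Pair conj_cvec_def)
    have jh: "(j \<circ> h) ` range f = j ` range f" unfolding image_comp[symmetric] hA ..
    have "\<exists>T. B_unitary T \<and> (\<forall>p\<in>range f. pmap T p = (j \<circ> h) p)"
    proof (rule exists_unitary_extending)
      show "spanning ((j \<circ> h) ` range f)" unfolding jh by (rule spanning_image[OF j spanning_f])
      show "origin \<in> (j \<circ> h) ` range f" unfolding jh using o jo by (metis imageI)
      show "dist ((j \<circ> h) p) ((j \<circ> h) q) = dist p q" if "p \<in> range f" "q \<in> range f" for p q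
        using hd[OF that] by (simp add: lifts_dist[OF j])
      show "Cart ((j \<circ> h) p) ((j \<circ> h) q) ((j \<circ> h) s) = Cart p q s"
        if "p \<in> range f" "q \<in> range f" "s \<in> range f" for p q s
        using that by (auto simp: Cart_antiunitary[OF j B_antiunitary_conj] hf Cart_f C)
    qed (use o spanning_f in auto)
    then obtain T where T: "B_unitary T" "\<And>x. pmap T (f x) = j (f (g x))"
      using hf by auto
    have "lifts (inv_into UNIV conj_cvec \<circ> T) (inv_into UNIV j \<circ> pmap T)"
      using T(1) by (intro lifts_comp lifts_inv(1)[OF j] lifts_pmap) simp
    moreover have "(inv_into UNIV j \<circ> pmap T) (f x) = f (g x)" for x
      using T(2) lifts_inv(2)[OF j] by (simp add: bij_is_inj)
    ultimately show ?thesis by blast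
  qed
qed

text \<open>The choice is determined uniquely, by \<open>\<rho>_eqI\<close>.\<close>

definition \<rho> :: "(chyp \<Rightarrow> chyp) \<Rightarrow> chyp \<Rightarrow> chyp" where
  "\<rho> g = (SOME r. \<exists>T. lifts T r \<and> (\<forall>x. r (f x) = f (g x)))"

lemma \<rho>:
  assumes "g \<in> carrier Is" shows "\<exists>T. lifts T (\<rho> g)" "\<rho> g (f x) = f (g x)"
proof -
  have "\<exists>r T. lifts T r \<and> (\<forall>x. r (f x) = f (g x))" using exists_extension[OF assms] by blast
  from someI_ex[OF this] have "\<exists>T. lifts T (\<rho> g) \<and> (\<forall>x. \<rho> g (f x) = f (g x))"
    unfolding \<rho>_def .
  then show "\<exists>T. lifts T (\<rho> g)" "\<rho> g (f x) = f (g x)" by auto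
qed

section \<open>Uniqueness, homomorphism property and continuity of the representation\<close>

lemma eq_on_range_f:
  assumes "lifts T r" "lifts S s" "\<And>x. r (f x) = s (f x)" shows "r = s"
proof -
  obtain x y z where "Cart x y z \<noteq> 0" using exists_Cart_nonzero by blast
  then have "Cart (f x) (f y) (f z) \<noteq> 0" using t(1) by (simp add: Cart_f)
  moreover have "origin \<in> range f" using f_origin by (metis rangeI)
  ultimately show ?thesis
    using lifts_eq_on_spanning[OF assms(1,2) spanning_f _ rangeI rangeI rangeI] assms(3) by blast
qed

lemma \<rho>_eqI:
  assumes "g \<in> carrier Is" "lifts T r" "\<And>x. r (f x) = f (g x)" shows "\<rho> g = r"
proof -
  obtain S where "lifts S (\<rho> g)" using \<rho>(1)[OF assms(1)] by blast
  from eq_on_range_f[OF this assms(2)] show ?thesis using \<rho>(2)[OF assms(1)] assms(3) by simp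
qed

lemma \<rho>_hom: "\<rho> \<in> hom Is Is"
proof (rule homI)
  fix g h assume g: "g \<in> carrier Is" and h: "h \<in> carrier Is"
  show "\<rho> g \<in> carrier Is" using \<rho>(1)[OF g] lifts_in_Is by blast
  obtain T S where TS: "lifts T (\<rho> g)" "lifts S (\<rho> h)" using \<rho>(1) g h by blast
  have "\<rho> (g \<circ> h) = \<rho> g \<circ> \<rho> h"
    by (rule \<rho>_eqI[OF Is_comp[OF g h] lifts_comp[OF TS]]) (simp add: \<rho>(2) g h)
  then show "\<rho> (g \<otimes>\<^bsub>Is\<^esub> h) = \<rho> g \<otimes>\<^bsub>Is\<^esub> \<rho> h" by (simp add: Is_def)
qed

lemma continuous_\<rho>: "continuous_on (carrier Is) \<rho>"
proof (rule continuous_on_coordinatewise_then_product)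
  fix p
  show "continuous_on (carrier Is) (\<lambda>g. \<rho> g p)"
    unfolding continuous_on_def
  proof
    fix g0 assume g0: "g0 \<in> carrier Is"
    define F where "F = at g0 within carrier Is"
    obtain S where S: "lifts S (\<rho> g0)" using \<rho>(1)[OF g0] by blast
    note b = lifts_inv(2)[OF S]
    \<comment> \<open>Translates convergence to \<open>\<rho> g0\<close> into convergence to the
      identity, the form that \<open>tendsto_on_spanning\<close> handles.\<close>
    define R where "R g = inv_into UNIV (\<rho> g0) \<circ> \<rho> g" for g
    have dR: "dist (R g q) p = dist (\<rho> g q) (\<rho> g0 p)" for g p q
      unfolding R_def comp_apply
      using lifts_dist[OF S, of "inv_into UNIV (\<rho> g0) (\<rho> g q)" p] b
      by (simp add: bij_is_surj surj_f_inv_f)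
    have ev: "\<forall>\<^sub>F g in F. g \<in> carrier Is" unfolding F_def by (simp add: eventually_at_filter)
    obtain x y z where xyz: "Cart x y z \<noteq> 0" using exists_Cart_nonzero by blast
    have "((\<lambda>g. R g p) \<longlongrightarrow> p) F"
    proof (rule tendsto_on_spanning[where A = "range f"])
      show "\<forall>\<^sub>F g in F. \<exists>T. lifts T (R g)"
        using ev
      proof eventually_elim
        case (elim g)
        then show ?case unfolding R_def using \<rho>(1) lifts_comp[OF lifts_inv(1)[OF S]] by blast
      qed
      show "origin \<in> range f" using f_origin by (metis rangeI)
      show "Cart (f x) (f y) (f z) \<noteq> 0" using xyz t(1) by (simp add: Cart_f)
      fix q assume "q \<in> range f"
      then obtain w where w: "q = f w" by blast
      have "((\<lambda>g. g w) \<longlongrightarrow> g0 w) F"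
        using g0 continuous_on_subset[OF continuous_on_product_coordinates, of "carrier Is" w]
        unfolding F_def continuous_on_def by blast
      then have "((\<lambda>g. dist (f (g w)) (f (g0 w))) \<longlongrightarrow> 0) F"
        by (rule tendsto_f[THEN tendsto_dist_iff[THEN iffD1]])
      then have "((\<lambda>g. dist (R g q) q) \<longlongrightarrow> 0) F"
      proof (rule Lim_transform_eventually)
        show "\<forall>\<^sub>F g in F. dist (f (g w)) (f (g0 w)) = dist (R g q) q"
          using ev by eventually_elim (simp add: dR w \<rho>(2) g0)
      qed
      then show "((\<lambda>g. R g q) \<longlongrightarrow> q) F" by (subst tendsto_dist_iff)
    qed (auto simp: spanning_f)
    then have "((\<lambda>g. dist (R g p) p) \<longlongrightarrow> 0) F" by (rule tendsto_dist_iff[THEN iffD1])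
    then show "((\<lambda>g. \<rho> g p) \<longlongrightarrow> \<rho> g0 p) (at g0 within carrier Is)"
      unfolding dR F_def by (subst tendsto_dist_iff)
  qed
qed

lemma exists_lift_to_f: "\<exists>g\<in>carrier Is. \<exists>T. lifts T (\<rho> g) \<and> point (T (1, 0)) = f x"
proof -
  obtain U where U: "B_unitary U" "pmap U origin = x" using exists_unitary_origin by blast
  then have g: "pmap U \<in> carrier Is" using lifts_in_Is[OF lifts_pmap] by blast
  then obtain T where T: "lifts T (\<rho> (pmap U))" using \<rho>(1) by blast
  have "point (T (1, 0)) = \<rho> (pmap U) origin"
    using lifts_point[OF T, of "(1, 0)"] by (simp add: origin_def B_positive_Pair)
  also have "\<dots> = f x" using \<rho>(2)[OF g, of origin] by (simp add: f_origin U(2))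
  finally show ?thesis using g T by blast
qed

lemma hvec_f_lift:
  assumes "lifts T (\<rho> g)" "point (T (1, 0)) = f x"
  shows "\<exists>c. c \<noteq> 0 \<and> hvec (f x) = cscale c (T (1, 0))"
  using assms point_eq_iff[of "T (1, 0)" "hvec (f x)"] lifts_positive[OF assms(1)]
  by (simp add: B_positive_Pair)

subsection \<open>Irreducibility\<close>

definition rotate :: "complex \<Rightarrow> cvec \<Rightarrow> cvec" where
  "rotate c X = (fst X, Abs_ell2 (\<lambda>k. c ^ deg k * coord (snd X) k))"

lemma coord_rotate: "cmod c = 1 \<Longrightarrow> coord (snd (rotate c X)) k = c ^ deg k * coord (snd X) k"
  unfolding rotate_def using summable_coord[of "snd X"]
  by (simp add: coord_Abs norm_mult norm_power)

lemma fst_rotate [simp]: "fst (rotate c X) = fst X" by (simp add: rotate_def)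

lemma B_unitary_rotate: assumes c: "cmod c = 1" shows "B_unitary (rotate c)"
proof -
  have c1: "cnj c * c = 1" "c * cnj c = 1" "cmod (cnj c) = 1"
    using c complex_norm_square[of c] by (simp_all add: mult.commute)
  have eqI: "X = Y" if "fst X = fst Y" "\<And>k. coord (snd X) k = coord (snd Y) k" for X Y :: cvec
    using that by (auto intro: prod_eqI ell2_eqI)
  have inv: "rotate (cnj c) (rotate c X) = X" "rotate c (rotate (cnj c) X) = X" for X
    by (rule eqI; simp add: coord_rotate c c1 mult.assoc[symmetric] power_mult_distrib[symmetric])+
  show ?thesis
    unfolding B_unitary_def
  proof (intro conjI allI)
    show "bij (rotate c)" using inv by (intro o_bij[of "rotate (cnj c)"]) auto
    show "rotate c (X + Y) = rotate c X + rotate c Y" for X Y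
      by (rule eqI) (simp_all add: coord_rotate c distrib_left)
    show "rotate c (cscale k X) = cscale k (rotate c X)" for k X
      by (rule eqI) (simp_all add: coord_rotate c cscale_alt mult.left_commute)
    show "B (rotate c X) (rotate c Y) = B X Y" for X Y
    proof -
      have 1: "cnj c ^ deg k * c ^ deg k = 1" for k
        by (simp only: power_mult_distrib[symmetric] c1 power_one)
      have "cnj (c ^ deg k * x) * (c ^ deg k * y) = (cnj c ^ deg k * c ^ deg k) * (cnj x * y)" for k x y
        by (simp add: mult_ac)
      then have 2: "cnj (c ^ deg k * x) * (c ^ deg k * y) = cnj x * y" for k x y
        unfolding 1 by simp
      show ?thesis unfolding B_alt cinner_def coord_rotate[OF c] fst_rotate 2 ..
    qed
  qed
qed

lemma rotate_invariant:
  assumes c: "cmod c = 1" and S: "\<And>g. g \<in> carrier Is \<Longrightarrow> proj_invariant (\<rho> g) S"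
  shows "rotate c ` S = S"
proof -
  define D where "D X = (fst X, scaleC c (snd X))" for X :: cvec
  have cc: "cnj c * c = 1" "c * cnj c = 1" using c complex_norm_square[of c] by (simp_all add: mult.commute)
  have s: "scaleC c (u + v) = scaleC c u + scaleC c v" "scaleC a (scaleC b u) = scaleC (a * b) u"
    "scaleC 1 u = u" for u v a b by (rule ell2_eqI; simp add: algebra_simps)+
  have D: "B_unitary D"
    unfolding B_unitary_def
  proof (intro conjI allI)
    show "bij D"
      by (rule o_bij[of "\<lambda>X. (fst X, scaleC (cnj c) (snd X))"]) (auto simp: D_def s cc fun_eq_iff)
    show "D (X + Y) = D X + D Y" for X Y by (simp add: D_def s)
    show "D (cscale k X) = cscale k (D X)" for k X by (simp add: D_def cscale_alt s mult.commute)
    show "B (D X) (D Y) = B X Y" for X Y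
      by (simp add: D_def B_alt cinner_scaleC_left cinner_scaleC_right mult.assoc[symmetric] cc)
  qed
  define g where "g = pmap D"
  have gL: "lifts D g" unfolding g_def using D by (intro lifts_pmap) simp
  have rL: "lifts (rotate c) (pmap (rotate c))" using B_unitary_rotate[OF c] by (intro lifts_pmap) simp
  have "pmap (rotate c) (f x) = f (g x)" for x
  proof -
    have n: "norm (bcoord x) < 1" by (rule norm_bcoord)
    have n': "norm (scaleC c (bcoord x)) < 1" using n c by (simp add: norm_scaleC)
    have "g x = point (D (hvec x))" using lifts_point[OF gL, of "hvec x"] by simp
    also have "D (hvec x) = (1, scaleC c (bcoord x))" by (simp add: D_def hvec_def)
    finally have gx: "g x = point (1, scaleC c (bcoord x))" .
    have "pmap (rotate c) (f x) = point (rotate c (hvec (f x)))"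
      using lifts_point[OF rL, of "hvec (f x)"] by simp
    also have "rotate c (hvec (f x)) = hvec (f (g x))"
      unfolding hvec_f gx bcoord_point[OF n']
      by (rule prod_eqI) (simp_all add: ell2_eqI coord_rotate c homogeneous n)
    finally show ?thesis by simp
  qed
  \<comment> \<open>Homogeneity gave the agreement on the image of \<open>f\<close>; uniqueness of
    the extension identifies the two isometries.\<close>
  then have "\<rho> g = pmap (rotate c)" by (intro \<rho>_eqI[OF lifts_in_Is[OF gL] rL])
  then show ?thesis using S[OF lifts_in_Is[OF gL]] rL unfolding proj_invariant_def by simp
qed

text \<open>The limit as \<open>m\<close> grows of the averages of \<open>Y\<close> over the \<open>2\<^sup>m\<close>-th roots of unity, which
  keep only the coordinates of degree divisible by \<open>2\<^sup>m\<close>.\<close>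
lemma fst_component_mem:
  assumes cl: "closed S" and sub: "cvec.subspace S"
    and S: "\<And>g. g \<in> carrier Is \<Longrightarrow> proj_invariant (\<rho> g) S" and Y: "Y \<in> S"
  shows "(fst Y, 0) \<in> S"
proof -
  define v where "v = snd Y"
  define w where "w m = Abs_ell2 (\<lambda>k. if 2 ^ m dvd deg k then coord v k else 0)" for m :: nat
  have "summable (\<lambda>k. (cmod (if 2 ^ m dvd deg k then coord v k else 0))\<^sup>2)" for m :: nat
    by (rule summable_comparison_test'[OF summable_coord[of v]]) auto
  then have w: "coord (w m) k = (if 2 ^ m dvd deg k then coord v k else 0)" for m k
    unfolding w_def by (simp add: coord_Abs)
  have mem: "(fst Y, w m) \<in> S" for m
  proof (induction m)
    case 0
    have "w 0 = v" by (rule ell2_eqI) (simp add: w)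
    then show ?case using Y unfolding v_def by simp
  next
    case (Suc m)
    \<comment> \<open>A primitive root of unity of order \<open>2^(m+1)\<close>: it acts by
      \<open>(-1)^j\<close> on degree \<open>2^m j\<close>, so the mean with the identity removes
      exactly the odd \<open>j\<close>.\<close>
    define c where "c = cis (pi / 2 ^ m)"
    have c: "cmod c = 1" by (simp add: c_def)
    have c2: "c ^ (2 ^ m) = - 1" unfolding c_def Complex.DeMoivre by simp
    have "rotate c (fst Y, w m) \<in> S" using rotate_invariant[OF c S] Suc by blast
    then have "cscale (1 / 2) ((fst Y, w m) + rotate c (fst Y, w m)) \<in> S"
      by (intro cvec.subspace_scale[OF sub] cvec.subspace_add[OF sub] Suc)
    also have "cscale (1 / 2) ((fst Y, w m) + rotate c (fst Y, w m)) = (fst Y, w (Suc m))"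
    proof (rule prod_eqI)
      show "snd (cscale (1 / 2) ((fst Y, w m) + rotate c (fst Y, w m))) = snd (fst Y, w (Suc m))"
      proof (rule ell2_eqI)
        fix k
        show "coord (snd (cscale (1 / 2) ((fst Y, w m) + rotate c (fst Y, w m)))) k
            = coord (snd (fst Y, w (Suc m))) k"
        proof (cases "2 ^ m dvd deg k")
          case True
          then obtain j where j: "deg k = 2 ^ m * j" by blast
          have "c ^ deg k = (- 1) ^ j" unfolding j power_mult c2 ..
          moreover have "2 ^ Suc m dvd deg k \<longleftrightarrow> even j" unfolding j by (simp add: mult.commute)
          ultimately show ?thesis using True by (cases "even j") (simp_all add: cscale_alt coord_rotate c w)
        next
          case False
          then have "\<not> 2 ^ Suc m dvd deg k" by (metis dvd_mult_right power_Suc)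
          then show ?thesis using False by (simp add: cscale_alt coord_rotate c w)
        qed
      qed
    qed (simp add: cscale_alt)
    finally show ?case .
  qed
  have "w \<longlonglongrightarrow> 0"
  proof (rule LIMSEQ_I)
    fix e :: real assume e: "e > 0"
    obtain K where K: "norm (\<Sum>k. (cmod (coord v (k + K)))\<^sup>2) < e\<^sup>2"
      using suminf_exist_split[OF _ summable_coord[of v], of "e\<^sup>2"] e by auto
    \<comment> \<open>For \<open>m >= M\<close> each of the first \<open>K\<close> degrees is
      positive and below \<open>2^m\<close>, hence not divisible by it; only a tail of
      \<open>v\<close> survives.\<close>
    define M where "M = Suc (\<Sum>k<K. deg k)"
    have "norm (w m - 0) < e" if "m \<ge> M" for m
    proof -
      have "coord (w m) k = 0" if "k < K" for k
      proof -
        have "deg k \<le> (\<Sum>k<K. deg k)" using that by (intro member_le_sum) auto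
        also have "\<dots> < m" using \<open>m \<ge> M\<close> unfolding M_def by simp
        also have "m < 2 ^ m" by (rule less_exp)
        finally have "\<not> 2 ^ m dvd deg k" using deg_pos[of k] by (auto dest: dvd_imp_le)
        then show ?thesis by (simp add: w)
      qed
      then have "(norm (w m))\<^sup>2 = (\<Sum>k. (cmod (coord (w m) (k + K)))\<^sup>2)"
        unfolding power2_norm_ell2
        by (subst suminf_split_initial_segment[OF summable_coord, of _ K]) simp
      also have "\<dots> \<le> (\<Sum>k. (cmod (coord v (k + K)))\<^sup>2)"
        by (intro suminf_le summable_ignore_initial_segment[OF summable_coord[of v]]
            summable_ignore_initial_segment[OF summable_coord[of "w m"]]) (simp add: w)
      also have "\<dots> < e\<^sup>2" using K by simp
      finally show ?thesis using e by (simp add: power_less_imp_less_base)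
    qed
    then show "\<exists>M. \<forall>m\<ge>M. norm (w m - 0) < e" by blast
  qed
  then have "(\<lambda>m. (fst Y, w m)) \<longlonglongrightarrow> (fst Y, 0)" by (intro tendsto_Pair tendsto_const)
  then show ?thesis by (rule closed_sequentially[OF cl, of "\<lambda>m. (fst Y, w m)", OF mem])
qed

lemma irreducible_\<rho>: "irreducible_action (carrier Is) \<rho>"
  unfolding irreducible_action_def
proof (intro allI impI, elim conjE)
  fix S assume cl: "closed S" and sub: "cvec.subspace S"
    and "\<forall>g\<in>carrier Is. proj_invariant (\<rho> g) S"
  then have inv: "\<And>g. g \<in> carrier Is \<Longrightarrow> proj_invariant (\<rho> g) S" by blast
  show "S = {0} \<or> S = UNIV"
  proof (cases "\<exists>Y\<in>S. fst Y \<noteq> 0")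
    case True
    then obtain Y where Y: "Y \<in> S" "fst Y \<noteq> 0" by blast
    have "cscale (1 / fst Y) (fst Y, 0) \<in> S"
      by (intro cvec.subspace_scale[OF sub] fst_component_mem[OF cl sub inv Y(1)])
    also have "cscale (1 / fst Y) (fst Y, 0) = (1, 0)"
      using Y(2) by (simp add: cscale.simps) (rule ell2_eqI, simp)
    finally have 1: "(1, 0) \<in> S" .
    have "hvec ` range f \<subseteq> S"
    proof (rule image_subsetI)
      fix p assume "p \<in> range f"
      then obtain x where p: "p = f x" by blast
      obtain g T where g: "g \<in> carrier Is" and T: "lifts T (\<rho> g)" "point (T (1, 0)) = f x"
        using exists_lift_to_f by blast
      have "T (1, 0) \<in> S" using inv[OF g] T(1) 1 unfolding proj_invariant_def by blast
      then show "hvec p \<in> S"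
        unfolding p using hvec_f_lift[OF T] cvec.subspace_scale[OF sub] by metis
    qed
    then have "closure (cvec.span (hvec ` range f)) \<subseteq> S"
      by (intro closure_minimal cl cvec.span_minimal sub)
    then show ?thesis unfolding spanning_closure[OF spanning_f] by blast
  next
    case False
    have "Y = 0" if Y: "Y \<in> S" for Y
    proof (rule spanningD[OF spanning_f])
      fix p assume "p \<in> range f"
      then obtain x where p: "p = f x" by blast
      obtain g T where g: "g \<in> carrier Is" and T: "lifts T (\<rho> g)" "point (T (1, 0)) = f x"
        using exists_lift_to_f by blast
      obtain Z where Z: "Z \<in> S" "Y = T Z" using inv[OF g] T(1) Y unfolding proj_invariant_def by blast
      have "B (1, 0) Z = 0" using False Z(1) by (cases Z) (auto simp: cinner_simps)
      then have "cmod (B (T (1, 0)) Y) = 0" unfolding Z(2) lifts_B(1)[OF T(1)] by simp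
      then show "B (hvec p) Y = 0" using hvec_f_lift[OF T] unfolding p by (auto simp: B_scale_left)
    qed
    then show ?thesis using cvec.subspace_0[OF sub] by blast
  qed
qed

theorem exists_representation:
  "\<exists>\<rho> f. \<rho> \<in> hom Is Is \<and> continuous_on (carrier Is) \<rho> \<and> irreducible_action (carrier Is) \<rho> \<and>
    (\<forall>g\<in>carrier Is. \<forall>x. f (g x) = \<rho> g (f x)) \<and>
    (\<forall>x y. cosh (dist (f x) (f y)) = (cosh (dist x y)) powr t) \<and>
    (\<forall>x y z. Cart (f x) (f y) (f z) = t * Cart x y z)"
  by (rule exI[of _ \<rho>], rule exI[of _ f])
    (simp add: \<rho>_hom continuous_\<rho> irreducible_\<rho> \<rho>(2) cosh_dist_f Cart_f)

end

text \<open>The monomial construction would fail to be total here, all weights beyond degree one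
  being zero.\<close>

lemma kernel_power_id: "kernel_power 1 (\<lambda>u. u) (\<lambda>_. 1)"
proof
  fix Y assume Y: "\<And>u. norm u < 1 \<Longrightarrow> B (1, u) Y = 0"
  obtain w v where wv: "Y = (w, v)" by (cases Y)
  have w: "w = 0" using Y[of 0] unfolding wv by (simp add: cinner_simps)
  \<comment> \<open>Scales \<open>v\<close> into the open ball, so that \<open>v\<close> can be
    tested against itself.\<close>
  define r where "r = 1 / (1 + norm v)"
  have r: "r > 0" "r * norm v < 1" unfolding r_def using norm_ge_zero[of v] by (auto simp: field_simps add_pos_nonneg)
  have "cinner (r *\<^sub>R v) v = 0" using Y[of "r *\<^sub>R v"] r unfolding wv w by simp
  then have "v = 0"
    using r(1) by (simp add: scaleC_of_real[symmetric] cinner_scaleC_left cinner_self)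
  then show "Y = 0" unfolding wv w by (simp add: zero_prod_def)
next
  fix u v :: ell2 assume "norm u < 1" "norm v < 1"
  then have "1 - cinner u v \<noteq> 0"
    using B_hvec_nonzero[of "point (1, u)" "point (1, v)"] by (simp add: hvec_point)
  then show "1 - cinner u v = (1 - cinner u v) powr of_real 1" by simp
qed auto

section \<open>Sums over words and multisets\<close>

text \<open>The distributive law for \<open>s ^ n\<close>. The nonnegative case comes first because
  it yields the absolute summability that the complex case relies on.\<close>

lemma has_sum_words:
  fixes x :: "nat \<Rightarrow> real"
  assumes x: "(x has_sum s) UNIV" and nn: "\<And>i. 0 \<le> x i"
  shows "((\<lambda>w. prod_list (map x w)) has_sum s ^ n) {w. length w = n}"
proof (induction n)
  case 0
  show ?case by (simp add: has_sum_finite_iff)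
next
  case (Suc n)
  let ?P = "\<lambda>w. prod_list (map x w)" and ?L = "{w :: nat list. length w = n}"
  have pnn: "0 \<le> ?P w" for w using nn by (induction w) auto
  have 1: "((\<lambda>w. x i * ?P w) has_sum x i * s ^ n) ?L" for i
    by (rule has_sum_cmult_right[OF Suc])
  have 2: "((\<lambda>i. x i * s ^ n) has_sum s * s ^ n) UNIV" by (rule has_sum_cmult_left[OF x])
  have "((\<lambda>(i, w). x i * ?P w) has_sum s * s ^ n) (UNIV \<times> ?L)"
  proof (rule has_sum_SigmaI)
    show "(\<lambda>(i, w). x i * ?P w) summable_on (UNIV \<times> ?L)"
      by (rule summable_on_SigmaI[where g = "\<lambda>i. x i * s ^ n"])
        (use 1 2 nn pnn in \<open>auto intro: has_sum_imp_summable mult_nonneg_nonneg\<close>)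
  qed (use 1 2 in auto)
  also have "((\<lambda>(i, w). x i * ?P w) has_sum s * s ^ n) (UNIV \<times> ?L)
      \<longleftrightarrow> (?P has_sum s * s ^ n) ((\<lambda>(i, w). i # w) ` (UNIV \<times> ?L))"
    by (subst has_sum_reindex) (auto simp: inj_on_def o_def case_prod_unfold)
  also have "(\<lambda>(i, w). i # w) ` (UNIV \<times> ?L) = {w. length w = Suc n}"
    by (auto simp: length_Suc_conv image_iff)
  finally show ?case by simp
qed

text \<open>Absolute convergence justifies every rearrangement of the sum over all words.\<close>
lemma has_sum_words_complex:
  fixes x :: "nat \<Rightarrow> complex"
  assumes x: "(x has_sum s) UNIV" and ax: "((\<lambda>i. cmod (x i)) has_sum r) UNIV"
  shows "((\<lambda>w. prod_list (map x w)) has_sum s ^ n) {w. length w = n}"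
proof (induction n)
  case 0
  show ?case by (simp add: has_sum_finite_iff)
next
  case (Suc n)
  let ?P = "\<lambda>w. prod_list (map x w)" and ?L = "{w :: nat list. length w = n}"
  have norm: "norm (?P w) = prod_list (map (\<lambda>i. cmod (x i)) w)" for w
    by (induction w) (auto simp: norm_mult)
  have inj: "inj_on (\<lambda>(i, w). i # w) (UNIV \<times> ?L)" by (auto simp: inj_on_def)
  have im: "(\<lambda>(i, w). i # w) ` (UNIV \<times> ?L) = {w. length w = Suc n}"
    by (auto simp: length_Suc_conv image_iff)
  have "(\<lambda>w. norm (?P w)) summable_on {w. length w = Suc n}"
    unfolding norm using has_sum_words[OF ax, of "Suc n"] by (auto intro: has_sum_imp_summable)
  then have "?P summable_on {w. length w = Suc n}" by (rule abs_summable_summable)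
  then have sm: "(\<lambda>(i, w). x i * ?P w) summable_on (UNIV \<times> ?L)"
    unfolding im[symmetric] summable_on_reindex[OF inj] by (simp add: o_def case_prod_unfold)
  have "((\<lambda>(i, w). x i * ?P w) has_sum s * s ^ n) (UNIV \<times> ?L)"
    by (rule has_sum_SigmaI[OF _ has_sum_cmult_left[OF x] sm]) (simp add: has_sum_cmult_right[OF Suc])
  also have "((\<lambda>(i, w). x i * ?P w) has_sum s * s ^ n) (UNIV \<times> ?L)
      \<longleftrightarrow> (?P has_sum s * s ^ n) ((\<lambda>(i, w). i # w) ` (UNIV \<times> ?L))"
    by (subst has_sum_reindex[OF inj]) (simp add: o_def case_prod_unfold)
  finally show ?case unfolding im by simp
qed

text \<open>Expands each power into words and sums over all lengths at once; the majorant is the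
  same series at \<open>r\<close>, the sum of the moduli.\<close>

lemma has_sum_power_series_words:
  fixes x :: "nat \<Rightarrow> complex" and c :: "nat \<Rightarrow> real"
  assumes x: "(x has_sum s) UNIV" and ax: "((\<lambda>i. cmod (x i)) has_sum r) UNIV"
    and c: "\<And>n. 0 \<le> c n" and cr: "(\<lambda>n. c n * r ^ n) summable_on UNIV"
    and cs: "((\<lambda>n. of_real (c n) * s ^ n) has_sum S) UNIV"
  shows "((\<lambda>w. of_real (c (length w)) * prod_list (map x w)) has_sum S) UNIV"
proof -
  let ?P = "\<lambda>w. prod_list (map x w)" and ?L = "\<lambda>n. {w :: nat list. length w = n}"
  let ?\<Sigma> = "Sigma UNIV ?L"
  have norm: "norm (?P w) = prod_list (map (\<lambda>i. cmod (x i)) w)" for w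
    by (induction w) (auto simp: norm_mult)
  have "(\<lambda>(n, w). c n * prod_list (map (\<lambda>i. cmod (x i)) w)) summable_on ?\<Sigma>"
  proof (rule summable_on_SigmaI)
    fix n
    show "((\<lambda>w. case (n, w) of (n, w) \<Rightarrow> c n * prod_list (map (\<lambda>i. cmod (x i)) w))
        has_sum c n * r ^ n) (?L n)"
      using has_sum_cmult_right[OF has_sum_words[OF ax], of "c n" n] by simp
  qed (use cr c in \<open>auto intro!: mult_nonneg_nonneg simp flip: norm\<close>)
  then have "(\<lambda>p. norm (case p of (n, w) \<Rightarrow> of_real (c n) * ?P w)) summable_on ?\<Sigma>"
    by (rule summable_on_cong[THEN iffD1, rotated]) (auto simp: norm norm_mult c)
  then have "(\<lambda>(n, w). of_real (c n) * ?P w) summable_on ?\<Sigma>" by (rule abs_summable_summable)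
  then have "((\<lambda>(n, w). of_real (c n) * ?P w) has_sum S) ?\<Sigma>"
    by (intro has_sum_SigmaI[OF _ cs])
      (simp_all add: has_sum_cmult_right[OF has_sum_words_complex[OF x ax]])
  also have "?this \<longleftrightarrow> ((\<lambda>(n, w). of_real (c (length w)) * ?P w) has_sum S) ?\<Sigma>"
    by (intro has_sum_cong) auto
  also have "\<dots> \<longleftrightarrow> (((\<lambda>w. of_real (c (length w)) * ?P w) \<circ> snd) has_sum S) ?\<Sigma>"
    by (simp add: o_def case_prod_unfold)
  also have "\<dots> \<longleftrightarrow> ((\<lambda>w. of_real (c (length w)) * ?P w) has_sum S) (snd ` ?\<Sigma>)"
    by (subst has_sum_reindex) (auto simp: inj_on_def)
  also have "snd ` ?\<Sigma> = UNIV" by (force simp: image_iff)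
  finally show ?thesis .
qed

text \<open>The multinomial coefficient of \<open>M\<close>.\<close>

definition orderings :: "nat multiset \<Rightarrow> nat" where
  "orderings M = card {w. mset w = M}"

lemma finite_orderings: "finite {w :: nat list. mset w = M}"
  by (metis ex_mset mset_eq_finite)

lemma orderings_pos: "0 < orderings M"
  unfolding orderings_def using finite_orderings[of M] ex_mset[of M] by (auto simp: card_gt_0_iff)

text \<open>The term of a word depends only on its underlying multiset, so the sum over words is
  regrouped along the finite fibres of \<open>mset\<close>.\<close>

lemma has_sum_power_series_multisets:
  fixes x :: "nat \<Rightarrow> complex" and c :: "nat \<Rightarrow> real"
  assumes "(x has_sum s) UNIV" and "((\<lambda>i. cmod (x i)) has_sum r) UNIV"
    and "\<And>n. 0 \<le> c n" and "(\<lambda>n. c n * r ^ n) summable_on UNIV"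
    and "((\<lambda>n. of_real (c n) * s ^ n) has_sum S) UNIV"
  shows "((\<lambda>M. of_real (c (size M) * orderings M) * (\<Prod>i\<in>#M. x i)) has_sum S) UNIV"
proof -
  let ?f = "\<lambda>w. of_real (c (length w)) * prod_list (map x w)"
  let ?\<Sigma> = "Sigma UNIV (\<lambda>M. {w. mset w = M})"
  have P: "?f w = of_real (c (size (mset w))) * (\<Prod>i\<in>#mset w. x i)" for w
    by (simp add: prod_mset_prod_list flip: mset_map)
  have "(?f has_sum S) UNIV" by (rule has_sum_power_series_words) (use assms in auto)
  also have "UNIV = snd ` ?\<Sigma>" by (force simp: image_iff)
  also have "(?f has_sum S) (snd ` ?\<Sigma>) \<longleftrightarrow> ((\<lambda>p. ?f (snd p)) has_sum S) ?\<Sigma>"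
    by (subst has_sum_reindex) (auto simp: inj_on_def o_def)
  finally have "((\<lambda>p. ?f (snd p)) has_sum S) ?\<Sigma>" .
  then show ?thesis
  proof (rule has_sum_SigmaD)
    fix M :: "nat multiset"
    have "(\<Sum>w | mset w = M. ?f w) = (\<Sum>w | mset w = M. of_real (c (size M)) * (\<Prod>i\<in>#M. x i))"
      by (rule sum.cong) (auto simp only: P mem_Collect_eq)
    then show "((\<lambda>w. ?f (snd (M, w))) has_sum of_real (c (size M) * orderings M) * (\<Prod>i\<in>#M. x i))
        {w. mset w = M}"
      by (intro has_sum_finiteI finite_orderings) (simp add: orderings_def mult_ac)
  qed
qed


section \<open>The binomial series\<close>

definition binom_coeff :: "real \<Rightarrow> nat \<Rightarrow> real" where
  "binom_coeff t n = (if n = 0 then 0 else - ((- 1) ^ n * (t gchoose n)))"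

text \<open>With \<open>c_n\<close> the coefficients, \<open>c_1 = t\<close> and
  \<open>(n + 1) c_{n+1} = (n - t) c_n\<close>; the factor \<open>n - t\<close> is positive for
  \<open>n >= 1\<close> because \<open>t < 1\<close>.\<close>

lemma binom_coeff_pos:
  assumes t: "0 < t" "t < 1" and "0 < n" shows "0 < binom_coeff t n"
  using \<open>0 < n\<close>
proof (induction n rule: nat_induct_non_zero)
  case 1
  then show ?case using t by (simp add: binom_coeff_def)
next
  case (Suc n)
  have *: "real (Suc n) * (t gchoose Suc n) = (t - real n) * (t gchoose n)"
    using gbinomial_mult_1[of t n] by (simp add: algebra_simps)
  have "real (Suc n) * binom_coeff t (Suc n) = (- 1) ^ n * (real (Suc n) * (t gchoose Suc n))"
    by (simp add: binom_coeff_def)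
  also have "\<dots> = (real n - t) * binom_coeff t n"
    unfolding * using Suc(1) by (simp add: binom_coeff_def algebra_simps)
  also have "\<dots> > 0" using Suc t by (intro mult_pos_pos) auto
  finally show ?case by (simp add: zero_less_mult_iff)
qed

lemma binom_coeff_nonneg: "0 < t \<Longrightarrow> t < 1 \<Longrightarrow> 0 \<le> binom_coeff t n"
  using binom_coeff_pos[of t n] by (cases "n = 0") (auto simp: binom_coeff_def)

lemma binom_coeff_sums:
  fixes z :: complex
  assumes "cmod z < 1"
  shows "(\<lambda>n. of_real (binom_coeff t n) * z ^ n) sums (1 - (1 - z) powr of_real t)"
proof -
  have "complex_of_real (t gchoose n) = (of_real t gchoose n)" for n
    by (simp add: gbinomial_prod_rev)
  then have "(\<lambda>n. (if n = 0 then 1 else 0) - of_real (t gchoose n) * (- z) ^ n) sums (1 - (1 + - z) powr of_real t)"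
    using gen_binomial_complex[of "- z" "of_real t"] assms sums_single[of 0 "\<lambda>_. 1 :: complex"]
    by (intro sums_diff) auto
  also have "(\<lambda>n. (if n = 0 then 1 else 0) - of_real (t gchoose n) * (- z) ^ n)
      = (\<lambda>n. of_real (binom_coeff t n) * z ^ n)"
    by (auto simp: binom_coeff_def fun_eq_iff power_minus[of z])
  finally show ?thesis by simp
qed

lemma binom_coeff_summable:
  assumes t: "0 < t" "t < 1" and r: "0 \<le> r" "r < 1"
  shows "(\<lambda>n. binom_coeff t n * r ^ n) summable_on UNIV"
proof -
  have "(\<lambda>n. complex_of_real (binom_coeff t n * r ^ n)) sums (1 - (1 - of_real r) powr of_real t)"
    using binom_coeff_sums[of "of_real r" t] r by simp
  then have "summable (\<lambda>n. binom_coeff t n * r ^ n)"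
    by (metis (no_types) summable_of_real_iff sums_summable)
  then show ?thesis
    by (intro norm_summable_imp_summable_on) (use binom_coeff_nonneg[OF t] r in \<open>simp add: abs_mult\<close>)
qed


section \<open>Uniqueness for Dirichlet series\<close>

text \<open>Isolate the nonzero coefficient with the smallest \<open>N k\<close>, multiply by
  \<open>(N k)^s\<close> and let \<open>s\<close> grow: the other terms decay geometrically, since
  distinct integers differ by at least 1.\<close>

lemma Dirichlet_unique:
  fixes b :: "nat \<Rightarrow> complex" and N :: "nat \<Rightarrow> nat"
  assumes inj: "inj N" and N: "\<And>k. 0 < N k"
    and sm: "summable (\<lambda>k. cmod (b k) / real (N k) ^ 2)"
    and zero: "\<And>s. 2 \<le> s \<Longrightarrow> (\<lambda>k. b k * (1 / of_nat (N k)) ^ s) sums 0"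
  shows "b k = 0"
proof (rule ccontr)
  assume "b k \<noteq> 0"
  then obtain k0 where k0: "b k0 \<noteq> 0" "\<And>k. b k \<noteq> 0 \<Longrightarrow> N k0 \<le> N k"
    using ex_has_least_nat[of "\<lambda>k. b k \<noteq> 0" k N] by blast
  define q where "q = real (N k0)"
  have q: "q > 0" unfolding q_def using N by simp
  define a where "a k = cmod (b k) / real (N k) ^ 2" for k
  \<comment> \<open>Bounds the ratio of \<open>q\<close> to every larger value of \<open>N\<close>,
    which is at least \<open>q + 1\<close>.\<close>
  define \<theta> where "\<theta> = q / (q + 1)"
  have \<theta>: "0 \<le> \<theta>" "\<theta> < 1" unfolding \<theta>_def using q by auto
  have le: "cmod (b k0) \<le> \<theta> ^ s * (q ^ 2 * suminf a)" for s
  proof -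
    \<comment> \<open>Two of the \<open>s + 2\<close> powers are reserved for the summable majorant
      \<open>a\<close>; the remaining \<open>s\<close> give the decay.\<close>
    define h where "h k = b k * (1 / of_nat (N k)) ^ (s + 2)" for k
    define h' where "h' k = (if k = k0 then 0 else h k)" for k
    have "h sums 0" unfolding h_def by (rule zero) simp
    then have "(\<lambda>k. h k - (if k = k0 then h k else 0)) sums (0 - h k0)"
      using sums_single[of k0 h] by (intro sums_diff) auto
    also have "(\<lambda>k. h k - (if k = k0 then h k else 0)) = h'"
      by (auto simp: h'_def fun_eq_iff)
    finally have h': "h' sums (- h k0)" by simp
    have bound: "norm (h' k) \<le> (1 / (q + 1)) ^ s * a k" for k
    proof (cases "k = k0 \<or> b k = 0")
      case True
      then show ?thesis using q by (auto simp: h'_def h_def a_def)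
    next
      case False
      then have "N k0 < N k" using k0(2)[of k] inj by (metis injD le_neq_implies_less)
      then have "q + 1 \<le> real (N k)" unfolding q_def by simp
      then have "(1 / real (N k)) ^ s \<le> (1 / (q + 1)) ^ s"
        using q by (intro power_mono divide_left_mono) auto
      then have "(1 / real (N k)) ^ s * a k \<le> (1 / (q + 1)) ^ s * a k"
        by (intro mult_right_mono) (auto simp: a_def)
      moreover have "norm (h' k) = (1 / real (N k)) ^ s * a k"
        using False by (simp add: h'_def h_def a_def norm_mult norm_divide norm_power power_add
            power2_eq_square power_divide)
      ultimately show ?thesis by simp
    qed
    have sa: "summable (\<lambda>k. (1 / (q + 1)) ^ s * a k)"
      unfolding a_def by (intro summable_mult sm)
    have "norm (h k0) = norm (suminf h')" using h' by (simp add: sums_iff)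
    also have "\<dots> \<le> (\<Sum>k. (1 / (q + 1)) ^ s * a k)"
      by (rule norm_suminf_le[OF bound sa])
    also have "\<dots> = (1 / (q + 1)) ^ s * suminf a"
      using sm by (intro suminf_mult) (simp add: a_def[abs_def])
    finally have "norm (h k0) \<le> (1 / (q + 1)) ^ s * suminf a" .
    moreover have "norm (h k0) = cmod (b k0) * (1 / q) ^ (s + 2)"
      by (simp add: h_def q_def norm_mult norm_divide norm_power)
    ultimately have "q ^ (s + 2) * (cmod (b k0) * (1 / q) ^ (s + 2))
        \<le> q ^ (s + 2) * ((1 / (q + 1)) ^ s * suminf a)"
      using q by (intro mult_left_mono) auto
    also have "q ^ (s + 2) * (cmod (b k0) * (1 / q) ^ (s + 2)) = cmod (b k0)"
      using q by (simp add: power_divide)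
    also have "q ^ (s + 2) * ((1 / (q + 1)) ^ s * suminf a) = \<theta> ^ s * (q ^ 2 * suminf a)"
      unfolding \<theta>_def by (simp add: power_add power_divide power2_eq_square)
    finally show ?thesis .
  qed
  have "(\<lambda>s. \<theta> ^ s * (q ^ 2 * suminf a)) \<longlonglongrightarrow> 0 * (q ^ 2 * suminf a)"
    using \<theta> by (intro tendsto_mult LIMSEQ_power_zero tendsto_const) auto
  then have "cmod (b k0) \<le> 0 * (q ^ 2 * suminf a)"
    by (rule LIMSEQ_le_const) (use le in blast)
  then show False using k0(1) by simp
qed

section \<open>The feature map of the kernel \<open>(1 - \<langle>u, v\<rangle>)\<^sup>t\<close>\<close>

text \<open>Coordinates of \<open>ell2\<close> are indexed by naturals, so the multisets are
  renumbered. The empty one is left out because the series has no constant term.\<close>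

lemma exists_enumeration: "\<exists>e :: nat \<Rightarrow> nat multiset. bij_betw e UNIV (- {{#}})"
proof -
  have "countable (range (mset :: nat list \<Rightarrow> nat multiset))" by simp
  then have "countable (- {{#}} :: nat multiset set)"
    by (rule countable_subset[rotated]) (metis subsetI surj_mset surjD UNIV_I rangeI)
  moreover have "infinite (- {{#}} :: nat multiset set)"
  proof
    assume "finite (- {{#}} :: nat multiset set)"
    then have "finite ((\<lambda>k::nat. replicate_mset (Suc k) (0::nat)) ` UNIV)"
      by (rule finite_subset[rotated]) auto
    moreover have "inj (\<lambda>k::nat. replicate_mset (Suc k) (0::nat))"
      by (rule injI) (metis size_replicate_mset nat.inject)
    ultimately have "finite (UNIV :: nat set)" by (rule finite_imageD)
    then show False by simp
  qed
  ultimately show ?thesis using bij_betw_from_nat_into by blast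
qed

definition nonempty_mset :: "nat \<Rightarrow> nat multiset" where
  "nonempty_mset = (SOME e. bij_betw e UNIV (- {{#}}))"

lemma bij_nonempty_mset: "bij_betw nonempty_mset UNIV (- {{#}})"
  using exists_enumeration unfolding nonempty_mset_def by (rule someI_ex)

lemma nonempty_mset [simp]: "nonempty_mset k \<noteq> {#}"
  using bij_betwE[OF bij_nonempty_mset] by blast

text \<open>Its square is the coefficient of the monomial \<open>M\<close> in the expansion of
  \<open>1 - (1 - cinner u v) powr t\<close>.\<close>

definition weight :: "real \<Rightarrow> nat multiset \<Rightarrow> real" where
  "weight t M = sqrt (binom_coeff t (size M) * orderings M)"

definition monomial :: "real \<Rightarrow> ell2 \<Rightarrow> nat multiset \<Rightarrow> complex" where
  "monomial t u M = of_real (weight t M) * (\<Prod>i\<in>#M. coord u i)"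

definition feature :: "real \<Rightarrow> ell2 \<Rightarrow> ell2" where
  "feature t u = Abs_ell2 (\<lambda>k. monomial t u (nonempty_mset k))"

lemma summable_norm_cinner: "summable (\<lambda>n. cmod (cnj (coord u n) * coord v n))"
proof (rule summable_comparison_test')
  show "summable (\<lambda>n. (cmod (coord u n))\<^sup>2 + (cmod (coord v n))\<^sup>2)"
    by (intro summable_add summable_coord)
  fix n
  have "2 * (cmod (coord u n) * cmod (coord v n)) \<le> (cmod (coord u n))\<^sup>2 + (cmod (coord v n))\<^sup>2"
    using sum_squares_bound[of "cmod (coord u n)" "cmod (coord v n)"] by (simp add: mult.assoc)
  moreover have "0 \<le> cmod (coord u n) * cmod (coord v n)" by simp
  ultimately show "norm (cmod (cnj (coord u n) * coord v n)) \<le> (cmod (coord u n))\<^sup>2 + (cmod (coord v n))\<^sup>2"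
    unfolding norm_mult complex_mod_cnj real_norm_def abs_mult abs_norm_cancel by linarith
qed

text \<open>Cauchy-Schwarz for the vectors of moduli. Absolute convergence of the expansion is
  governed by this sum rather than by \<open>cmod (cinner u v)\<close>, so it is this sum that must
  stay below 1.\<close>

lemma suminf_norm_cinner_le: "(\<Sum>n. cmod (cnj (coord u n) * coord v n)) \<le> norm u * norm v"
proof -
  have abs: "\<exists>a. coord a = (\<lambda>n. of_real (cmod (coord w n))) \<and> norm a = norm w" for w
  proof -
    have "coord (Abs_ell2 (\<lambda>n. of_real (cmod (coord w n)))) = (\<lambda>n. of_real (cmod (coord w n)))"
      by (rule coord_Abs) (simp add: summable_coord)
    moreover from this have "(norm (Abs_ell2 (\<lambda>n. of_real (cmod (coord w n)))))\<^sup>2 = (norm w)\<^sup>2"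
      unfolding power2_norm_ell2 by simp
    ultimately show ?thesis by (metis norm_ge_zero power2_eq_iff_nonneg)
  qed
  obtain a where a: "coord a = (\<lambda>n. of_real (cmod (coord u n)))" "norm a = norm u" using abs by blast
  obtain b where b: "coord b = (\<lambda>n. of_real (cmod (coord v n)))" "norm b = norm v" using abs by blast
  have "(\<Sum>n. cmod (cnj (coord u n) * coord v n)) = inner a b"
    unfolding inner_ell2_alt a b by (simp add: norm_mult)
  also have "\<dots> \<le> norm a * norm b" by (rule norm_cauchy_schwarz)
  finally show ?thesis unfolding a b .
qed

text \<open>A Goedel numbering: unique factorisation makes distinct multisets distinct integers, and
  the product of the i-th coordinates becomes a power of one integer.\<close>

definition prime_weight :: "nat multiset \<Rightarrow> nat" where
  "prime_weight M = (\<Prod>i\<in>#M. enumerate {p. prime p} i)"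

lemma prime_enumerate: "prime (enumerate {p::nat. prime p} i)"
  using enumerate_in_set[OF primes_infinite] by simp

lemma prime_weight_pos: "0 < prime_weight M"
  unfolding prime_weight_def using prime_enumerate by (induction M) (auto simp: prime_gt_0_nat)

lemma inj_prime_weight: "inj prime_weight"
proof (rule injI)
  fix M N assume "prime_weight M = prime_weight N"
  then have "prime_factorization (prime_weight M) = prime_factorization (prime_weight N)" by simp
  then have "image_mset (enumerate {p. prime p}) M = image_mset (enumerate {p::nat. prime p}) N"
    unfolding prime_weight_def
    by (subst (asm) (1 2) prime_factorization_prod_mset_primes) (auto simp: prime_enumerate)
  moreover have "inj (enumerate {p::nat. prime p})"
    by (intro strict_mono_imp_inj_on strict_mono_onI enumerate_mono primes_infinite)
  ultimately show "M = N" by (simp add: multiset.inj_map inj_eq)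
qed

section \<open>The feature map for exponents strictly between 0 and 1\<close>

context
  fixes t :: real assumes t: "0 < t" "t < 1"
begin

lemma weight_square: "weight t M * weight t M = binom_coeff t (size M) * orderings M"
  unfolding weight_def using binom_coeff_nonneg[OF t] by simp

lemma weight_pos: "M \<noteq> {#} \<Longrightarrow> 0 < weight t M"
  unfolding weight_def
  using binom_coeff_pos[OF t, of "size M"] orderings_pos[of M] by (simp add: nonempty_has_size)

lemma has_sum_monomial:
  assumes "norm u < 1" "norm v < 1"
  shows "((\<lambda>M. cnj (monomial t u M) * monomial t v M) has_sum (1 - (1 - cinner u v) powr of_real t)) UNIV"
proof -
  define x where "x i = cnj (coord u i) * coord v i" for i
  define r where "r = (\<Sum>i. cmod (x i))"
  have sm: "summable (\<lambda>i. cmod (x i))" unfolding x_def by (rule summable_norm_cinner)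
  have "r \<le> norm u * norm v" unfolding r_def x_def by (rule suminf_norm_cinner_le)
  also have "\<dots> < 1 * 1" by (intro mult_strict_mono' assms norm_ge_zero)
  finally have r1: "r < 1" by simp
  have r0: "0 \<le> r" unfolding r_def by (intro suminf_nonneg sm) simp
  have z: "cmod (cinner u v) < 1"
    using r1 summable_norm[OF sm] unfolding r_def cinner_def x_def by simp
  have "((\<lambda>M. of_real (binom_coeff t (size M) * orderings M) * (\<Prod>i\<in>#M. x i))
      has_sum (1 - (1 - cinner u v) powr of_real t)) UNIV"
  proof (rule has_sum_power_series_multisets)
    show "(x has_sum cinner u v) UNIV"
      using sm unfolding x_def cinner_def
      by (intro norm_summable_imp_has_sum summable_sums summable_cinner)
    show "((\<lambda>i. cmod (x i)) has_sum r) UNIV"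
      unfolding r_def by (intro norm_summable_imp_has_sum summable_sums) (simp_all add: sm)
    show "(\<lambda>n. binom_coeff t n * r ^ n) summable_on UNIV"
      by (rule binom_coeff_summable[OF t r0 r1])
    show "((\<lambda>n. of_real (binom_coeff t n) * cinner u v ^ n) has_sum (1 - (1 - cinner u v) powr of_real t)) UNIV"
    proof (rule norm_summable_imp_has_sum[OF _ binom_coeff_sums[OF z]])
      have "(\<lambda>n. binom_coeff t n * cmod (cinner u v) ^ n) summable_on UNIV"
        by (rule binom_coeff_summable[OF t _ z]) simp
      then have "summable (\<lambda>n. binom_coeff t n * cmod (cinner u v) ^ n)"
        by (rule summable_on_imp_summable)
      then show "summable (\<lambda>n. norm (of_real (binom_coeff t n) * cinner u v ^ n))"
        by (simp add: norm_mult norm_power binom_coeff_nonneg[OF t])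
    qed
  qed (rule binom_coeff_nonneg[OF t])
  moreover have "of_real (binom_coeff t (size M) * orderings M) * (\<Prod>i\<in>#M. x i)
      = cnj (monomial t u M) * monomial t v M" for M
  proof -
    have "(\<Prod>i\<in>#M. x i) = cnj (\<Prod>i\<in>#M. coord u i) * (\<Prod>i\<in>#M. coord v i)"
      by (induction M) (simp_all add: x_def mult_ac)
    then show ?thesis unfolding monomial_def weight_square[symmetric] by (simp add: mult_ac)
  qed
  ultimately show ?thesis by simp
qed

lemma monomial_sums:
  assumes "norm u < 1" "norm v < 1"
  shows "(\<lambda>k. cnj (monomial t u (nonempty_mset k)) * monomial t v (nonempty_mset k)) sums
    (1 - (1 - cinner u v) powr of_real t)"
proof -
  have "monomial t u {#} = 0" by (simp add: monomial_def weight_def binom_coeff_def)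
  then have "((\<lambda>M. cnj (monomial t u M) * monomial t v M) has_sum (1 - (1 - cinner u v) powr of_real t)) (- {{#}})"
    using has_sum_monomial[OF assms] by (subst has_sum_cong_neutral[where T = UNIV]) auto
  then show ?thesis
    using has_sum_reindex_bij_betw[OF bij_nonempty_mset,
        of "\<lambda>M. cnj (monomial t u M) * monomial t v M"] by (intro has_sum_imp_sums) simp
qed

lemma coord_feature:
  assumes u: "norm u < 1" shows "coord (feature t u) k = monomial t u (nonempty_mset k)"
proof -
  have "summable (\<lambda>k. Re (cnj (monomial t u (nonempty_mset k)) * monomial t u (nonempty_mset k)))"
    by (intro summable_Re sums_summable[OF monomial_sums[OF u u]])
  then have "summable (\<lambda>k. (cmod (monomial t u (nonempty_mset k)))\<^sup>2)"
    unfolding cmod_power2 by (simp add: power2_eq_square)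
  then show ?thesis unfolding feature_def by (simp add: coord_Abs)
qed

lemma cinner_feature:
  assumes "norm u < 1" "norm v < 1"
  shows "cinner (feature t u) (feature t v) = 1 - (1 - cinner u v) powr of_real t"
  unfolding cinner_def[of "feature t u"] coord_feature[OF assms(1)] coord_feature[OF assms(2)]
  by (rule sums_unique[symmetric, OF monomial_sums[OF assms]])

text \<open>On the points \<open>u\<^sub>i = p\<^sub>i\<^sup>-\<^sup>s\<close>, with \<open>p\<^sub>i\<close> the \<open>i\<close>-th prime, the monomials become the terms
  \<open>n\<^sup>-\<^sup>s\<close> of a Dirichlet series.\<close>
lemma exists_prime_point:
  assumes s: "2 \<le> s"
  shows "\<exists>u. norm u < 1 \<and>
    (\<forall>M. monomial t u M = of_real (weight t M) * (1 / of_nat (prime_weight M)) ^ s)"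
proof -
  define p where "p = enumerate {p::nat. prime p}"
  define x where "x i = (1 / of_nat (p i) :: complex) ^ s" for i
  \<comment> \<open>Both \<open>p i >= 2\<close> and \<open>p i >= i + 1\<close> are used, one for
    each of two factors available since \<open>s >= 2\<close>. Summing gives squared norm at most
    \<open>pi^2 / 24 < 1\<close>.\<close>
  have le: "(cmod (x i))\<^sup>2 \<le> (1 / 4) * (1 / (real i + 1)\<^sup>2)" for i
  proof -
    have p2: "2 \<le> p i" unfolding p_def using prime_enumerate prime_ge_2_nat by blast
    have "Suc i \<le> p i"
    proof (induction i)
      case 0
      show ?case unfolding p_def using prime_gt_0_nat[OF prime_enumerate[of 0]] by simp
    next
      case (Suc i)
      then show ?case using enumerate_step[OF primes_infinite, of i] unfolding p_def by linarith
    qed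
    then have pi: "real i + 1 \<le> real (p i)" by linarith
    have "cmod (x i) = (1 / real (p i)) ^ s" by (simp add: x_def norm_power norm_divide)
    also have "\<dots> \<le> (1 / real (p i)) ^ 2" using p2 s by (intro power_decreasing) auto
    also have "\<dots> = (1 / real (p i)) * (1 / real (p i))" by (rule power2_eq_square)
    also have "\<dots> \<le> (1 / 2) * (1 / (real i + 1))"
      using p2 pi by (intro mult_mono divide_left_mono) auto
    finally have "(cmod (x i))\<^sup>2 \<le> ((1 / 2) * (1 / (real i + 1)))\<^sup>2" by (intro power_mono) auto
    also have "\<dots> = (1 / 4) * (1 / (real i + 1)\<^sup>2)"
      unfolding power_mult_distrib power_divide by simp
    finally show ?thesis .
  qed
  have bound: "(\<lambda>i. (1 / 4) * (1 / (real i + 1)\<^sup>2)) sums ((1 / 4) * (pi\<^sup>2 / 6))"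
    using inverse_squares_sums by (intro sums_mult) (simp add: add.commute)
  have "summable (\<lambda>i. (cmod (x i))\<^sup>2)"
    by (rule summable_comparison_test'[OF sums_summable[OF bound]]) (use le in simp)
  define u where "u = Abs_ell2 x"
  have u: "coord u = x" unfolding u_def by (rule coord_Abs) fact
  have "(norm u)\<^sup>2 \<le> (1 / 4) * (pi\<^sup>2 / 6)"
    unfolding power2_norm_ell2 u using \<open>summable _\<close> le bound
    by (metis (no_types, lifting) sums_iff suminf_le)
  also have "\<dots> < 1"
  proof -
    have "pi\<^sup>2 < 4\<^sup>2" using pi_less_4 pi_gt_zero by (intro power_strict_mono) auto
    then show ?thesis by simp
  qed
  finally have "norm u < 1" by (simp add: power_less_one_iff abs_square_less_1)
  moreover have "(\<Prod>i\<in>#M. coord u i) = (1 / of_nat (prime_weight M)) ^ s" for M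
    unfolding u prime_weight_def x_def p_def
    by (induction M) (simp_all add: power_mult_distrib power_divide)
  ultimately show ?thesis unfolding monomial_def by (intro exI[of _ u]) simp
qed

lemma feature_zero: "feature t 0 = 0"
proof (rule ell2_eqI)
  fix k
  obtain i M where "nonempty_mset k = add_mset i M" using nonempty_mset[of k] by (metis multiset_cases)
  then show "coord (feature t 0) k = coord 0 k"
    by (simp add: coord_feature monomial_def)
qed

text \<open>Testing at \<open>u = 0\<close> kills the first component. At the prime points,
  orthogonality of the second becomes the vanishing of a Dirichlet series with coefficients
  \<open>b k\<close>, and the positive weights pass the conclusion on to \<open>v\<close>.\<close>

lemma feature_total:
  assumes Y: "\<And>u. norm u < 1 \<Longrightarrow> B (1, feature t u) Y = 0" shows "Y = 0"
proof -
  obtain w v where wv: "Y = (w, v)" by (cases Y)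
  have w: "w = 0" using Y[of 0] unfolding wv feature_zero by (simp add: cinner_simps(5))
  have orth: "cinner (feature t u) v = 0" if "norm u < 1" for u using Y[OF that] unfolding wv w by simp
  define N where "N k = prime_weight (nonempty_mset k)" for k
  define b where "b k = of_real (weight t (nonempty_mset k)) * coord v k" for k
  have prime_term: "\<exists>u. norm u < 1 \<and> (\<forall>k. cnj (coord (feature t u) k) * coord v k = b k * (1 / of_nat (N k)) ^ s)"
    if s: "2 \<le> s" for s
  proof -
    obtain u where u: "norm u < 1"
      "\<And>M. monomial t u M = of_real (weight t M) * (1 / of_nat (prime_weight M)) ^ s"
      using exists_prime_point[OF s] by blast
    show ?thesis using u(1) by (auto simp: coord_feature u(2) b_def N_def intro!: exI[of _ u])
  qed
  have "b k = 0" for k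
  proof (rule Dirichlet_unique)
    show "inj N" unfolding N_def
      using inj_prime_weight bij_nonempty_mset by (auto simp: bij_betw_def inj_on_def)
    show "0 < N k" for k unfolding N_def by (rule prime_weight_pos)
    show "summable (\<lambda>k. cmod (b k) / real (N k) ^ 2)"
    proof -
      obtain u where "\<And>k. cnj (coord (feature t u) k) * coord v k = b k * (1 / of_nat (N k)) ^ 2"
        using prime_term[of 2] by auto
      then show ?thesis using summable_norm_cinner[of "feature t u" v]
        by (simp add: norm_mult norm_power norm_divide power_divide)
    qed
    show "(\<lambda>k. b k * (1 / of_nat (N k)) ^ s) sums 0" if s: "2 \<le> s" for s
    proof -
      obtain u where u: "norm u < 1"
        "\<And>k. cnj (coord (feature t u) k) * coord v k = b k * (1 / of_nat (N k)) ^ s"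
        using prime_term[OF s] by auto
      show ?thesis
        using summable_sums[OF summable_cinner[of "feature t u" v]] orth[OF u(1)]
        unfolding cinner_def u(2) by simp
    qed
  qed
  then have "coord v k = 0" for k
    using weight_pos[OF nonempty_mset, of k] unfolding b_def by (metis less_irrefl mult_eq_0_iff of_real_eq_0_iff)
  then have "v = 0" by (intro ell2_eqI) simp
  then show ?thesis unfolding wv w by (simp add: zero_prod_def)
qed

lemma kernel_power_feature: "kernel_power t (feature t) (\<lambda>k. size (nonempty_mset k))"
proof
  show "0 < t" "t \<le> 1" using t by auto
  show "1 - cinner (feature t u) (feature t v) = (1 - cinner u v) powr of_real t"
    if "norm u < 1" "norm v < 1" for u v
    by (simp add: cinner_feature[OF that])
  show "coord (feature t (scaleC c u)) k = c ^ size (nonempty_mset k) * coord (feature t u) k"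
    if u: "norm u < 1" and c: "cmod c = 1" for u c k
  proof -
    have cu: "norm (scaleC c u) < 1" using u c by (simp add: norm_scaleC)
    have P: "(\<Prod>i\<in>#M. coord (scaleC c u) i) = c ^ size M * (\<Prod>i\<in>#M. coord u i)" for M
      by (induction M) (simp_all add: mult_ac)
    show ?thesis unfolding coord_feature[OF u] coord_feature[OF cu] monomial_def P
      by (rule mult.left_commute)
  qed
  show "0 < size (nonempty_mset k)" for k by (simp add: nonempty_has_size[symmetric])
  show "Y = 0" if "\<And>u. norm u < 1 \<Longrightarrow> B (1, feature t u) Y = 0" for Y
    by (rule feature_total[OF that])
qed

end

theorem theorem1p13:
  fixes t :: real
  assumes "0 < t" and "t \<le> 1"
  shows "\<exists>(\<rho> :: (chyp \<Rightarrow> chyp) \<Rightarrow> (chyp \<Rightarrow> chyp)) (f :: chyp \<Rightarrow> chyp).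
    \<rho> \<in> hom Is Is \<and>
    continuous_on (carrier Is) \<rho> \<and>
    irreducible_action (carrier Is) \<rho> \<and>
    (\<forall>g\<in>carrier Is. \<forall>x. f (g x) = \<rho> g (f x)) \<and>
    (\<forall>x y. cosh (dist (f x) (f y)) = (cosh (dist x y)) powr t) \<and>
    (\<forall>x y z. Cart (f x) (f y) (f z) = t * Cart x y z)"
proof (cases "t = 1")
  case True
  show ?thesis unfolding True by (rule kernel_power.exists_representation[OF kernel_power_id])
next
  case False
  with assms have "t < 1" by simp
  show ?thesis
    by (rule kernel_power.exists_representation[OF kernel_power_feature[OF assms(1) \<open>t < 1\<close>]])
qed

end
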